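(* Let $C$ be a reduced singular plane curve, let $L_0=Z(x_0),\dots,L_m=Z(x_m)$ be a sequence of maximal contact curves of the minimal embedded resolution $\psi_C$ of $C$ which is generic for $C$, and set $D=\bigcup_{j=0}^m L_j$. Let $\mathcal U$ be the set of semivaluations $\nu$ of $R=k[[X,Y]]$ such that $\nu(x_j)<\infty$ for $j=0,\dots,m$, and let $\mathrm{trop}(\nu)=(\nu(x_0),\dots,\nu(x_m))$. Then $$\mathrm{trop}(\mathcal U)=|\mathcal T|:=\mathbb R_{\ge0}\{\,w^P\mid P\in\Theta_{L_0}(D)\,\}.$$
   Context: $k$ is an algebraically closed field of arbitrary characteristic, $S=\mathrm{Spec}\,k[X,Y]$, $O$ the origin, $R=k[[X,Y]]$ with maximal ideal $m_R$. Plane curves are $Z(f)$, $f\in m_R$; branches are $Z(f)$ with $f$ irreducible; $(Z(f)\cdot Z(g))=\dim_kR/(f,g)$. $(L,L')$ is a cross if $L=Z(x),L'=Z(y)$ with $(x,y)=m_R$. A model $\psi\colon S(\psi)\to S$ is a composition of blow-ups of a finite (possibly empty) set of points infinitely near $O$; $E(\psi)=\psi^{-1}(O)$ reduced. Its dual graph has one vertex per exceptional prime divisor, two joined if they intersect; ends are vertices of valency one. A branch $A$ is a curvetta of an exceptional prime divisor $E$ at $\psi$ if its strict transform $A^\psi$ is smooth and transversal to $E$ at a smooth point of $E(\psi)$. $\psi$ is an embedded resolution of $C$ if $C^\psi+E(\psi)$ has simple normal crossings. A sequence of maximal contact curves of $\psi$ is $L_0,\dots,L_m$ with $L_i$ a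 curvetta at $\psi$ of $E_i$, where $E_0,\dots,E_m$ are the divisors corresponding to the ends of the dual graph, in order of creation; if $\psi$ is the identity or the blow-up of $O$, it is a cross $L_0,L_1$. It is generic for $C$ (when $\psi=\psi_C$) if $(C^{\psi_C}\cdot L_i^{\psi_C})=0$ for all $i$. The branch $L_0$ is smooth. A semivaluation of $R$ is a map $\nu\colon R\to[0,\infty]$ with $\nu(fg)=\nu(f)+\nu(g)$, $\nu(f+g)\ge\min(\nu(f),\nu(g))$, $\nu(0)=\infty$ and $\nu(\lambda)=0$ for $\lambda\in k^*$. Eggers–Wall tree. For branches $A,B\ne L_0$ put $c(A,B)=\frac{(A\cdot B)}{(L_0\cdot A)(L_0\cdot B)}$ if $A\ne B$ and $c(A,A)=\infty$. $\Theta_{L_0}(D)$ is the rooted tree obtained from the segments $[0,\infty]\times\{i\}$, $1\le i\le m$, by identifying $(c,i)$ with $(c,j)$ whenever $c\le c(L_i,L_j)$; the root ($c=0$) is labelled $L_0$ and the leaf $(\infty,i)$ is labelled $L_i$. The first coordinate is the contact complexity function $\mathbf c_{L_0}$. The interior points are those different from the root and the leaves. If $P=(c,i)$ is an interior point, then $w^P=(w^P_0,\dots,w^P_m)$ is defined by $w_0^P=1$ and $w_j^P=(L_0\cdot L_j)\cdot\mathbf c_{L_0}(\langle L_0,P,L_j\rangle)=(L_0\cdot L_j)\min\{c,c(L_i,L_j)\}$ for $1\le j\le m$, where $\langle L_0,P,L_j\rangle$ is the common point of the three segments joining $L_0,P,L_j$ pairwise. At the ends, $w^{L_j}=e_j$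 for $0\le j\le m$, where $e_0,\dots,e_m$ is the canonical basis of $\mathbb R^{m+1}$. For $X\subset\mathbb R^{m+1}$, $\mathbb R_{\ge0}X=\{ax\mid a\in\mathbb R_{>0},x\in X\}\cup\{0\}$. *)

theory Defs
  imports
    "HOL-Computational_Algebra.Computational_Algebra"
    "HOL-Library.Extended_Nonnegative_Real"
begin

section \<open>The ring \<open>R = k[[X,Y]]\<close> and plane curves\<close>

text \<open>The ring \<open>R\<close> is \<open>k[[X]][[Y]]\<close>: the outer index is the exponent of \<open>Y\<close>.\<close>

type_synonym 'a pseries = "'a fps fps"

definition cf :: "'a pseries \<Rightarrow> nat \<Rightarrow> nat \<Rightarrow> 'a" where
  "cf f i j = fps_nth (fps_nth f j) i"

definition varX :: "'a::comm_ring_1 pseries" where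
  "varX = fps_const fps_X"

definition varY :: "'a::comm_ring_1 pseries" where
  "varY = fps_X"

definition cnst :: "'a::comm_ring_1 \<Rightarrow> 'a pseries" where
  "cnst c = fps_const (fps_const c)"

definition maxideal :: "'a::field pseries set" where
  "maxideal = {f. cf f 0 0 = 0}"

definition mult :: "'a::field pseries \<Rightarrow> nat" where
  "mult f = (LEAST n. \<exists>i j. i + j = n \<and> cf f i j \<noteq> 0)"

definition ideal2 :: "'a::field pseries \<Rightarrow> 'a pseries \<Rightarrow> 'a pseries set" where
  "ideal2 f g = {a * f + b * g | a b. True}"

text \<open>The classes of the elements of \<open>B\<close> are pairwise distinct and form a
  \<open>k\<close>-basis of \<open>R/I\<close>: each class has unique coordinates with respect to \<open>B\<close>.\<close>

definition quotient_basis :: "'a::field pseries set \<Rightarrow> 'a pseries set \<Rightarrow> bool" where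
  "quotient_basis I B \<longleftrightarrow> finite B \<and>
     (\<forall>f. \<exists>!c. (\<forall>b. b \<notin> B \<longrightarrow> c b = 0) \<and> f - (\<Sum>b\<in>B. cnst (c b) * b) \<in> I)"

definition quotient_dim :: "'a::field pseries set \<Rightarrow> enat" where
  "quotient_dim I =
     (if \<exists>B. quotient_basis I B then enat (card (SOME B. quotient_basis I B)) else \<infinity>)"

definition intersection :: "'a::field pseries \<Rightarrow> 'a pseries \<Rightarrow> enat" where
  "intersection f g = quotient_dim (ideal2 f g)"

definition cross :: "'a::field pseries \<Rightarrow> 'a pseries \<Rightarrow> bool" where
  "cross f g \<longleftrightarrow> ideal2 f g = maxideal"

definition same_curve :: "'a::field pseries \<Rightarrow> 'a pseries \<Rightarrow> bool" where
  "same_curve f g \<longleftrightarrow> f dvd g \<and> g dvd f"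

section \<open>Infinitely near points, strict transforms and models\<close>

text \<open>Substitution \<open>f(a,b)\<close> for \<open>a, b\<close> in the maximal ideal. As \<open>a^i * b^j\<close> has order at
  least \<open>i + j\<close>, only the terms with \<open>i + j \<le> n + l\<close> contribute to the coefficient of
  \<open>X^n * Y^l\<close>.\<close>

definition subst2 :: "'a::field pseries \<Rightarrow> 'a pseries \<Rightarrow> 'a pseries \<Rightarrow> 'a pseries" where
  "subst2 f a b = Abs_fps (\<lambda>l. Abs_fps (\<lambda>n.
     \<Sum>(i, j)\<in>{(i, j). i + j \<le> n + l}. cf f i j * cf (a ^ i * b ^ j) n l))"

text \<open>The exceptional curve of the blow-up of a point with local coordinates \<open>(x, y)\<close> is the
  projective line of tangent directions at that point. At the direction \<open>Slope t\<close>
  (the line \<open>y = t * x\<close>) we use the local coordinates \<open>(X, Y)\<close> with \<open>x = X\<close>,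
  \<open>y = X * (Y + t)\<close>, and at the direction \<open>Vertical\<close> (the line \<open>x = 0\<close>) those with
  \<open>x = X * Y\<close>, \<open>y = Y\<close>. The exceptional curve is then \<open>X = 0\<close>, respectively \<open>Y = 0\<close>.

  Since \<open>k\<close> is algebraically closed, a point infinitely near \<open>O\<close> is a finite word of
  directions, the most recent one first: \<open>[]\<close> is \<open>O\<close>, and \<open>d # p\<close> is the point \<open>d\<close> of the
  exceptional curve of the blow-up of \<open>p\<close>. Completed local rings at all these points are
  identified with \<open>R\<close> by the coordinates above.\<close>

datatype 'a direction = Slope 'a | Vertical

type_synonym 'a inpoint = "'a direction list"

fun pullback :: "'a::field direction \<Rightarrow> 'a pseries \<Rightarrow> 'a pseries" where
  "pullback (Slope t) f = subst2 f varX (varX * (varY + cnst t))"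
| "pullback Vertical f = subst2 f (varX * varY) varY"

fun exceptional :: "'a::field direction \<Rightarrow> 'a pseries" where
  "exceptional (Slope t) = varX"
| "exceptional Vertical = varY"

definition strict1 :: "'a::field direction \<Rightarrow> 'a pseries \<Rightarrow> 'a pseries" where
  "strict1 d f = (THE g. pullback d f = exceptional d ^ mult f * g)"

text \<open>A local equation at the point \<open>p\<close> of the strict transform of \<open>Z(f)\<close>;
  it is a unit if the strict transform does not pass through \<open>p\<close>.\<close>

fun strict :: "'a::field inpoint \<Rightarrow> 'a pseries \<Rightarrow> 'a pseries" where
  "strict [] f = f"
| "strict (d # p) f = strict1 d (strict p f)"

text \<open>A local equation at \<open>p\<close> of the exceptional prime divisor \<open>E\<^sub>q\<close> created by blowing up \<open>q\<close>;
  it is a unit if \<open>E\<^sub>q\<close> does not pass through \<open>p\<close>, in particular if \<open>p\<close> is not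
  infinitely near \<open>q\<close>.\<close>

fun divisor_eq :: "'a::field inpoint \<Rightarrow> 'a inpoint \<Rightarrow> 'a pseries" where
  "divisor_eq q [] = 1"
| "divisor_eq q (d # p) =
     (if p = q then exceptional d else strict1 d (divisor_eq q p))"

text \<open>A model, presented as the list of blown up points in the order in which they are
  blown up. A point may be blown up once the point it is created from has been. The exceptional
  prime divisors are indexed by \<open>set ps\<close>, and \<open>ps\<close> lists them in order of creation.\<close>

definition model :: "'a inpoint list \<Rightarrow> bool" where
  "model ps \<longleftrightarrow> distinct ps \<and>
     (\<forall>n < length ps. ps ! n = [] \<or> tl (ps ! n) \<in> set (take n ps))"

text \<open>The points of the surface of the model lying above \<open>O\<close>.\<close>

definition points_over_O :: "'a inpoint list \<Rightarrow> 'a inpoint set" where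
  "points_over_O ps = {p. p \<notin> set ps \<and> (p = [] \<or> tl p \<in> set ps)}"

text \<open>A local equation at \<open>p\<close> of the reduced exceptional divisor; it is \<open>1\<close> for the
  identity model, which has no exceptional prime divisor.\<close>

definition total_divisor_eq :: "'a::field inpoint list \<Rightarrow> 'a inpoint \<Rightarrow> 'a pseries" where
  "total_divisor_eq ps p = (\<Prod>q\<in>set ps. divisor_eq q p)"

definition adjacent :: "'a::field inpoint list \<Rightarrow> 'a inpoint \<Rightarrow> 'a inpoint \<Rightarrow> bool" where
  "adjacent ps q r \<longleftrightarrow> q \<in> set ps \<and> r \<in> set ps \<and> q \<noteq> r \<and>
     (\<exists>p\<in>points_over_O ps. divisor_eq q p \<in> maxideal \<and> divisor_eq r p \<in> maxideal)"

definition is_end :: "'a::field inpoint list \<Rightarrow> 'a inpoint \<Rightarrow> bool" where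
  "is_end ps q \<longleftrightarrow> q \<in> set ps \<and> card {r. adjacent ps q r} = 1"

definition curvetta :: "'a::field inpoint list \<Rightarrow> 'a inpoint \<Rightarrow> 'a pseries \<Rightarrow> bool" where
  "curvetta ps q f \<longleftrightarrow> irreducible f \<and> q \<in> set ps \<and>
     (\<exists>p. {p' \<in> points_over_O ps. strict p' f \<in> maxideal} = {p} \<and>
          mult (strict p f) = 1 \<and>
          divisor_eq q p \<in> maxideal \<and> mult (total_divisor_eq ps p) = 1 \<and>
          cross (strict p f) (divisor_eq q p))"

section \<open>Embedded resolutions and maximal contact curves\<close>

text \<open>Unit factors are absorbed in the local coordinates \<open>a, b\<close>. Simplicity is automatic, as
  branches and exceptional prime divisors are unibranch at each point.\<close>

definition normal_crossings :: "'a::field pseries \<Rightarrow> bool" where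
  "normal_crossings h \<longleftrightarrow> h dvd 1 \<or> (\<exists>a b. cross a b \<and> (h = a \<or> h = a * b))"

text \<open>The smoothness of the strict transform is implied by the normal crossings condition, except
  for the identity model, which has no exceptional divisor: there it expresses that the identity
  does not resolve an ordinary double point.\<close>

definition embedded_resolution :: "'a::field inpoint list \<Rightarrow> 'a pseries \<Rightarrow> bool" where
  "embedded_resolution ps f \<longleftrightarrow> model ps \<and>
     (\<forall>p\<in>points_over_O ps. mult (strict p f) \<le> 1 \<and>
        normal_crossings (strict p f * total_divisor_eq ps p))"

text \<open>A model factors through another one if and only if it blows up all the points which
  the latter blows up.\<close>

definition minimal_embedded_resolution :: "'a::field inpoint list \<Rightarrow> 'a pseries \<Rightarrow> bool" where
  "minimal_embedded_resolution ps f \<longleftrightarrow> embedded_resolution ps f \<and>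
     (\<forall>qs. embedded_resolution qs f \<longrightarrow> set ps \<subseteq> set qs)"

definition reduced_curve :: "'a::field pseries \<Rightarrow> bool" where
  "reduced_curve f \<longleftrightarrow> f \<in> maxideal \<and> squarefree f"

definition singular_curve :: "'a::field pseries \<Rightarrow> bool" where
  "singular_curve f \<longleftrightarrow> mult f \<ge> 2"

definition smooth_curve :: "'a::field pseries \<Rightarrow> bool" where
  "smooth_curve f \<longleftrightarrow> mult f = 1"

text \<open>The models with at most one blown up point are the identity and the blow-up of \<open>O\<close>.

  The order of creation, and hence the choice of the first end, depends on the chosen sequence of
  blow-ups. If the curve has several branches, some sequences lead to a first end whose
  curvettas are singular, so smoothness of \<open>Z(x 0)\<close> has to be required separately.\<close>

definition maximal_contact_curves ::
    "'a::field inpoint list \<Rightarrow> nat \<Rightarrow> (nat \<Rightarrow> 'a pseries) \<Rightarrow> bool" where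
  "maximal_contact_curves ps m x \<longleftrightarrow>
     (if length ps \<le> 1 then m = 1 \<and> cross (x 0) (x 1)
      else length (filter (is_end ps) ps) = m + 1 \<and>
           (\<forall>i\<le>m. curvetta ps (filter (is_end ps) ps ! i) (x i)))"

definition generic_for ::
    "'a::field inpoint list \<Rightarrow> nat \<Rightarrow> (nat \<Rightarrow> 'a pseries) \<Rightarrow> 'a pseries \<Rightarrow> bool" where
  "generic_for ps m x f \<longleftrightarrow>
     (\<forall>i\<le>m. \<forall>p\<in>points_over_O ps. intersection (strict p f) (strict p (x i)) = 0)"

section \<open>Semivaluations and tropicalization\<close>

definition semivaluation :: "('a::field pseries \<Rightarrow> ennreal) \<Rightarrow> bool" where
  "semivaluation \<nu> \<longleftrightarrow>
     (\<forall>f g. \<nu> (f * g) = \<nu> f + \<nu> g) \<and>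
     (\<forall>f g. \<nu> (f + g) \<ge> min (\<nu> f) (\<nu> g)) \<and>
     \<nu> 0 = \<infinity> \<and> (\<forall>c. c \<noteq> 0 \<longrightarrow> \<nu> (cnst c) = 0)"

text \<open>Vectors of \<open>\<real>\<^sup>m\<^sup>+\<^sup>1\<close> are functions \<open>nat \<Rightarrow> real\<close> vanishing at all indices \<open>> m\<close>.\<close>

definition unit_vec :: "nat \<Rightarrow> nat \<Rightarrow> real" where
  "unit_vec i = (\<lambda>j. if j = i then 1 else 0)"

definition trop ::
    "nat \<Rightarrow> (nat \<Rightarrow> 'a::field pseries) \<Rightarrow> ('a pseries \<Rightarrow> ennreal) \<Rightarrow> nat \<Rightarrow> real" where
  "trop m x \<nu> = (\<lambda>j. if j \<le> m then enn2real (\<nu> (x j)) else 0)"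

definition cone_over :: "(nat \<Rightarrow> real) set \<Rightarrow> (nat \<Rightarrow> real) set" where
  "cone_over V = {(\<lambda>j. a * v j) | a v. a > 0 \<and> v \<in> V} \<union> {\<lambda>_. 0}"

section \<open>The Eggers-Wall tree and its embedding\<close>

definition contact :: "'a::field pseries \<Rightarrow> 'a pseries \<Rightarrow> 'a pseries \<Rightarrow> ennreal" where
  "contact L0 f g =
     (if same_curve f g then \<infinity>
      else ennreal_of_enat (intersection f g) /
           (ennreal_of_enat (intersection L0 f) * ennreal_of_enat (intersection L0 g)))"

definition EW_segments :: "nat \<Rightarrow> (ennreal \<times> nat) set" where
  "EW_segments m = UNIV \<times> {1..m}"

definition EW_rel ::
    "nat \<Rightarrow> (nat \<Rightarrow> 'a::field pseries) \<Rightarrow> ((ennreal \<times> nat) \<times> (ennreal \<times> nat)) set" where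
  "EW_rel m x = {((c, i), (d, j)). i \<in> {1..m} \<and> j \<in> {1..m} \<and>
                    c = d \<and> c \<le> contact (x 0) (x i) (x j)}"

definition EW_tree :: "nat \<Rightarrow> (nat \<Rightarrow> 'a::field pseries) \<Rightarrow> (ennreal \<times> nat) set set" where
  "EW_tree m x = EW_segments m // EW_rel m x"

fun w_rep :: "nat \<Rightarrow> (nat \<Rightarrow> 'a::field pseries) \<Rightarrow> ennreal \<times> nat \<Rightarrow> nat \<Rightarrow> real" where
  "w_rep m x (c, i) =
     (if c = 0 then unit_vec 0
      else if c = \<infinity> then unit_vec i
      else (\<lambda>j. if j = 0 then 1
                else if j \<le> m then
                  enn2real (ennreal_of_enat (intersection (x 0) (x j)) *
                            min c (contact (x 0) (x i) (x j)))
                else 0))"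

text \<open>The value of \<open>w_rep\<close> does not depend on the representative of the point \<open>P\<close> of the tree;
  \<open>w_vec\<close> is the common value on the class \<open>P\<close>.\<close>

definition w_vec ::
    "nat \<Rightarrow> (nat \<Rightarrow> 'a::field pseries) \<Rightarrow> (ennreal \<times> nat) set \<Rightarrow> nat \<Rightarrow> real" where
  "w_vec m x P = the_elem (w_rep m x ` P)"

end

theory Submission
  imports "HOL-Algebra.Algebraic_Closure_Type" "HOL-Library.Function_Algebras" Defs
begin

text \<open>The statement holds for every sequence of pairwise distinct branches \<open>Z(x\<^sub>0), \<dots>, Z(x\<^sub>m)\<close> with
  \<open>m \<ge> 1\<close> and \<open>Z(x\<^sub>0)\<close> smooth (\<open>trop_eq_cone\<close>). Maximal contact curves are such a sequence, because
  a model with at least two blown up points has at least two ends (\<open>two_ends\<close>) and curvettas of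
  different exceptional divisors are different curves (\<open>curvettas_distinct\<close>).

  For such a sequence, the smooth branch \<open>Z(x\<^sub>0)\<close> is made the axis \<open>X = 0\<close> by a change of
  coordinates (\<open>straighten_smooth\<close>), which preserves semivaluations and intersection numbers. By the
  Weierstrass preparation theorem every other branch is then given by the minimal polynomial \<open>W\<close>
  over \<open>k[[X]]\<close> of a point \<open>a\<close> of the algebraic closure of \<open>k((X))\<close> (\<open>branch_data_exists\<close>). This
  works in every characteristic, as no Puiseux parametrization is involved. The closure carries a
  unique absolute value \<open>|\<cdot>|\<close> with \<open>|X| = e\<^sup>-\<^sup>1\<close>. It is invariant under conjugation
  (\<open>conjugate_absv\<close>) and computes intersection numbers: \<open>(Z(W) \<cdot> Z(g))\<close> is \<open>deg W\<close> times
  \<open>- log |g(a)|\<close> (\<open>codim_eq_absv\<close>).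

  The inclusion of the tropicalization in the cone rests on the three-branch relation
  (\<open>three_branches\<close>): if a semivaluation \<open>\<nu>\<close> is positive and finite on \<open>x\<^sub>0\<close>, \<open>x\<^sub>i\<close> and \<open>x\<^sub>j\<close>, then
  the minimum of \<open>\<nu>(x\<^sub>i) / (L\<^sub>0 \<cdot> L\<^sub>i)\<close>, \<open>\<nu>(x\<^sub>j) / (L\<^sub>0 \<cdot> L\<^sub>j)\<close> and \<open>\<nu>(x\<^sub>0) c(L\<^sub>i, L\<^sub>j)\<close> is attained
  at least twice. For its proof, in coordinates with \<open>x\<^sub>0 = X\<close> and after scaling to \<open>\<nu>(X) = 1\<close>, the
  seminorm \<open>e\<^sup>-\<^sup>\<nu>\<close> is compared with the norms \<open>disc_norm a \<rho>\<close>, the supremum norms of polynomials on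
  the disc of radius \<open>\<rho>\<close> about \<open>a\<close>. If \<open>W\<close> is the minimal polynomial of \<open>a\<close> and \<open>e\<^sup>-\<^sup>\<nu>\<close> is at most
  the disc norm at \<open>W\<close>, then it is so everywhere (\<open>seminorm_le_disc_norm\<close>): the terms of the
  \<open>W\<close>-adic expansion of a polynomial are orthogonal for the disc norm (\<open>disc_norm_orthogonal\<close>), and
  the constant left over disappears on passing to high powers. On polynomials without zeros in the
  disc, \<open>e\<^sup>-\<^sup>\<nu>\<close> is even equal to the disc norm (\<open>seminorm_eq_absv\<close>). Given the relation,
  \<open>\<nu>(x\<^sub>0) > 0\<close> determines with the index \<open>i\<close> of largest \<open>\<nu>(x\<^sub>i) / (L\<^sub>0 \<cdot> L\<^sub>i)\<close> a point \<open>P\<close> of the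
  tree, on the segment from \<open>L\<^sub>0\<close> to \<open>L\<^sub>i\<close>, and the vector of \<open>\<nu>\<close> is \<open>\<nu>(x\<^sub>0) w\<^sup>P\<close> (\<open>trop_centered\<close>).
  A semivaluation that is positive on two of the branches is positive on the whole maximal ideal
  (\<open>semivaluation_centered\<close>), so the remaining semivaluations give multiples of basis vectors.

  Conversely, the norm of a disc about \<open>a\<close> is multiplicative and extends to power series, and minus
  its logarithm takes the values \<open>w\<^sup>P\<close> on the branches (\<open>branch_valuation\<close>). The basis vectors come
  from the orders of vanishing along the branches (\<open>order_valuation\<close>), and the origin comes from the
  trivial valuation.\<close>

hide_const (open) Divisibility.irreducible Divisibility.prime Group.mult
hide_const (open) UnivPoly.coeff UnivPoly.monom UnivPoly.deg

section \<open>Orders and units in \<open>k[[X,Y]]\<close>\<close>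

lemma cf_add [simp]: "cf (f + g) i j = cf f i j + cf g i j"
  and cf_diff [simp]: "cf (f - g) i j = cf f i j - cf g i j"
  for f g :: "'a::ring_1 pseries"
  by (simp_all add: cf_def)

lemma cf_minus [simp]: "cf (- f) i j = - cf f i j" for f :: "'a::ring_1 pseries"
  by (simp add: cf_def)

lemma cf_0 [simp]: "cf 0 i j = 0"
  by (simp add: cf_def)

lemma cf_1: "cf (1 :: 'a::comm_ring_1 pseries) i j = (if i = 0 \<and> j = 0 then 1 else 0)"
  by (simp add: cf_def)

lemma cf_sum: "cf (\<Sum>x\<in>A. F x) i j = (\<Sum>x\<in>A. cf (F x) i j)"
  for F :: "'b \<Rightarrow> 'a::comm_ring_1 pseries"
  by (simp add: cf_def fps_sum_nth)

lemma cf_mult: "cf (f * g) i j = (\<Sum>b\<le>j. \<Sum>a\<le>i. cf f a b * cf g (i - a) (j - b))"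
  for f g :: "'a::comm_ring_1 pseries"
  by (simp add: cf_def fps_mult_nth fps_sum_nth atLeast0AtMost)

lemma pseries_eqI: "(\<And>i j. cf f i j = cf g i j) \<Longrightarrow> f = g"
  by (simp add: cf_def fps_eq_iff)

lemma cf_cnst: "cf (cnst c) i j = (if i = 0 \<and> j = 0 then c else 0)"
  by (simp add: cf_def cnst_def)

lemma cf_cnst_mult [simp]: "cf (cnst c * f) i j = c * cf f i j"
  for f :: "'a::comm_ring_1 pseries"
  by (simp add: cf_def cnst_def)

lemma cnst_hom [simp]: "cnst 0 = 0" "cnst 1 = 1" "cnst (a + b) = cnst a + cnst b"
  "cnst (a * b) = cnst a * cnst b" "cnst (- a) = - cnst a" "cnst (a - b) = cnst a - cnst b"
  for a b :: "'a::comm_ring_1"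
  by (intro pseries_eqI; simp add: cf_cnst cf_1)+

lemma cf_varX: "cf varX i j = (if i = 1 \<and> j = 0 then 1 else 0)"
  by (simp add: cf_def varX_def)

lemma cf_varY: "cf varY i j = (if i = 0 \<and> j = 1 then 1 else 0)"
  by (simp add: cf_def varY_def fps_X_def)

lemma cf_varX_mult: "cf (varX * f) i j = (if i = 0 then 0 else cf f (i - 1) j)"
  for f :: "'a::comm_ring_1 pseries"
  by (simp add: cf_def varX_def)

lemma cf_varY_mult: "cf (varY * f) i j = (if j = 0 then 0 else cf f i (j - 1))"
  for f :: "'a::comm_ring_1 pseries"
  by (simp add: cf_def varY_def)

definition order_ge :: "nat \<Rightarrow> 'a::field pseries \<Rightarrow> bool" where
  "order_ge n f \<longleftrightarrow> (\<forall>i j. i + j < n \<longrightarrow> cf f i j = 0)"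

lemma order_ge_0 [simp]: "order_ge 0 f"
  by (simp add: order_ge_def)

lemma order_ge_zero [simp]: "order_ge n 0"
  by (simp add: order_ge_def)

lemma order_ge_add: "order_ge n f \<Longrightarrow> order_ge n g \<Longrightarrow> order_ge n (f + g)"
  and order_ge_diff: "order_ge n f \<Longrightarrow> order_ge n g \<Longrightarrow> order_ge n (f - g)"
  by (simp_all add: order_ge_def)

lemma order_ge_sum: "(\<And>x. x \<in> A \<Longrightarrow> order_ge n (F x)) \<Longrightarrow> order_ge n (\<Sum>x\<in>A. F x)"
  by (simp add: order_ge_def cf_sum)

lemma order_ge_mono: "order_ge n f \<Longrightarrow> m \<le> n \<Longrightarrow> order_ge m f"
  by (simp add: order_ge_def)

lemma order_ge_mult:
  assumes "order_ge m f" "order_ge n g"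
  shows "order_ge (m + n) (f * g)"
  unfolding order_ge_def
proof (intro allI impI)
  fix i j assume ij: "i + j < m + n"
  have "cf f a b * cf g (i - a) (j - b) = 0" if "a \<le> i" "b \<le> j" for a b
  proof (cases "a + b < m")
    case False
    then have "(i - a) + (j - b) < n" using ij that by linarith
    then show ?thesis using assms(2) by (simp add: order_ge_def)
  qed (use assms(1) in \<open>simp add: order_ge_def\<close>)
  then show "cf (f * g) i j = 0" unfolding cf_mult by (intro sum.neutral ballI) auto
qed

lemma order_ge_mult_left: "order_ge n g \<Longrightarrow> order_ge n (f * g)"
  using order_ge_mult[of 0 f n g] by simp

lemma order_ge_power: "order_ge 1 f \<Longrightarrow> order_ge n (f ^ n)"
proof (induction n)
  case (Suc n)
  then show ?case using order_ge_mult[of 1 f n "f ^ n"] by simp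
qed simp

lemma order_ge_1_iff: "order_ge 1 f \<longleftrightarrow> cf f 0 0 = 0"
  by (auto simp: order_ge_def)

lemma maxideal_iff: "f \<in> maxideal \<longleftrightarrow> order_ge 1 f"
  unfolding maxideal_def order_ge_1_iff by simp

lemma order_ge_imp_zero: "(\<And>n. order_ge n f) \<Longrightarrow> f = 0"
  by (rule pseries_eqI) (auto simp: order_ge_def)

lemma order_ge_varX: "order_ge 1 varX" and order_ge_varY: "order_ge 1 varY"
  by (simp_all add: order_ge_def cf_varX cf_varY)

lemma cf_mult_00 [simp]: "cf (f * g) 0 0 = cf f 0 0 * cf g 0 0"
  for f g :: "'a::comm_ring_1 pseries"
  by (simp add: cf_mult)

lemma pseries_unit_iff: "f dvd 1 \<longleftrightarrow> cf f 0 0 \<noteq> 0" for f :: "'a::field pseries"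
proof
  assume "f dvd 1"
  then obtain g where "f * g = 1" by (metis dvdE)
  then have "cf f 0 0 * cf g 0 0 = 1" by (metis cf_mult_00 cf_1)
  then show "cf f 0 0 \<noteq> 0" by auto
next
  assume "cf f 0 0 \<noteq> 0"
  then have "fps_nth f 0 * inverse (fps_nth f 0) = 1"
    by (simp add: cf_def inverse_mult_eq_1')
  then have "f * fps_right_inverse f (inverse (fps_nth f 0)) = 1"
    by (rule fps_right_inverse)
  then show "f dvd 1" by (metis dvdI)
qed

lemma maxideal_iff_nonunit: "f \<in> maxideal \<longleftrightarrow> \<not> f dvd 1"
  by (simp add: maxideal_def pseries_unit_iff)

lemma pseries_split:
  obtains f1 f2 where "f = cnst (cf f 0 0) + varX * f1 + varY * f2"
    "\<And>n. order_ge (Suc n) f \<Longrightarrow> order_ge n f1 \<and> order_ge n f2"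
proof
  define f1 where "f1 = fps_const (Abs_fps (\<lambda>i. cf f (Suc i) 0))"
  define f2 where "f2 = fps_shift 1 f"
  have f1: "cf f1 i j = (if j = 0 then cf f (Suc i) 0 else 0)" for i j
    by (simp add: f1_def cf_def)
  have f2: "cf f2 i j = cf f i (Suc j)" for i j
    by (simp add: f2_def cf_def)
  show "f = cnst (cf f 0 0) + varX * f1 + varY * f2"
    by (rule pseries_eqI) (auto simp: cf_cnst cf_varX_mult cf_varY_mult f1 f2)
  show "order_ge n f1 \<and> order_ge n f2" if "order_ge (Suc n) f" for n
    using that by (auto simp: order_ge_def f1 f2)
qed

lemma mult_eq_iff:
  assumes "f \<noteq> 0"
  shows "mult f = n \<longleftrightarrow> order_ge n f \<and> \<not> order_ge (Suc n) f"
proof -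
  let ?P = "\<lambda>n. \<exists>i j. i + j = n \<and> cf f i j \<noteq> 0"
  obtain i j where "cf f i j \<noteq> 0"
    using assms pseries_eqI[of f 0] by auto
  then have ex: "?P (i + j)" by blast
  have 1: "?P (mult f)" unfolding mult_def by (rule LeastI[of ?P, OF ex])
  have 2: "cf f i j = 0" if "i + j < mult f" for i j
    using not_less_Least[of "i + j" ?P] that unfolding mult_def by blast
  have A: "order_ge (mult f) f" using 2 by (simp add: order_ge_def)
  have B: "\<not> order_ge (Suc (mult f)) f" using 1 unfolding order_ge_def by (metis lessI)
  show ?thesis
    by (metis A B not_less_eq_eq order_antisym order_ge_mono)
qed

lemma order_ge_mult_f: "f \<noteq> 0 \<Longrightarrow> order_ge (mult f) f"
  using mult_eq_iff by blast

lemma order_ge_unit_iff: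
  assumes "u dvd 1" shows "order_ge n (u * f) \<longleftrightarrow> order_ge n f"
proof
  obtain v where v: "1 = u * v" using assms by (rule dvdE)
  assume "order_ge n (u * f)"
  then have "order_ge n (v * (u * f))" by (rule order_ge_mult_left)
  also have "v * (u * f) = (u * v) * f" by (simp only: mult_ac)
  finally show "order_ge n f" unfolding v[symmetric] by simp
qed (rule order_ge_mult_left)

lemma mult_unit: "u dvd 1 \<Longrightarrow> mult (u * f) = mult f" for f :: "'a::field pseries"
proof (cases "f = 0")
  case False
  assume u: "u dvd 1"
  then have "u * f \<noteq> 0" using False by auto
  then show ?thesis
    using u False mult_eq_iff[of "u * f" "mult f"] mult_eq_iff[of f "mult f"]
    by (simp add: order_ge_unit_iff)
qed auto

lemma mult_eq_1_nonzero_linear: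
  assumes "f \<noteq> 0"
  shows "mult f = 1 \<longleftrightarrow> cf f 0 0 = 0 \<and> (cf f 1 0 \<noteq> 0 \<or> cf f 0 1 \<noteq> 0)"
proof -
  have "order_ge 2 f \<longleftrightarrow> cf f 0 0 = 0 \<and> cf f 1 0 = 0 \<and> cf f 0 1 = 0"
  proof -
    have "i + j < 2 \<longleftrightarrow> (i = 0 \<and> j = 0) \<or> (i = 1 \<and> j = 0) \<or> (i = 0 \<and> j = 1)" for i j :: nat
      by auto
    then show ?thesis unfolding order_ge_def by auto
  qed
  then show ?thesis
    using mult_eq_iff[OF assms, of 1] order_ge_1_iff[of f] by (auto simp: numeral_2_eq_2)
qed

section \<open>Substitution homomorphisms\<close>

definition endo :: "('a::field pseries \<Rightarrow> 'a pseries) \<Rightarrow> bool" where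
  "endo F \<longleftrightarrow> (\<forall>f g. F (f + g) = F f + F g) \<and> (\<forall>f g. F (f * g) = F f * F g) \<and>
     (\<forall>c. F (cnst c) = cnst c)"

lemma endo_simps:
  assumes "endo F"
  shows "F (f + g) = F f + F g" "F (f * g) = F f * F g" "F (cnst c) = cnst c"
    "F 0 = 0" "F 1 = 1" "F (- f) = - F f" "F (f - g) = F f - F g" "F (f ^ n) = F f ^ n"
proof -
  show *: "F (f + g) = F f + F g" "F (f * g) = F f * F g" "F (cnst c) = cnst c" for f g c
    using assms by (auto simp: endo_def)
  show 0: "F 0 = 0" and 1: "F 1 = 1" using *(3)[of 0] *(3)[of 1] by simp_all
  show m: "F (- f) = - F f" for f
    using *(1)[of f "-f"] 0 by (simp add: eq_neg_iff_add_eq_0 add.commute)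
  show "F (f - g) = F f - F g" using *(1)[of f "-g"] m[of g] by simp
  show "F (f ^ n) = F f ^ n" by (induction n) (auto simp: 1 *)
qed

lemma endo_comp: "endo F \<Longrightarrow> endo G \<Longrightarrow> endo (\<lambda>f. F (G f))"
  by (simp add: endo_def)

lemma endo_dvd_power:
  assumes F: "endo F" and e: "e dvd F varX" "e dvd F varY" and "order_ge n f"
  shows "e ^ n dvd F f"
  using \<open>order_ge n f\<close>
proof (induction n arbitrary: f)
  case (Suc n)
  obtain f1 f2 where f: "f = cnst (cf f 0 0) + varX * f1 + varY * f2"
    "order_ge n f1" "order_ge n f2"
    using pseries_split[of f] Suc.prems by metis
  have "cf f 0 0 = 0" using Suc.prems by (simp add: order_ge_def)
  then have "F f = F varX * F f1 + F varY * F f2"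
    by (subst f(1)) (simp add: endo_simps[OF F])
  then show ?case
    using Suc.IH[OF f(2)] Suc.IH[OF f(3)] e by (simp add: dvd_add mult_dvd_mono)
qed simp

text \<open>Local endomorphisms are continuous, so the images of \<open>X\<close> and \<open>Y\<close> determine them.\<close>

lemma endo_eqI:
  assumes F: "endo F" and G: "endo G"
    and eq: "F varX = G varX" "F varY = G varY"
    and loc: "order_ge 1 (F varX)" "order_ge 1 (F varY)"
  shows "F f = G f"
proof -
  have "order_ge n (F f - G f)" for n
  proof (induction n arbitrary: f)
    case (Suc n)
    obtain f1 f2 where f: "f = cnst (cf f 0 0) + varX * f1 + varY * f2"
      using pseries_split[of f] by metis
    have "F f - G f = F varX * (F f1 - G f1) + F varY * (F f2 - G f2)"
      by (subst f, subst (2) f) (simp add: endo_simps[OF F] endo_simps[OF G] eq algebra_simps)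
    moreover have "order_ge (1 + n) (F varX * (F f1 - G f1))"
      "order_ge (1 + n) (F varY * (F f2 - G f2))"
      by (intro order_ge_mult loc Suc)+
    ultimately show ?case by (metis order_ge_add plus_1_eq_Suc)
  qed simp
  then show ?thesis using order_ge_imp_zero by (metis right_minus_eq)
qed

text \<open>A power series in two elements of the maximal ideal agrees up to any given order with a
  polynomial in them, for which multiplicativity is a finite computation.\<close>

definition subst_trunc :: "nat \<Rightarrow> 'a::field pseries \<Rightarrow> 'a pseries \<Rightarrow> 'a pseries \<Rightarrow> 'a pseries" where
  "subst_trunc N f a b = (\<Sum>(i, j)\<in>{(i, j). i + j \<le> N}. cnst (cf f i j) * (a ^ i * b ^ j))"

lemma finite_triangle: "finite {(i, j). i + j \<le> (N::nat)}"
  by (rule finite_subset[of _ "{..N} \<times> {..N}"]) auto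

lemma order_ge_monomial:
  assumes "order_ge 1 a" "order_ge 1 b" shows "order_ge (i + j) (a ^ i * b ^ j)"
  by (intro order_ge_mult order_ge_power assms)

lemma subst2_trunc:
  assumes "order_ge 1 a" "order_ge 1 b"
  shows "order_ge (Suc N) (subst2 f a b - subst_trunc N f a b)"
  unfolding order_ge_def
proof (intro allI impI)
  fix n l assume nl: "n + l < Suc N"
  have "(\<Sum>(i, j)\<in>{(i, j). i + j \<le> n + l}. cf f i j * cf (a ^ i * b ^ j) n l)
      = (\<Sum>(i, j)\<in>{(i, j). i + j \<le> N}. cf f i j * cf (a ^ i * b ^ j) n l)"
  proof (rule sum.mono_neutral_left[OF finite_triangle])
    have "cf (a ^ i * b ^ j) n l = 0" if "i + j \<le> n + l \<longrightarrow> False" for i j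
      using order_ge_monomial[OF assms, of i j] that by (simp add: order_ge_def)
    then show "\<forall>p\<in>{(i, j). i + j \<le> N} - {(i, j). i + j \<le> n + l}.
        (case p of (i, j) \<Rightarrow> cf f i j * cf (a ^ i * b ^ j) n l) = 0"
      by (metis (mono_tags, lifting) DiffD2 case_prodI2 case_prod_conv mem_Collect_eq mult_zero_right surj_pair)
  qed (use nl in auto)
  then show "cf (subst2 f a b - subst_trunc N f a b) n l = 0"
    by (simp add: subst_trunc_def cf_sum case_prod_beta)
       (simp add: subst2_def cf_def case_prod_beta)
qed

lemma subst_trunc_mult:
  assumes "order_ge 1 a" "order_ge 1 b"
  shows "order_ge (Suc N) (subst_trunc N f a b * subst_trunc N g a b - subst_trunc N (f * g) a b)"
proof -
  define T where "T = {(i, j). i + j \<le> N}"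
  define m where "m = (\<lambda>p::nat \<times> nat. a ^ fst p * b ^ snd p)"
  define h where "h = (\<lambda>p q. cnst (cf f (fst p) (snd p)) * cnst (cf g (fst q) (snd q)) *
    m (fst p + fst q, snd p + snd q))"
  have fT: "finite T" unfolding T_def by (rule finite_triangle)
  have m_mult: "m p * m q = m (fst p + fst q, snd p + snd q)" for p q
    by (simp add: m_def power_add mult_ac)
  have S: "subst_trunc N f' a b = (\<Sum>p\<in>T. cnst (cf f' (fst p) (snd p)) * m p)" for f'
    by (simp add: subst_trunc_def T_def m_def case_prod_beta)
  have 1: "subst_trunc N f a b * subst_trunc N g a b = (\<Sum>p\<in>T. \<Sum>q\<in>T. h p q)"
    unfolding S sum_product h_def m_mult[symmetric] by (simp only: mult_ac)
  let ?D = "\<lambda>r. {..fst r} \<times> {..snd r}"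
  let ?\<phi> = "\<lambda>r s. ((fst s, snd s), (fst r - fst s, snd r - snd s))"
  have "subst_trunc N (f * g) a b = (\<Sum>r\<in>T. \<Sum>s\<in>?D r. h s (fst r - fst s, snd r - snd s))"
    unfolding S
  proof (rule sum.cong[OF refl])
    fix r assume "r \<in> T"
    have "cf (f * g) (fst r) (snd r) =
      (\<Sum>s\<in>?D r. cf f (fst s) (snd s) * cf g (fst r - fst s) (snd r - snd s))"
      unfolding cf_mult by (subst sum.swap) (simp add: sum.cartesian_product case_prod_beta)
    then have c: "cnst (cf (f * g) (fst r) (snd r)) =
      (\<Sum>s\<in>?D r. cnst (cf f (fst s) (snd s)) * cnst (cf g (fst r - fst s) (snd r - snd s)))"
      by (intro pseries_eqI) (simp add: cf_sum cf_cnst sum_distrib_right)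
    show "cnst (cf (f * g) (fst r) (snd r)) * m r =
        (\<Sum>s\<in>?D r. h s (fst r - fst s, snd r - snd s))"
      unfolding c sum_distrib_right h_def by (intro sum.cong) auto
  qed
  also have "\<dots> = (\<Sum>(r, s)\<in>Sigma T ?D. h s (fst r - fst s, snd r - snd s))"
    by (rule sum.Sigma) (auto simp: fT)
  also have "\<dots> = (\<Sum>(p, q)\<in>{(p, q). p \<in> T \<and> q \<in> T \<and> (fst p + fst q, snd p + snd q) \<in> T}. h p q)"
    by (rule sum.reindex_bij_witness[where
          i = "\<lambda>(p, q). ((fst p + fst q, snd p + snd q), p)" and
          j = "\<lambda>(r, s). (s, (fst r - fst s, snd r - snd s))"])
       (auto simp: T_def)
  finally have 2: "subst_trunc N (f * g) a b =
    (\<Sum>(p, q)\<in>{(p, q). p \<in> T \<and> q \<in> T \<and> (fst p + fst q, snd p + snd q) \<in> T}. h p q)" .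
  have "(\<Sum>p\<in>T. \<Sum>q\<in>T. h p q) = (\<Sum>(p, q)\<in>T \<times> T. h p q)"
    by (rule sum.cartesian_product)
  also have "\<dots> - subst_trunc N (f * g) a b =
    (\<Sum>(p, q)\<in>T \<times> T - {(p, q). p \<in> T \<and> q \<in> T \<and> (fst p + fst q, snd p + snd q) \<in> T}. h p q)"
    unfolding 2 by (rule sum_diff[symmetric]) (auto simp: fT)
  finally have "subst_trunc N f a b * subst_trunc N g a b - subst_trunc N (f * g) a b =
    (\<Sum>(p, q)\<in>T \<times> T - {(p, q). p \<in> T \<and> q \<in> T \<and> (fst p + fst q, snd p + snd q) \<in> T}. h p q)"
    unfolding 1 .
  moreover have "order_ge (Suc N) (h p q)" if "(fst p + fst q, snd p + snd q) \<notin> T" for p q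
    unfolding h_def m_def
    by (intro order_ge_mult_left order_ge_mono[OF order_ge_monomial[OF assms]])
       (use that in \<open>auto simp: T_def\<close>)
  ultimately show ?thesis by (auto intro!: order_ge_sum)
qed

lemma subst2_varX:
  assumes "order_ge 1 a" "order_ge 1 b" shows "subst2 varX a b = a"
proof -
  have "order_ge (Suc N) (subst2 varX a b - a)" if "N \<ge> 1" for N
  proof -
    have "subst_trunc N varX a b = (\<Sum>p\<in>{(1::nat, 0::nat)}. a)"
      unfolding subst_trunc_def
      by (rule sum.mono_neutral_cong_right) (use that in \<open>auto simp: finite_triangle cf_varX split: if_splits\<close>)
    then show ?thesis using subst2_trunc[OF assms, of N varX] by simp
  qed
  then have "order_ge N (subst2 varX a b - a)" for N
    by (rule order_ge_mono[of "Suc (Suc N)"]) simp_all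
  then show ?thesis using order_ge_imp_zero by (metis right_minus_eq)
qed

lemma subst2_varY:
  assumes "order_ge 1 a" "order_ge 1 b" shows "subst2 varY a b = b"
proof -
  have "order_ge (Suc N) (subst2 varY a b - b)" if "N \<ge> 1" for N
  proof -
    have "subst_trunc N varY a b = (\<Sum>p\<in>{(0::nat, 1::nat)}. b)"
      unfolding subst_trunc_def
      by (rule sum.mono_neutral_cong_right) (use that in \<open>auto simp: finite_triangle cf_varY split: if_splits\<close>)
    then show ?thesis using subst2_trunc[OF assms, of N varY] by simp
  qed
  then have "order_ge N (subst2 varY a b - b)" for N
    by (rule order_ge_mono[of "Suc (Suc N)"]) simp_all
  then show ?thesis using order_ge_imp_zero by (metis right_minus_eq)
qed

lemma endo_subst2:
  assumes "order_ge 1 a" "order_ge 1 b"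
  shows "endo (\<lambda>f. subst2 f a b)"
proof -
  note tr = subst2_trunc[OF assms]
  have "subst2 (f + g) a b - (subst2 f a b + subst2 g a b) = 0" for f g
  proof (rule order_ge_imp_zero)
    fix N
    have "subst_trunc N (f + g) a b = subst_trunc N f a b + subst_trunc N g a b"
      by (simp add: subst_trunc_def case_prod_beta ring_distribs sum.distrib)
    then have "subst2 (f + g) a b - (subst2 f a b + subst2 g a b) =
      (subst2 (f + g) a b - subst_trunc N (f + g) a b) - (subst2 f a b - subst_trunc N f a b)
       - (subst2 g a b - subst_trunc N g a b)" by simp
    then show "order_ge N (subst2 (f + g) a b - (subst2 f a b + subst2 g a b))"
      by (simp only:) (intro order_ge_diff order_ge_mono[OF tr le_SucI[OF order_refl]])
  qed
  moreover have "subst2 (f * g) a b - subst2 f a b * subst2 g a b = 0" for f g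
  proof (rule order_ge_imp_zero)
    fix N
    let ?E = "\<lambda>f. subst_trunc N f a b" and ?S = "\<lambda>f. subst2 f a b"
    have eq: "?S (f * g) - ?S f * ?S g =
       (?S (f * g) - ?E (f * g)) - (?E f * ?E g - ?E (f * g)) - ?S g * (?S f - ?E f)
        - ?E f * (?S g - ?E g)" by (simp add: algebra_simps)
    have "order_ge (Suc N) (?S (f * g) - ?S f * ?S g)"
      unfolding eq by (intro order_ge_diff order_ge_mult_left tr subst_trunc_mult assms)
    then show "order_ge N (?S (f * g) - ?S f * ?S g)"
      by (rule order_ge_mono) simp
  qed
  moreover have "subst2 (cnst c) a b = cnst c" for c
  proof -
    have "subst_trunc N (cnst c) a b = (\<Sum>p\<in>{(0::nat, 0::nat)}. cnst c)" for N
      unfolding subst_trunc_def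
      by (rule sum.mono_neutral_cong_right) (auto simp: finite_triangle cf_cnst split: if_splits)
    then have "order_ge N (subst2 (cnst c) a b - cnst c)" for N
      using tr[of N "cnst c"] order_ge_mono[of "Suc N" _ N] by simp
    then show ?thesis using order_ge_imp_zero by (metis right_minus_eq)
  qed
  ultimately show ?thesis by (simp add: endo_def)
qed


section \<open>Weierstrass division and preparation\<close>

definition X_order_ge :: "nat \<Rightarrow> 'a::field pseries \<Rightarrow> bool" where
  "X_order_ge n f \<longleftrightarrow> (\<forall>i j. i < n \<longrightarrow> cf f i j = 0)"

lemma X_order_ge_0 [simp]: "X_order_ge 0 f"
  by (simp add: X_order_ge_def)

lemma X_order_ge_zero [simp]: "X_order_ge n 0"
  by (simp add: X_order_ge_def)

lemma X_order_ge_diff: "X_order_ge n f \<Longrightarrow> X_order_ge n g \<Longrightarrow> X_order_ge n (f - g)"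
  by (simp add: X_order_ge_def)

lemma X_order_ge_mult:
  assumes "X_order_ge m f" "X_order_ge n g"
  shows "X_order_ge (m + n) (f * g)"
  unfolding X_order_ge_def
proof (intro allI impI)
  fix i j assume ij: "i < m + n"
  have "cf f a b * cf g (i - a) (j - b) = 0" if "a \<le> i" for a b
  proof (cases "a < m")
    case False
    then have "i - a < n" using ij that by linarith
    then show ?thesis using assms(2) by (simp add: X_order_ge_def)
  qed (use assms(1) in \<open>simp add: X_order_ge_def\<close>)
  then show "cf (f * g) i j = 0" unfolding cf_mult by (intro sum.neutral ballI) auto
qed

lemma X_order_ge_imp_zero: "(\<And>n. X_order_ge n f) \<Longrightarrow> f = 0"
  by (rule pseries_eqI) (auto simp: X_order_ge_def)

lemma cf_fps_shift [simp]: "cf (fps_shift d f) i j = cf f i (j + d)"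
  by (simp add: cf_def)

text \<open>Banach's fixed point theorem for the \<open>X\<close>-adic topology: the iterates of a contraction
  stabilise coefficientwise.\<close>

lemma X_adic_fixed_point:
  fixes F :: "'a::field pseries \<Rightarrow> 'a pseries"
  assumes contr: "\<And>n g h. X_order_ge n (g - h) \<Longrightarrow> X_order_ge (Suc n) (F g - F h)"
  obtains q where "F q = q"
proof
  define q where "q = Abs_fps (\<lambda>j. Abs_fps (\<lambda>i. cf ((F ^^ Suc i) 0) i j))"
  have cauchy: "X_order_ge n ((F ^^ (n + m)) 0 - (F ^^ n) 0)" for n m
    by (induction n) (auto intro: contr)
  have lim: "X_order_ge n ((F ^^ n) 0 - q)" for n
    unfolding X_order_ge_def
  proof (intro allI impI)
    fix i j assume "i < n"
    then obtain m where n: "n = Suc i + m" using less_imp_Suc_add by auto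
    have "cf ((F ^^ n) 0) i j = cf ((F ^^ Suc i) 0) i j"
      using cauchy[of "Suc i" m] unfolding X_order_ge_def n cf_diff right_minus_eq by blast
    then show "cf ((F ^^ n) 0 - q) i j = 0" by (simp add: q_def cf_def)
  qed
  have "X_order_ge n (F q - q)" for n
  proof -
    have "X_order_ge (Suc n) (((F ^^ Suc n) 0 - q) - (F ((F ^^ n) 0) - F q))"
      by (intro X_order_ge_diff lim contr)
    then show ?thesis by (simp add: X_order_ge_def)
  qed
  then show "F q = q" using X_order_ge_imp_zero by (metis right_minus_eq)
qed

text \<open>Division by \<open>f\<close> is the fixed point equation obtained from \<open>g = q f + r\<close> by dropping the
  coefficients of \<open>Y\<^sup>j\<close> with \<open>j < d\<close>: there \<open>f\<close> is a unit up to a multiple of \<open>X\<close>.\<close>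

context
  fixes f :: "'a::field pseries" and d :: nat
  assumes low: "\<And>j. j < d \<Longrightarrow> cf f 0 j = 0" and top: "cf f 0 d \<noteq> 0"
begin

lemma weierstrass_shift:
  obtains w where "\<And>q. w * fps_shift d (q * f) = q + w * fps_shift d (q * fps_cutoff d f)"
proof -
  have "fps_shift d f dvd 1" by (simp add: pseries_unit_iff top)
  then obtain w where w: "1 = fps_shift d f * w" by (rule dvdE)
  have "w * fps_shift d (q * f) = q + w * fps_shift d (q * fps_cutoff d f)" for q
  proof -
    have "q * f = (q * fps_shift d f) * fps_X ^ d + q * fps_cutoff d f"
      by (subst fps_shift_cutoff[of d f, symmetric]) (simp add: algebra_simps)
    then have "fps_shift d (q * f) = q * fps_shift d f + fps_shift d (q * fps_cutoff d f)"
      by (simp add: fps_shift_add fps_shift_times_fps_X_power)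
    then have "w * fps_shift d (q * f) = q * (fps_shift d f * w) + w * fps_shift d (q * fps_cutoff d f)"
      by (simp add: algebra_simps)
    then show ?thesis unfolding w[symmetric] by simp
  qed
  then show ?thesis by (rule that)
qed

lemma X_order_ge_shift_cutoff:
  assumes "X_order_ge n q"
  shows "X_order_ge (Suc n) (w * fps_shift d (q * fps_cutoff d f))"
proof -
  have "X_order_ge 1 (fps_cutoff d f)" using low by (simp add: X_order_ge_def cf_def)
  from X_order_ge_mult[OF assms this] have "X_order_ge (Suc n) (fps_shift d (q * fps_cutoff d f))"
    by (simp add: X_order_ge_def)
  from X_order_ge_mult[of 0 w, OF _ this] show ?thesis by simp
qed

lemma weierstrass_division:
  obtains q r where "g = q * f + fps_of_poly r" "\<And>j. j \<ge> d \<Longrightarrow> coeff r j = 0"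
proof -
  obtain w where w: "\<And>q. w * fps_shift d (q * f) = q + w * fps_shift d (q * fps_cutoff d f)"
    using weierstrass_shift by blast
  define F where "F = (\<lambda>q. w * fps_shift d g - w * fps_shift d (q * fps_cutoff d f))"
  have "X_order_ge (Suc n) (F q - F q')" if "X_order_ge n (q - q')" for n q q'
  proof -
    have "X_order_ge n (q' - q)" using that by (simp add: X_order_ge_def)
    moreover have "F q - F q' = w * fps_shift d ((q' - q) * fps_cutoff d f)"
      by (simp add: F_def ring_distribs fps_shift_diff)
    ultimately show ?thesis using X_order_ge_shift_cutoff by metis
  qed
  then obtain q where "F q = q" by (rule X_adic_fixed_point)
  then have "w * fps_shift d (g - q * f) = 0"
    using w[of q] by (simp add: F_def fps_shift_diff right_diff_distrib algebra_simps)
  moreover have "w \<noteq> 0"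
  proof
    assume "w = 0" with w[of 1] show False by simp
  qed
  ultimately have "fps_shift d (g - q * f) = 0" by simp
  then have hi: "fps_nth (g - q * f) j = 0" if "j \<ge> d" for j
    using that by (metis fps_shift_nth fps_zero_nth le_add_diff_inverse2)
  define r where "r = (\<Sum>j<d. monom (fps_nth (g - q * f) j) j)"
  have r: "coeff r j = (if j < d then fps_nth (g - q * f) j else 0)" for j
    by (simp add: r_def coeff_sum)
  have "g = q * f + fps_of_poly r"
  proof (rule fps_ext)
    fix j show "fps_nth g j = fps_nth (q * f + fps_of_poly r) j"
      using hi[of j] by (auto simp: r)
  qed
  then show ?thesis using r by (intro that[of q r]) auto
qed

lemma weierstrass_division_unique:
  assumes "q * f + fps_of_poly r = q' * f + fps_of_poly r'"
    and "\<And>j. j \<ge> d \<Longrightarrow> coeff r j = 0" "\<And>j. j \<ge> d \<Longrightarrow> coeff r' j = 0"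
  shows "q = q'" "r = r'"
proof -
  obtain w where w: "\<And>q. w * fps_shift d (q * f) = q + w * fps_shift d (q * fps_cutoff d f)"
    using weierstrass_shift by blast
  let ?p = "q - q'"
  have "?p * f = fps_of_poly (r' - r)" using assms(1) by (simp add: algebra_simps fps_of_poly_diff)
  then have "fps_shift d (?p * f) = 0" by (simp add: fps_eq_iff assms(2,3))
  then have *: "?p = - (w * fps_shift d (?p * fps_cutoff d f))"
    using w[of ?p] by (simp add: eq_neg_iff_add_eq_0)
  have "X_order_ge n ?p" for n
  proof (induction n)
    case (Suc n)
    from X_order_ge_shift_cutoff[OF this, of w] show ?case
      by (subst *) (simp add: X_order_ge_def)
  qed simp
  then show "q = q'" using X_order_ge_imp_zero by (metis right_minus_eq)
  then show "r = r'" using assms(1) by (simp add: fps_of_poly_eq_iff)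
qed

end

definition weierstrass :: "'a::field fps poly \<Rightarrow> bool" where
  "weierstrass W \<longleftrightarrow> lead_coeff W = 1 \<and> (\<forall>j<degree W. fps_nth (coeff W j) 0 = 0)"

lemma cf_fps_of_poly [simp]: "cf (fps_of_poly p) i j = fps_nth (coeff p j) i"
  by (simp add: cf_def)

lemma weierstrass_cf:
  assumes "weierstrass W"
  shows "cf (fps_of_poly W) 0 j = (if j = degree W then 1 else 0)"
  using assms by (cases j "degree W" rule: linorder_cases)
    (auto simp: weierstrass_def coeff_eq_0)

lemma weierstrass_low: "weierstrass W \<Longrightarrow> j < degree W \<Longrightarrow> cf (fps_of_poly W) 0 j = 0"
  and weierstrass_top: "weierstrass W \<Longrightarrow> cf (fps_of_poly W) 0 (degree W) \<noteq> 0"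
  by (simp_all only: weierstrass_cf) auto

lemma weierstrass_nonzero: "weierstrass W \<Longrightarrow> W \<noteq> 0"
  by (auto simp: weierstrass_def)

theorem weierstrass_preparation:
  fixes f :: "'a::field pseries"
  assumes low: "\<And>j. j < d \<Longrightarrow> cf f 0 j = 0" and top: "cf f 0 d \<noteq> 0"
  obtains u W where "u dvd 1" "f = u * fps_of_poly W" "weierstrass W" "degree W = d"
proof -
  obtain q r where qr: "fps_X ^ d = q * f + fps_of_poly r" "\<And>j. j \<ge> d \<Longrightarrow> coeff r j = 0"
    using weierstrass_division[of d f "fps_X ^ d"] low top by metis
  have cfX: "cf (fps_X ^ d :: 'a pseries) 0 j = (if j = d then 1 else 0)" for j
    by (simp add: cf_def)
  have c: "cf (q * f) 0 j = (if j = d then cf q 0 0 * cf f 0 d else 0)" if "j \<le> d" for j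
  proof -
    have "cf (q * f) 0 j = cf (f * q) 0 j" by (simp add: mult.commute)
    also have "\<dots> = (\<Sum>b\<le>j. cf f 0 b * cf q 0 (j - b))" by (simp add: cf_mult)
    also have "\<dots> = (\<Sum>b\<le>j. if b = d then cf f 0 d * cf q 0 (j - d) else 0)"
      using that low by (intro sum.cong) auto
    also have "\<dots> = (if j = d then cf q 0 0 * cf f 0 d else 0)" using that by auto
    finally show ?thesis .
  qed
  have r0: "fps_nth (coeff r j) 0 = 0" if "j < d" for j
  proof -
    have "cf (fps_X ^ d :: 'a pseries) 0 j = cf (q * f) 0 j + fps_nth (coeff r j) 0"
      by (subst qr(1)) simp
    then show ?thesis using that c[of j] cfX[of j] by simp
  qed
  have "cf (fps_X ^ d :: 'a pseries) 0 d = cf (q * f) 0 d + fps_nth (coeff r d) 0"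
    by (subst qr(1)) simp
  then have "cf q 0 0 \<noteq> 0" using c[of d] cfX[of d] qr(2)[of d] by auto
  then have "q dvd 1" by (simp add: pseries_unit_iff)
  then obtain v where v: "1 = q * v" by (rule dvdE)
  define W where "W = monom 1 d - r"
  have cW: "coeff W j = (if j = d then 1 else 0) - coeff r j" for j
    by (simp add: W_def)
  have deg: "degree W = d"
  proof (rule antisym)
    show "degree W \<le> d" by (rule degree_le) (auto simp: cW qr(2))
    show "d \<le> degree W" by (rule le_degree) (simp add: cW qr(2))
  qed
  have "fps_of_poly W = q * f"
    using qr(1) by (simp add: W_def fps_of_poly_diff fps_of_poly_monom algebra_simps)
  then have "v * fps_of_poly W = (q * v) * f" by (simp add: mult_ac)
  then have "f = v * fps_of_poly W" unfolding v[symmetric] by simp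
  moreover have "v dvd 1" by (rule dvdI[of _ _ q]) (simp add: v mult.commute)
  moreover have "weierstrass W"
    using r0 qr(2)[of d] by (simp add: weierstrass_def deg cW)
  ultimately show ?thesis using that deg by blast
qed

lemma monic_division:
  fixes W :: "'a::idom poly"
  assumes "lead_coeff W = 1"
  obtains q r where "p = W * q + r" "r = 0 \<or> degree r < degree W"
proof -
  have "W \<noteq> 0" using assms by auto
  obtain q r where qr: "pseudo_divmod p W = (q, r)" by (cases "pseudo_divmod p W")
  show ?thesis
    using pseudo_divmod[OF \<open>W \<noteq> 0\<close> qr] assms that[of q r] by simp
qed

text \<open>A form of Hensel's lemma: the Weierstrass polynomial of a polynomial \<open>p\<close> divides \<open>p\<close> in the
  polynomial ring as well, because division with remainder is unique already for power series.\<close>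

lemma hensel_factor:
  fixes p :: "'a::field fps poly"
  assumes low: "\<And>j. j < r \<Longrightarrow> fps_nth (coeff p j) 0 = 0" and top: "fps_nth (coeff p r) 0 \<noteq> 0"
  obtains W q where "p = W * q" "weierstrass W" "degree W = r"
proof -
  obtain u W where W: "fps_of_poly p = u * fps_of_poly W" "weierstrass W" "degree W = r"
    by (rule weierstrass_preparation[of r "fps_of_poly p"]) (use low top in auto)
  have lW: "lead_coeff W = 1" using W by (simp add: weierstrass_def)
  obtain q s where qs: "p = W * q + s" "s = 0 \<or> degree s < degree W"
    using monic_division[OF lW] by metis
  have "fps_of_poly q * fps_of_poly W + fps_of_poly s = u * fps_of_poly W + fps_of_poly 0"
    using W(1) by (simp add: qs(1) fps_of_poly_add fps_of_poly_mult mult.commute)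
  then have "s = 0"
    using qs(2) weierstrass_low[OF W(2)] weierstrass_top[OF W(2)]
    by (intro weierstrass_division_unique(2)[of "degree W" "fps_of_poly W" "fps_of_poly q" s u 0])
       (auto intro: coeff_eq_0)
  then show ?thesis using that qs W by auto
qed

section \<open>The absolute value on an algebraic closure of \<open>k((X))\<close>\<close>

type_synonym 'a puiseux = "'a fls alg_closure"

definition emb :: "'a::field fps \<Rightarrow> 'a puiseux" where
  "emb c = to_ac (fps_to_fls c)"

lemma emb_simps [simp]:
  "emb 0 = 0" "emb 1 = 1" "emb (a + b) = emb a + emb b" "emb (a * b) = emb a * emb b"
  "emb (- a) = - emb a" "emb (a - b) = emb a - emb b" "emb (a ^ n) = emb a ^ n"
  by (simp_all add: emb_def fps_to_fls_power
      fls_times_fps_to_fls)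

lemma emb_eq_0_iff [simp]: "emb a = 0 \<longleftrightarrow> a = 0"
  by (simp add: emb_def)

lemma emb_sum: "emb (\<Sum>x\<in>A. F x) = (\<Sum>x\<in>A. emb (F x))"
  by (induction A rule: infinite_finite_induct) auto

definition unif :: "'a::field puiseux" where
  "unif = emb fps_X"

lemma unif_nonzero [simp]: "unif \<noteq> 0"
  by (simp add: unif_def)

definition emb_poly :: "'a::field fps poly \<Rightarrow> 'a puiseux poly" where
  "emb_poly p = map_poly emb p"

lemma coeff_emb_poly [simp]: "coeff (emb_poly p) i = emb (coeff p i)"
  by (simp add: emb_poly_def coeff_map_poly)

lemma emb_poly_simps [simp]:
  "emb_poly 0 = 0" "emb_poly 1 = 1" "emb_poly (p + q) = emb_poly p + emb_poly q"
  "emb_poly (p * q) = emb_poly p * emb_poly q" "emb_poly (- p) = - emb_poly p"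
  "emb_poly (p - q) = emb_poly p - emb_poly q" "emb_poly (smult c p) = smult (emb c) (emb_poly p)"
  "emb_poly (pCons c p) = pCons (emb c) (emb_poly p)" "emb_poly (monom c n) = monom (emb c) n"
  by (intro poly_eqI; simp add: coeff_mult emb_sum coeff_pCons split: nat.split)+

lemma emb_poly_power [simp]: "emb_poly (p ^ n) = emb_poly p ^ n"
  by (induction n) auto

lemma degree_emb_poly [simp]: "degree (emb_poly p) = degree p"
  by (simp add: emb_poly_def degree_map_poly)

lemma emb_poly_eq_0_iff [simp]: "emb_poly p = 0 \<longleftrightarrow> p = 0"
  by (metis coeff_emb_poly emb_eq_0_iff leading_coeff_0_iff degree_emb_poly)

definition ev :: "'a::field fps poly \<Rightarrow> 'a puiseux \<Rightarrow> 'a puiseux" where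
  "ev p z = poly (emb_poly p) z"

lemma ev_simps [simp]:
  "ev 0 z = 0" "ev 1 z = 1" "ev (p + q) z = ev p z + ev q z" "ev (p * q) z = ev p z * ev q z"
  "ev (- p) z = - ev p z" "ev (p - q) z = ev p z - ev q z" "ev (smult c p) z = emb c * ev p z"
  "ev (pCons c p) z = emb c + z * ev p z" "ev (monom c n) z = emb c * z ^ n"
  "ev (p ^ n) z = ev p z ^ n"
  by (simp_all add: ev_def poly_monom)

lemma ev_sum: "ev (\<Sum>x\<in>A. F x) z = (\<Sum>x\<in>A. ev (F x) z)"
  by (induction A rule: infinite_finite_induct) auto

lemma ev_altdef: "ev p z = (\<Sum>i\<le>degree p. emb (coeff p i) * z ^ i)"
  by (simp add: ev_def poly_altdef)

lemma ev_pcompose: "ev (pcompose p q) z = ev p (ev q z)"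
  by (induction p) (auto simp: pcompose_pCons)

lemma clear_denominators:
  fixes c :: "'a::field fls"
  obtains N where "\<And>M. M \<ge> N \<Longrightarrow> \<exists>c'. fps_to_fls c' = fls_X ^ M * c"
proof
  fix M assume M: "M \<ge> nat (- fls_subdegree c)"
  have "fls_subdegree (fls_X ^ M * c) \<ge> 0"
  proof (cases "c = 0")
    case False
    then show ?thesis using M by (simp add: fls_X_power_times_conv_shift)
  qed simp
  then show "\<exists>c'. fps_to_fls c' = fls_X ^ M * c" by (metis fls_regpart_to_fls_trivial)
qed

lemma algebraic_over_fps:
  fixes z :: "'a::field puiseux"
  obtains p where "p \<noteq> 0" "ev p z = 0"
proof -
  obtain q where q: "q \<noteq> 0" "poly (map_poly to_ac q) z = 0"
    using alg_closure_algebraic by blast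
  have "\<exists>N. \<forall>M\<ge>N. \<exists>c'. fps_to_fls c' = fls_X ^ M * coeff q i" for i
    by (metis clear_denominators)
  then obtain N where N: "\<And>i M. M \<ge> N i \<Longrightarrow> \<exists>c'. fps_to_fls c' = fls_X ^ M * coeff q i"
    by metis
  define M where "M = (\<Sum>i\<le>degree q. N i)"
  have "N i \<le> M" if "i \<le> degree q" for i
    unfolding M_def by (rule member_le_sum) (use that in auto)
  then have "\<exists>c'. fps_to_fls c' = fls_X ^ M * coeff q i" for i
    using N by (cases "i \<le> degree q") (auto simp: coeff_eq_0 intro!: exI[of _ 0])
  then obtain c where c: "\<And>i. fps_to_fls (c i) = fls_X ^ M * coeff q i" by metis
  define p where "p = (\<Sum>i\<le>degree q. monom (c i) i)"
  have cp: "coeff p i = c i" for i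
    using c[of i] by (cases "i \<le> degree q") (auto simp: p_def coeff_sum coeff_eq_0)
  have "emb_poly p = smult (to_ac (fls_X ^ M)) (map_poly to_ac q)"
    by (rule poly_eqI) (simp add: cp emb_def c coeff_map_poly del: to_ac_power)
  then have "ev p z = 0" using q by (simp add: ev_def)
  moreover have "coeff p (degree q) \<noteq> 0" using c[of "degree q"] q by (auto simp: cp)
  then have "p \<noteq> 0" by auto
  ultimately show ?thesis by (rule that[rotated])
qed

lemma fps_unit_decompose:
  fixes c :: "'a::field fps" assumes "c \<noteq> 0"
  obtains u where "c = fps_X ^ subdegree c * u" "fps_nth u 0 \<noteq> 0"
proof
  show "c = fps_X ^ subdegree c * fps_shift (subdegree c) c"
    by (metis mult.commute subdegree_decompose)
  show "fps_nth (fps_shift (subdegree c) c) 0 \<noteq> 0" using assms by simp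
qed

lemma fps_unit_inverse: "fps_nth u 0 \<noteq> 0 \<Longrightarrow> u * inverse u = 1" for u :: "'a::field fps"
  by (rule inverse_mult_eq_1')

lemma emb_unit_inverse:
  assumes "fps_nth u 0 \<noteq> 0" shows "inverse (emb u) = emb (inverse u)"
  using fps_unit_inverse[OF assms] by (intro inverse_unique) (simp flip: emb_simps)

text \<open>Dividing out the content preserves the degree, and then some coefficient is a unit.\<close>

lemma primitive_annihilator:
  fixes z :: "'a::field puiseux"
  obtains p where "p \<noteq> 0" "ev p z = 0" "\<And>q. q \<noteq> 0 \<Longrightarrow> ev q z = 0 \<Longrightarrow> degree p \<le> degree q"
    "\<exists>i. fps_nth (coeff p i) 0 \<noteq> 0"
proof -
  let ?P = "\<lambda>p. p \<noteq> 0 \<and> ev p z = 0"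
  obtain p0 where "?P p0" using algebraic_over_fps by blast
  then obtain p where p: "?P p" and min: "\<And>q. ?P q \<Longrightarrow> degree p \<le> degree q"
    using ex_has_least_nat[of ?P p0 degree] by auto
  define n where "n = (LEAST n. \<exists>i. fps_nth (coeff p i) n \<noteq> 0)"
  have "\<exists>n i. fps_nth (coeff p i) n \<noteq> 0"
  proof (rule ccontr)
    assume "\<nexists>n i. fps_nth (coeff p i) n \<noteq> 0"
    then have "p = 0" by (intro poly_eqI fps_ext) auto
    then show False using p by simp
  qed
  then have n: "\<exists>i. fps_nth (coeff p i) n \<noteq> 0" unfolding n_def by (rule LeastI_ex)
  have low: "fps_nth (coeff p i) j = 0" if "j < n" for i j
    using not_less_Least[of j] that unfolding n_def by blast
  define q where "q = (\<Sum>i\<le>degree p. monom (fps_shift n (coeff p i)) i)"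
  have cq: "coeff q i = fps_shift n (coeff p i)" for i
    by (cases "i \<le> degree p") (auto simp: q_def coeff_sum coeff_eq_0)
  have pq: "p = smult (fps_X ^ n) q"
    by (intro poly_eqI fps_ext) (auto simp: cq fps_X_power_mult_nth low)
  then have "q \<noteq> 0" using p by auto
  moreover have "ev q z = 0" using p by (simp add: pq flip: unif_def)
  moreover have "degree q = degree p" by (simp add: pq)
  ultimately show ?thesis using that[of q] min n by (auto simp: cq)
qed

text \<open>Otherwise Hensel's lemma factors \<open>p\<close>, and one factor of smaller degree would annihilate \<open>z\<close>.\<close>

lemma annihilator_first_unit:
  assumes p: "p \<noteq> 0" "ev p z = 0" "\<And>q. q \<noteq> 0 \<Longrightarrow> ev q z = 0 \<Longrightarrow> degree p \<le> degree q"
    and r: "\<And>j. j < r \<Longrightarrow> fps_nth (coeff p j) 0 = 0" "fps_nth (coeff p r) 0 \<noteq> 0"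
  shows "r = 0 \<or> r = degree p"
proof -
  obtain W q where W: "p = W * q" "weierstrass W" "degree W = r"
    using hensel_factor[OF r] by blast
  have nz: "W \<noteq> 0" "q \<noteq> 0" using W p by auto
  then have deg: "degree p = degree W + degree q" by (simp add: W degree_mult_eq)
  have "ev W z = 0 \<or> ev q z = 0" using p(2) by (simp add: W)
  then show ?thesis using p(3) nz deg W(3) by fastforce
qed

definition integral_ring :: "'a::field puiseux set" where
  "integral_ring = {z. \<exists>p. lead_coeff p = 1 \<and> ev p z = 0}"

lemma integralI_unit:
  assumes "fps_nth (lead_coeff p) 0 \<noteq> 0" "ev p z = 0"
  shows "z \<in> integral_ring"
proof -
  let ?c = "inverse (lead_coeff p)"
  have c: "?c \<noteq> 0" using assms by (metis fps_unit_inverse mult_zero_right zero_neq_one)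
  have "lead_coeff (smult ?c p) = 1"
    using fps_unit_inverse[OF assms(1)] c by (simp add: mult.commute)
  then show ?thesis using assms(2) unfolding integral_ring_def by (auto intro!: exI[of _ "smult ?c p"])
qed

lemma ev_reflect:
  assumes "z \<noteq> 0" shows "ev (reflect_poly p) (inverse z) = ev p z / z ^ degree p"
proof -
  have "emb_poly (reflect_poly p) = reflect_poly (emb_poly p)"
    by (rule poly_eqI) (simp add: coeff_reflect_poly)
  then show ?thesis
    using assms by (simp add: ev_def poly_reflect_poly_nz field_simps power_inverse)
qed

text \<open>The integral closure of \<open>k[[X]]\<close> is a valuation ring: the first unit among the coefficients of
  a primitive annihilator is either the leading coefficient, which makes \<open>z\<close> integral, or the
  constant one, which makes the inverse integral.\<close>

lemma integral_or_inverse: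
  fixes z :: "'a::field puiseux"
  shows "z \<in> integral_ring \<or> inverse z \<in> integral_ring"
proof (cases "z = 0")
  case True
  then show ?thesis by (auto simp: integral_ring_def intro!: exI[of _ "[:0, 1:]"])
next
  case False
  obtain p where p: "p \<noteq> 0" "ev p z = 0" "\<And>q. q \<noteq> 0 \<Longrightarrow> ev q z = 0 \<Longrightarrow> degree p \<le> degree q"
    "\<exists>i. fps_nth (coeff p i) 0 \<noteq> 0"
    using primitive_annihilator by blast
  define r where "r = (LEAST i. fps_nth (coeff p i) 0 \<noteq> 0)"
  have r: "fps_nth (coeff p r) 0 \<noteq> 0" "\<And>j. j < r \<Longrightarrow> fps_nth (coeff p j) 0 = 0"
    using LeastI_ex[OF p(4)] not_less_Least unfolding r_def by blast+
  consider "r = 0" | "r = degree p" using annihilator_first_unit[OF p(1-3)] r by blast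
  then show ?thesis
  proof cases
    case 1
    then have "coeff p 0 \<noteq> 0" using r by auto
    then have "fps_nth (lead_coeff (reflect_poly p)) 0 \<noteq> 0"
      using 1 r(1) by (simp add: coeff_reflect_poly)
    moreover have "ev (reflect_poly p) (inverse z) = 0" using ev_reflect[OF False] p(2) by simp
    ultimately show ?thesis using integralI_unit by blast
  next
    case 2
    then show ?thesis using integralI_unit r(1) p(2) by blast
  qed
qed

text \<open>Elements that stabilise a nonzero finitely generated \<open>k[[X]]\<close>-module form a ring for formal
  reasons. Hensel's lemma identifies this ring with the integral closure.\<close>

interpretation fps_module: Modules.module "\<lambda>(c::'a::field fps) (z::'a puiseux). emb c * z"
  by unfold_locales (simp_all add: algebra_simps)

definition stabilizes :: "'a::field puiseux \<Rightarrow> 'a puiseux set \<Rightarrow> bool" where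
  "stabilizes z E \<longleftrightarrow> finite E \<and> (\<exists>e\<in>E. e \<noteq> 0) \<and> (\<forall>e\<in>E. z * e \<in> fps_module.span E)"

lemma span_mult_span:
  assumes "u \<in> fps_module.span E" "v \<in> fps_module.span F"
  shows "u * v \<in> fps_module.span ((\<lambda>(e, f). e * f) ` (E \<times> F))" (is "_ \<in> ?S")
proof -
  have 1: "e * v \<in> ?S" if e: "e \<in> E" for e
    using assms(2)
  proof (induction rule: fps_module.span_induct_alt)
    case (step c y z)
    have "e * y \<in> ?S" by (rule fps_module.span_base) (use e step in auto)
    then have "emb c * (e * y) + e * z \<in> ?S"
      by (intro fps_module.span_add fps_module.span_scale step)
    then show ?case by (simp add: algebra_simps)
  qed (simp add: fps_module.span_zero)
  show ?thesis using assms(1)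
  proof (induction rule: fps_module.span_induct_alt)
    case (step c y z)
    have "emb c * (y * v) + z * v \<in> ?S"
      by (intro fps_module.span_add fps_module.span_scale 1 step)
    then show ?case by (simp add: algebra_simps)
  qed (simp add: fps_module.span_zero)
qed

lemma stabilizes_span:
  assumes "stabilizes z E" "v \<in> fps_module.span E" shows "z * v \<in> fps_module.span E"
  using assms(2)
proof (induction rule: fps_module.span_induct_alt)
  case (step c y w)
  have "emb c * (z * y) + z * w \<in> fps_module.span E"
    using assms(1) step by (intro fps_module.span_add fps_module.span_scale) (auto simp: stabilizes_def)
  then show ?case by (simp add: algebra_simps)
qed (simp add: fps_module.span_zero)

text \<open>The products of the generators generate a module that both elements stabilise.\<close>

lemma stabilizes_common:
  assumes "stabilizes z E" "stabilizes w F"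
  obtains G where "stabilizes z G" "stabilizes w G"
proof
  define G where "G = (\<lambda>(e, f). e * f) ` (E \<times> F)"
  have fin: "finite G" and nz: "\<exists>g\<in>G. g \<noteq> 0"
    using assms by (auto simp: G_def stabilizes_def intro!: bexI)
  have "z * (e * f) \<in> fps_module.span G" if "e \<in> E" "f \<in> F" for e f
    unfolding G_def using span_mult_span[of "z * e" E f F] assms(1) that
    by (simp add: stabilizes_def fps_module.span_base mult.assoc)
  then show "stabilizes z G" using fin nz by (auto simp: stabilizes_def G_def)
  have "w * (e * f) \<in> fps_module.span G" if "e \<in> E" "f \<in> F" for e f
  proof -
    have "e * (w * f) \<in> fps_module.span G"
      unfolding G_def using span_mult_span[of e E "w * f" F] assms(2) that
      by (simp add: stabilizes_def fps_module.span_base)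
    then show ?thesis by (simp only: mult.left_commute)
  qed
  then show "stabilizes w G" using fin nz by (auto simp: stabilizes_def G_def)
qed

lemma stabilizes_add: "stabilizes z G \<Longrightarrow> stabilizes w G \<Longrightarrow> stabilizes (z + w) G"
  by (simp add: stabilizes_def distrib_right fps_module.span_add)

lemma stabilizes_mult: "stabilizes z G \<Longrightarrow> stabilizes w G \<Longrightarrow> stabilizes (z * w) G"
  using stabilizes_span[of z G] by (simp add: stabilizes_def mult.assoc)

lemma stabilizes_emb: "finite G \<Longrightarrow> \<exists>e\<in>G. e \<noteq> 0 \<Longrightarrow> stabilizes (emb c) G"
  by (simp add: stabilizes_def fps_module.span_scale fps_module.span_base)

lemma stabilizes_ev: "stabilizes z G \<Longrightarrow> stabilizes (ev p z) G"
proof (induction p)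
  case 0
  then show ?case using stabilizes_emb[of G 0] by (simp add: stabilizes_def)
next
  case (pCons c p)
  then have "stabilizes (emb c) G" using stabilizes_emb[of G c] by (simp add: stabilizes_def)
  with pCons show ?case by (simp add: stabilizes_add stabilizes_mult)
qed

lemma integral_imp_stabilizes:
  assumes "z \<in> integral_ring" obtains E where "stabilizes z E"
proof -
  obtain p where p: "lead_coeff p = 1" "ev p z = 0" using assms by (auto simp: integral_ring_def)
  define n where "n = degree p"
  have "n > 0"
  proof (rule ccontr)
    assume "\<not> n > 0"
    then obtain c where "p = [:c:]" unfolding n_def by (metis degree_eq_zeroE neq0_conv)
    then show False using p by simp
  qed
  define E where "E = (\<lambda>i. z ^ i) ` {..<n}"
  have "0 = (\<Sum>i\<le>n. emb (coeff p i) * z ^ i)" using p(2) by (simp add: ev_altdef n_def)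
  also have "\<dots> = z ^ n + (\<Sum>i<n. emb (coeff p i) * z ^ i)"
    using p(1) by (simp add: lessThan_Suc_atMost[symmetric] n_def)
  finally have "z ^ n = (\<Sum>i<n. emb (- coeff p i) * z ^ i)"
    by (simp add: sum_negf eq_neg_iff_add_eq_0)
  moreover have "\<dots> \<in> fps_module.span E"
    by (intro fps_module.span_sum fps_module.span_scale fps_module.span_base) (auto simp: E_def)
  ultimately have top: "z ^ n \<in> fps_module.span E" by simp
  have "z * z ^ i \<in> fps_module.span E" if "i < n" for i
  proof (cases "Suc i = n")
    case False
    then have "z ^ Suc i \<in> E" using that unfolding E_def by (intro imageI) auto
    then show ?thesis using fps_module.span_base by fastforce
  qed (use top in auto)
  then have "\<forall>e\<in>E. z * e \<in> fps_module.span E" unfolding E_def by auto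
  moreover have "1 \<in> E" unfolding E_def using \<open>n > 0\<close> by (intro image_eqI[of _ _ 0]) auto
  then have "\<exists>e\<in>E. e \<noteq> 0" by (intro bexI[of _ 1]) auto
  moreover have "finite E" by (simp add: E_def)
  ultimately show ?thesis by (intro that[of E]) (simp add: stabilizes_def)
qed

text \<open>Nakayama's lemma for the ideal \<open>(X)\<close> of the local ring \<open>k[[X]]\<close>.\<close>

lemma span_nakayama:
  assumes "finite E" "\<And>e. e \<in> E \<Longrightarrow> \<exists>w\<in>fps_module.span E. e = unif * w"
  shows "\<forall>e\<in>E. e = 0"
  using assms
proof (induction E rule: finite_induct)
  case (insert x E)
  obtain w where w: "w \<in> fps_module.span (insert x E)" "x = unif * w" using insert.prems by blast
  obtain c where c: "w - emb c * x \<in> fps_module.span E"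
    using w(1) by (auto simp: fps_module.span_breakdown_eq)
  define u where "u = 1 - fps_X * c"
  have u: "fps_nth u 0 \<noteq> 0" by (simp add: u_def)
  have "emb u * x = unif * (w - emb c * x)"
    using w(2) by (simp add: u_def unif_def[symmetric] algebra_simps)
  moreover have "emb u \<noteq> 0" using u by auto
  ultimately have "x = inverse (emb u) * (unif * (w - emb c * x))"
    by (metis (no_types) mult.assoc left_inverse mult_1_left)
  then have x: "x = unif * (emb (inverse u) * (w - emb c * x))"
    unfolding emb_unit_inverse[OF u] by (simp only: mult.left_commute)
  define v where "v = emb (inverse u) * (w - emb c * x)"
  have v: "v \<in> fps_module.span E" unfolding v_def by (intro fps_module.span_scale c)
  have "\<exists>w'\<in>fps_module.span E. e = unif * w'" if "e \<in> E" for e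
  proof -
    obtain w' where w': "w' \<in> fps_module.span (insert x E)" "e = unif * w'"
      using insert.prems \<open>e \<in> E\<close> by blast
    obtain c' where c': "w' - emb c' * x \<in> fps_module.span E"
      using w'(1) by (auto simp: fps_module.span_breakdown_eq)
    have "w' = (w' - emb c' * x) + emb (c' * fps_X) * v"
      using x by (simp add: v_def[symmetric] unif_def)
    moreover have "\<dots> \<in> fps_module.span E"
      by (intro fps_module.span_add fps_module.span_scale c' v)
    ultimately show ?thesis using w'(2) by auto
  qed
  then have E0: "\<forall>e\<in>E. e = 0" by (rule insert.IH)
  then have "fps_module.span E \<subseteq> {0}"
    by (intro fps_module.span_minimal fps_module.subspace_single_0) auto
  then have "v = 0" using v by auto
  then show ?case using E0 x by (simp add: v_def[symmetric])
qed simp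

lemma not_stabilizes_inverse_unif: "\<not> stabilizes (inverse unif) E"
proof
  assume st: "stabilizes (inverse unif) E"
  have "\<exists>w\<in>fps_module.span E. e = unif * w" if "e \<in> E" for e
    using st that by (intro bexI[of _ "inverse unif * e"]) (auto simp: stabilizes_def)
  then show False using span_nakayama[of E] st by (auto simp: stabilizes_def)
qed

text \<open>If \<open>z\<close> is not integral, then the constant coefficient is the only unit among the coefficients
  of a primitive annihilator of \<open>z\<close>. Solving for it exhibits the inverse of \<open>X\<close> as an element of the
  ring of stabilizers, which contradicts Nakayama's lemma.\<close>

lemma stabilizes_imp_integral:
  assumes st: "stabilizes z E"
  shows "z \<in> integral_ring"
proof (cases "z = 0")
  case True
  then show ?thesis by (auto simp: integral_ring_def intro!: exI[of _ "[:0, 1:]"])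
next
  case False
  obtain p where p: "p \<noteq> 0" "ev p z = 0" "\<And>q. q \<noteq> 0 \<Longrightarrow> ev q z = 0 \<Longrightarrow> degree p \<le> degree q"
    "\<exists>i. fps_nth (coeff p i) 0 \<noteq> 0"
    using primitive_annihilator by blast
  have c0: "coeff p 0 \<noteq> 0"
  proof
    assume "coeff p 0 = 0"
    then obtain q where q: "p = pCons 0 q" by (metis coeff_pCons_0 pCons_cases)
    then have "q \<noteq> 0" "ev q z = 0" "degree p = Suc (degree q)" using p False by auto
    then show False using p(3) by fastforce
  qed
  show ?thesis
  proof (rule ccontr)
    assume nint: "z \<notin> integral_ring"
    then have lead: "fps_nth (lead_coeff p) 0 = 0" using integralI_unit p(2) by blast
    let ?q = "reflect_poly p"
    have dq: "degree ?q = degree p" using c0 by (rule degree_reflect_poly_eq)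
    have q: "?q \<noteq> 0" "ev ?q (inverse z) = 0" using p ev_reflect[OF False, of p] by auto
    have qmin: "degree ?q \<le> degree s" if s: "s \<noteq> 0" "ev s (inverse z) = 0" for s
    proof -
      have "ev (reflect_poly s) z = 0" using ev_reflect[of "inverse z" s] False s(2) by simp
      then have "degree p \<le> degree (reflect_poly s)" using p(3) s(1) by simp
      then show ?thesis using degree_reflect_poly_le[of s] dq by simp
    qed
    define r where "r = (LEAST i. fps_nth (coeff ?q i) 0 \<noteq> 0)"
    have "\<exists>i. fps_nth (coeff ?q i) 0 \<noteq> 0"
    proof -
      obtain i where i: "fps_nth (coeff p i) 0 \<noteq> 0" using p(4) by blast
      then have "i \<le> degree p" by (metis coeff_eq_0 fps_zero_nth not_le)
      then show ?thesis using i by (intro exI[of _ "degree p - i"]) (simp add: coeff_reflect_poly)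
    qed
    then have r1: "fps_nth (coeff ?q r) 0 \<noteq> 0"
      unfolding r_def by (rule LeastI_ex[of "\<lambda>i. fps_nth (coeff ?q i) 0 \<noteq> 0"])
    have r2: "fps_nth (coeff ?q j) 0 = 0" if "j < r" for j
      using not_less_Least[of j "\<lambda>i. fps_nth (coeff ?q i) 0 \<noteq> 0"] that unfolding r_def by simp
    note r = r1 r2
    have "r \<noteq> 0" using r1 lead by (metis coeff_0_reflect_poly)
    then have "r = degree p"
      using annihilator_first_unit[OF q qmin r2 r1] dq by auto
    then have low: "fps_nth (coeff p i) 0 = 0" if "i \<noteq> 0" for i
    proof (cases "i \<le> degree p")
      case True
      then have "degree p - (degree p - i) = i" "\<not> degree p < degree p - i" by auto
      then show ?thesis using r2[of "degree p - i"] that True \<open>r = degree p\<close>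
        by (simp add: coeff_reflect_poly del: diff_diff_cancel)
    qed (simp add: coeff_eq_0)
    then have u: "fps_nth (coeff p 0) 0 \<noteq> 0" using p(4) by metis
    \<comment> \<open>So the constant coefficient is a multiple of \<open>X\<close> in the ring of stabilizers of \<open>E\<close>.\<close>
    define s where "s = (\<Sum>i\<le>degree p. monom (if i = 0 then 0 else fps_shift 1 (coeff p i)) i)"
    have cs: "coeff s i = (if i = 0 then 0 else fps_shift 1 (coeff p i))" for i
      by (cases "i \<le> degree p") (auto simp: s_def coeff_sum coeff_eq_0)
    have "p = [:coeff p 0:] + smult fps_X s"
    proof (intro poly_eqI fps_ext)
      fix i n
      show "fps_nth (coeff p i) n = fps_nth (coeff ([:coeff p 0:] + smult fps_X s) i) n"
        using low[of i] by (cases i; cases n) (auto simp: cs)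
    qed
    then have "ev p z = ev ([:coeff p 0:] + smult fps_X s) z" by simp
    then have "0 = emb (coeff p 0) + unif * ev s z"
      using p(2) by (simp add: unif_def)
    then have "emb (coeff p 0) = - (unif * ev s z)" by (simp add: eq_neg_iff_add_eq_0)
    moreover from this have "ev s z \<noteq> 0" using c0 by auto
    ultimately have "inverse unif = - (ev s z * inverse (emb (coeff p 0)))"
      by (simp add: field_simps)
    also have "\<dots> = emb (- inverse (coeff p 0)) * ev s z"
      by (simp add: emb_unit_inverse[OF u])
    finally have eq: "inverse unif = emb (- inverse (coeff p 0)) * ev s z" .
    have "stabilizes (inverse unif) E"
      unfolding eq by (rule stabilizes_mult[OF stabilizes_emb stabilizes_ev[OF st]])
        (use st in \<open>auto simp: stabilizes_def\<close>)
    then show False using not_stabilizes_inverse_unif by blast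
  qed
qed

lemma integral_iff_stabilizes: "z \<in> integral_ring \<longleftrightarrow> (\<exists>E. stabilizes z E)"
  by (metis integral_imp_stabilizes stabilizes_imp_integral)

lemma integral_add: "z \<in> integral_ring \<Longrightarrow> w \<in> integral_ring \<Longrightarrow> z + w \<in> integral_ring"
  and integral_mult: "z \<in> integral_ring \<Longrightarrow> w \<in> integral_ring \<Longrightarrow> z * w \<in> integral_ring"
  by (metis integral_iff_stabilizes stabilizes_common stabilizes_add stabilizes_mult)+

lemma integral_emb: "emb c \<in> integral_ring"
  unfolding integral_ring_def by (auto intro!: exI[of _ "[:-c, 1:]"])

lemma integral_0 [simp]: "0 \<in> integral_ring" and integral_1 [simp]: "1 \<in> integral_ring"
  using integral_emb[of 0] integral_emb[of 1] by simp_all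

lemma integral_uminus: "z \<in> integral_ring \<Longrightarrow> - z \<in> integral_ring"
  using integral_mult[OF integral_emb[of "-1"], of z] by simp

lemma integral_sum: "(\<And>x. x \<in> A \<Longrightarrow> F x \<in> integral_ring) \<Longrightarrow> (\<Sum>x\<in>A. F x) \<in> integral_ring"
  by (induction A rule: infinite_finite_induct) (auto intro: integral_add)

lemma integral_power: "z \<in> integral_ring \<Longrightarrow> z ^ n \<in> integral_ring"
  by (induction n) (auto intro: integral_mult)

lemma integral_ev: "z \<in> integral_ring \<Longrightarrow> ev p z \<in> integral_ring"
  by (metis integral_iff_stabilizes stabilizes_ev)

lemma inverse_unif_not_integral: "inverse unif \<notin> integral_ring"
  using integral_iff_stabilizes not_stabilizes_inverse_unif by blast

lemma integral_root: assumes "z ^ n \<in> integral_ring" "n > 0" shows "z \<in> integral_ring"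
proof (cases "inverse z \<in> integral_ring \<and> z \<noteq> 0")
  case True
  then have "z ^ n * inverse z ^ (n - 1) \<in> integral_ring"
    by (intro integral_mult assms integral_power) auto
  moreover have "z ^ n * inverse z ^ (n - 1) = z"
    using True assms(2) by (cases n) (auto simp: field_simps power_inverse)
  ultimately show ?thesis by simp
qed (use integral_or_inverse in auto)


definition integral_unit :: "'a::field puiseux \<Rightarrow> bool" where
  "integral_unit z \<longleftrightarrow> z \<noteq> 0 \<and> z \<in> integral_ring \<and> inverse z \<in> integral_ring"

lemma integral_unit_mult: "integral_unit z \<Longrightarrow> integral_unit w \<Longrightarrow> integral_unit (z * w)"
  by (simp add: integral_unit_def integral_mult)

lemma integral_unit_inverse: "integral_unit z \<Longrightarrow> integral_unit (inverse z)"
  by (simp add: integral_unit_def)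

lemma integral_unit_power: "integral_unit z \<Longrightarrow> integral_unit (z ^ n)"
  by (induction n) (auto simp: integral_unit_mult, simp add: integral_unit_def)

lemma integral_unit_emb: "fps_nth u 0 \<noteq> 0 \<Longrightarrow> integral_unit (emb u)"
  by (auto simp: integral_unit_def emb_unit_inverse integral_emb)

lemma unif_powi_integral: "unif powi m \<in> integral_ring \<longleftrightarrow> m \<ge> 0"
proof
  assume *: "unif powi m \<in> integral_ring"
  show "m \<ge> 0"
  proof (rule ccontr)
    assume "\<not> m \<ge> 0"
    then have "unif powi m = inverse unif ^ nat (- m)" "nat (- m) > 0"
      by (auto simp: power_int_def)
    then show False using * integral_root inverse_unif_not_integral by metis
  qed
next
  assume "m \<ge> 0"
  then show "unif powi m \<in> integral_ring"
    by (simp add: power_int_def unif_def integral_emb integral_power)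
qed

lemma integral_unit_unif_powi: "integral_unit (unif powi m) \<longleftrightarrow> m = 0"
proof -
  have "inverse (unif powi m) \<in> integral_ring \<longleftrightarrow> - m \<ge> 0"
    using unif_powi_integral[of "- m"] by (simp add: power_int_minus)
  then show ?thesis unfolding integral_unit_def unif_powi_integral by auto
qed

text \<open>The valuation of \<open>z\<close>, normalised by giving \<open>X\<close> the value one, is the slope \<open>m / n\<close>.\<close>

definition slope :: "'a::field puiseux \<Rightarrow> int \<Rightarrow> nat \<Rightarrow> bool" where
  "slope z m n \<longleftrightarrow> n > 0 \<and> integral_unit (z ^ n / unif powi m)"

lemma slope_unique:
  fixes z :: "'a::field puiseux"
  assumes "slope z m n" "slope z m' n'"
  shows "m * int n' = m' * int n"
proof -
  let ?a = "z ^ n / unif powi m" and ?b = "z ^ n' / unif powi m'"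
  have z: "z \<noteq> 0"
  proof
    assume "z = 0"
    then show False using assms(1) by (auto simp: slope_def integral_unit_def)
  qed
  have 1: "?a ^ n' = z ^ (n * n') / unif powi (m * int n')"
    by (simp add: power_divide power_mult power_int_mult)
  have 2: "?b ^ n = z ^ (n * n') / unif powi (m' * int n)"
    by (simp add: power_divide power_mult power_int_mult mult.commute[of n])
  have "?a ^ n' / ?b ^ n = unif powi (m' * int n) / unif powi (m * int n')"
    unfolding 1 2 using z by simp
  also have "\<dots> = unif powi (m' * int n - m * int n')" by (simp add: power_int_diff)
  finally have eq: "?a ^ n' * inverse (?b ^ n) = unif powi (m' * int n - m * int n')"
    by (simp only: divide_inverse)
  have "integral_unit (?a ^ n' * inverse (?b ^ n))" using assms
    by (intro integral_unit_mult integral_unit_inverse integral_unit_power) (auto simp: slope_def)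
  then have "integral_unit ((unif :: 'a puiseux) powi (m' * int n - m * int n'))"
    by (simp only: eq)
  then show ?thesis by (simp add: integral_unit_unif_powi)
qed

lemma slope_mult:
  assumes "slope z m n" "slope w m' n'"
  shows "slope (z * w) (m * int n' + m' * int n) (n * n')"
proof -
  let ?a = "z ^ n / unif powi m" and ?b = "w ^ n' / unif powi m'"
  have 1: "?a ^ n' = z ^ (n * n') / unif powi (m * int n')"
    by (simp add: power_divide power_mult power_int_mult)
  have 2: "?b ^ n = w ^ (n * n') / unif powi (m' * int n)"
    by (simp add: power_divide power_mult power_int_mult mult.commute[of n])
  have "(z * w) ^ (n * n') / unif powi (m * int n' + m' * int n) = ?a ^ n' * ?b ^ n"
    unfolding 1 2 by (simp add: power_mult_distrib power_int_add)
  then show ?thesis using assms by (simp add: slope_def integral_unit_mult integral_unit_power)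
qed

text \<open>In a vanishing sum the largest value is attained twice.\<close>

lemma integral_unit_of_sum_zero:
  assumes "finite I" "(\<Sum>i\<in>I. T i) = 0" "\<And>i. i \<in> I \<Longrightarrow> T i \<noteq> 0" "I \<noteq> {}"
  shows "\<exists>i\<in>I. \<exists>j\<in>I. i \<noteq> j \<and> integral_unit (T i / T j)"
proof -
  have max: "\<exists>i\<in>J. \<forall>j\<in>J. T j / T i \<in> integral_ring" if "finite J" "J \<noteq> {}" "J \<subseteq> I" for J
    using that
  proof (induction J rule: finite_ne_induct)
    case (singleton x)
    then show ?case using assms(3) by auto
  next
    case (insert x J)
    then obtain i where i: "i \<in> J" "\<forall>j\<in>J. T j / T i \<in> integral_ring" by auto
    have nz: "T i \<noteq> 0" "T x \<noteq> 0" using insert.prems i(1) assms(3) by auto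
    show ?case
    proof (cases "T x / T i \<in> integral_ring")
      case True
      then show ?thesis using i nz by auto
    next
      case False
      then have "T i / T x \<in> integral_ring"
        using integral_or_inverse[of "T x / T i"] by (simp add: field_simps)
      then have "T j / T i * (T i / T x) \<in> integral_ring" if "j \<in> J" for j
        using i(2) that integral_mult by blast
      then show ?thesis using nz by (intro bexI[of _ x]) auto
    qed
  qed
  obtain i where i: "i \<in> I" "\<forall>j\<in>I. T j / T i \<in> integral_ring" using max[of I] assms by auto
  have Ti: "T i \<noteq> 0" using assms(3) i(1) by blast
  show ?thesis
  proof (rule ccontr)
    assume none: "\<not> ?thesis"
    \<comment> \<open>If no other term is as large as \<open>T i\<close>, then all of them are divisible by a common
       nonunit of the valuation ring.\<close>
    have nonunit: "T i / T j \<notin> integral_ring" if "j \<in> I" "j \<noteq> i" for j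
      using none i that assms(3) unfolding integral_unit_def
      by (metis divide_eq_0_iff inverse_divide)
    have "I - {i} \<noteq> {}"
    proof
      assume "I - {i} = {}"
      then have "I = {i}" using i(1) by auto
      then show False using assms(2) Ti by simp
    qed
    then obtain l where l: "l \<in> I" "l \<noteq> i" "\<forall>j\<in>I - {i}. T j / T l \<in> integral_ring"
      using max[of "I - {i}"] assms(1) by auto
    have Tl: "T l \<noteq> 0" using assms(3) l(1) by blast
    have "T i + (\<Sum>j\<in>I - {i}. T j) = 0" using assms(1,2) i(1) by (simp add: sum.remove)
    then have "T i = - (\<Sum>j\<in>I - {i}. T j)" by (simp add: eq_neg_iff_add_eq_0)
    then have "T i / T l = - (\<Sum>j\<in>I - {i}. T j / T l)"
      by (simp add: sum_divide_distrib)
    also have "\<dots> \<in> integral_ring" using l(3) by (intro integral_uminus integral_sum) auto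
    finally show False using nonunit l by blast
  qed
qed

text \<open>Two terms of an algebraic equation of \<open>z\<close> have the same value, and their quotient is a power
  of \<open>z\<close> times an element of \<open>k((X))\<close>.\<close>

lemma slope_exists:
  fixes z :: "'a::field puiseux"
  assumes "z \<noteq> 0" obtains m n where "slope z m n"
proof -
  obtain p where p: "p \<noteq> 0" "ev p z = 0" using algebraic_over_fps by blast
  define I where "I = {i. i \<le> degree p \<and> coeff p i \<noteq> 0}"
  have fin: "finite I" by (simp add: I_def)
  let ?T = "\<lambda>i. emb (coeff p i) * z ^ i"
  have "(\<Sum>i\<in>I. ?T i) = (\<Sum>i\<le>degree p. ?T i)"
    by (rule sum.mono_neutral_left) (auto simp: I_def)
  then have "(\<Sum>i\<in>I. ?T i) = 0" using p(2) by (simp add: ev_altdef)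
  moreover have "degree p \<in> I" using p(1) by (simp add: I_def)
  ultimately obtain i j where ij: "i \<in> I" "j \<in> I" "i \<noteq> j" "integral_unit (?T i / ?T j)"
    using integral_unit_of_sum_zero[OF fin, of ?T] assms unfolding I_def by fastforce
  have main: "\<exists>m n. slope z m n" if ij: "i \<in> I" "j \<in> I" "j < i" "integral_unit (?T i / ?T j)" for i j
  proof -
    let ?a = "subdegree (coeff p i)" and ?b = "subdegree (coeff p j)"
    obtain u where u: "coeff p i = fps_X ^ ?a * u" "fps_nth u 0 \<noteq> 0"
      using fps_unit_decompose ij(1) unfolding I_def by blast
    obtain v where v: "coeff p j = fps_X ^ ?b * v" "fps_nth v 0 \<noteq> 0"
      using fps_unit_decompose ij(2) unfolding I_def by blast
    have nz: "emb u \<noteq> 0" "emb v \<noteq> 0" using u v by auto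
    have e: "z ^ i = z ^ (i - j) * z ^ j" using ij(3) by (simp flip: power_add)
    have "?T i / ?T j * (emb v * inverse (emb u)) =
        (unif ^ ?a * emb u * (z ^ (i - j) * z ^ j)) / (unif ^ ?b * emb v * z ^ j)
          * (emb v * inverse (emb u))"
      by (subst u(1), subst v(1)) (simp add: unif_def e)
    also have "\<dots> = z ^ (i - j) * unif ^ ?a / unif ^ ?b"
      using nz assms by (simp add: divide_simps)
    also have "\<dots> = z ^ (i - j) / unif powi (int ?b - int ?a)"
      by (simp add: power_int_diff)
    finally have eq: "?T i / ?T j * (emb v * inverse (emb u)) =
      z ^ (i - j) / unif powi (int ?b - int ?a)" .
    have "integral_unit (?T i / ?T j * (emb v * inverse (emb u)))"
      by (intro integral_unit_mult integral_unit_inverse ij(4) integral_unit_emb u v)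
    then have "slope z (int ?b - int ?a) (i - j)" unfolding slope_def eq[symmetric] using ij(3) by simp
    then show ?thesis by blast
  qed
  have "\<exists>m n. slope z m n"
  proof (cases "j < i")
    case False
    have "integral_unit (inverse (?T i / ?T j))" using ij(4) by (rule integral_unit_inverse)
    moreover have "inverse (?T i / ?T j) = ?T j / ?T i" by simp
    ultimately show ?thesis using main[of j i] ij(1-3) False by simp
  qed (use main[of i j] ij in blast)
  then show thesis using that by blast
qed

definition absv :: "'a::field puiseux \<Rightarrow> real" where
  "absv z = (if z = 0 then 0 else
     exp (THE r. \<exists>m n. slope z m n \<and> r = - (real_of_int m / real n)))"

lemma slope_nonzero: "slope z m n \<Longrightarrow> z \<noteq> 0"
  by (auto simp: slope_def integral_unit_def)

lemma absv_slope:
  assumes "slope z m n" shows "absv z = exp (- (real_of_int m / real n))"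
proof -
  have "(THE r. \<exists>m n. slope z m n \<and> r = - (real_of_int m / real n)) = - (real_of_int m / real n)"
  proof (rule the_equality)
    fix r assume "\<exists>m n. slope z m n \<and> r = - (real_of_int m / real n)"
    then obtain m' n' where r: "slope z m' n'" "r = - (real_of_int m' / real n')" by blast
    have "real_of_int m * real n' = real_of_int m' * real n"
      using slope_unique[OF assms r(1)] by (metis of_int_mult of_int_of_nat_eq)
    moreover have "real n > 0" "real n' > 0" using assms r(1) by (auto simp: slope_def)
    ultimately show "r = - (real_of_int m / real n)"
      unfolding r(2) by (simp add: frac_eq_eq)
  qed (use assms in blast)
  then show ?thesis using slope_nonzero[OF assms] by (simp add: absv_def)
qed

lemma absv_0 [simp]: "absv 0 = 0"
  by (simp add: absv_def)

lemma absv_pos: "z \<noteq> 0 \<Longrightarrow> absv z > 0"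
  using slope_exists[of z] absv_slope by (metis exp_gt_zero)

lemma absv_nonneg [simp]: "absv z \<ge> 0"
  using absv_pos[of z] by (cases "z = 0") auto

lemma absv_eq_0_iff [simp]: "absv z = 0 \<longleftrightarrow> z = 0"
  using absv_pos[of z] by (cases "z = 0") auto

lemma absv_mult [simp]: "absv (z * w) = absv z * absv w"
proof (cases "z = 0 \<or> w = 0")
  case False
  then obtain m n m' n' where s: "slope z m n" "slope w m' n'" by (metis slope_exists)
  then have "n > 0" "n' > 0" by (auto simp: slope_def)
  then show ?thesis using absv_slope[OF slope_mult[OF s]] s
    by (simp add: absv_slope exp_add[symmetric] add_divide_distrib)
qed auto

text \<open>A root of an integral element is integral, so the sign of the slope decides integrality.\<close>

lemma absv_le_1_iff: "absv z \<le> 1 \<longleftrightarrow> z \<in> integral_ring"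
proof (cases "z = 0")
  case False
  then obtain m n where s: "slope z m n" by (rule slope_exists)
  then have n: "n > 0" and u: "integral_unit (z ^ n / unif powi m)" by (auto simp: slope_def)
  have "absv z \<le> 1 \<longleftrightarrow> m \<ge> 0" using n by (simp add: absv_slope[OF s] zero_le_divide_iff)
  also have "\<dots> \<longleftrightarrow> z \<in> integral_ring"
  proof
    assume "m \<ge> 0"
    then have "(z ^ n / unif powi m) * unif powi m \<in> integral_ring"
      using u by (intro integral_mult) (auto simp: integral_unit_def unif_powi_integral)
    then show "z \<in> integral_ring" using integral_root[OF _ n] by simp
  next
    assume "z \<in> integral_ring"
    then have "z ^ n * inverse (z ^ n / unif powi m) \<in> integral_ring"
      using u by (intro integral_mult integral_power) (auto simp: integral_unit_def)
    then show "m \<ge> 0" using False by (simp add: unif_powi_integral)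
  qed
  finally show ?thesis .
qed simp

lemma absv_1 [simp]: "absv 1 = 1"
  using absv_mult[of 1 1] by (metis absv_eq_0_iff mult_cancel_right1 zero_neq_one mult_1)

lemma absv_uminus [simp]: "absv (- z) = absv z"
proof -
  have "absv (- 1 :: 'a puiseux) * absv (- 1 :: 'a puiseux) = 1"
    by (simp flip: absv_mult)
  then have "absv (- 1 :: 'a puiseux) = 1"
    by (metis absv_nonneg abs_of_nonneg abs_square_eq_1 power2_eq_square)
  then show ?thesis using absv_mult[of "-1" z] by simp
qed

lemma absv_minus_commute: "absv (z - w) = absv (w - z)"
  using absv_uminus[of "z - w"] by simp

lemma absv_inverse [simp]: "absv (inverse z) = inverse (absv z)"
proof (cases "z = 0")
  case False
  then have "absv z * absv (inverse z) = 1" by (simp flip: absv_mult)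
  then show ?thesis by (metis inverse_unique)
qed simp

lemma absv_divide [simp]: "absv (z / w) = absv z / absv w"
  by (simp add: divide_inverse)

lemma absv_power [simp]: "absv (z ^ n) = absv z ^ n"
  by (induction n) auto

lemma absv_add: "absv (z + w) \<le> max (absv z) (absv w)"
proof -
  have main: "absv (z + w) \<le> absv w" if "absv z \<le> absv w" for z w :: "'a puiseux"
  proof (cases "w = 0")
    case False
    have "absv (z / w) \<le> 1" using that False absv_pos[of w] by simp
    then have "absv (z / w + 1) \<le> 1" unfolding absv_le_1_iff by (intro integral_add) auto
    moreover have "z + w = w * (z / w + 1)" using False by (simp add: field_simps)
    ultimately show ?thesis by (metis absv_mult absv_nonneg mult_left_le)
  qed (use that in \<open>simp add: order_antisym\<close>)
  show ?thesis using main[of z w] main[of w z] by (cases "absv z \<le> absv w") (auto simp: add.commute)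
qed

lemma absv_diff: "absv (z - w) \<le> max (absv z) (absv w)"
  using absv_add[of z "- w"] by simp

lemma absv_sum_le:
  assumes "\<And>x. x \<in> A \<Longrightarrow> absv (F x) \<le> B" "B \<ge> 0"
  shows "absv (\<Sum>x\<in>A. F x) \<le> B"
  using assms
proof (induction A rule: infinite_finite_induct)
  case (insert x A)
  then have "max (absv (F x)) (absv (\<Sum>x\<in>A. F x)) \<le> B" by auto
  then have "absv (F x + (\<Sum>x\<in>A. F x)) \<le> B" by (rule order_trans[OF absv_add])
  then show ?case using insert by simp
qed auto

lemma absv_sum_less:
  assumes "\<And>x. x \<in> A \<Longrightarrow> absv (F x) < B" "B > 0"
  shows "absv (\<Sum>x\<in>A. F x) < B"
  using assms
proof (induction A rule: infinite_finite_induct)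
  case (insert x A)
  then have "max (absv (F x)) (absv (\<Sum>x\<in>A. F x)) < B" by auto
  then have "absv (F x + (\<Sum>x\<in>A. F x)) < B" by (rule order_le_less_trans[OF absv_add])
  then show ?case using insert by simp
qed auto

lemma absv_prod_mset: "absv (\<Prod>x\<in>#M. F x) = (\<Prod>x\<in>#M. absv (F x))"
  by (induction M) auto

lemma absv_add_eq: "absv z < absv w \<Longrightarrow> absv (z + w) = absv w"
proof (rule antisym)
  assume "absv z < absv w"
  then show "absv (z + w) \<le> absv w" using absv_add[of z w] by simp
  show "absv w \<le> absv (z + w)"
    using absv_diff[of "z + w" z] \<open>absv z < absv w\<close> by (auto simp: max_def split: if_splits)
qed

lemma absv_unif: "absv unif = exp (- 1)"
proof -
  have "slope unif 1 1" by (simp add: slope_def integral_unit_def)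
  from absv_slope[OF this] show ?thesis by simp
qed

lemma absv_emb_unit: "fps_nth u 0 \<noteq> 0 \<Longrightarrow> absv (emb u) = 1"
  using integral_unit_emb[of u] absv_le_1_iff[of "emb u"] absv_le_1_iff[of "inverse (emb u)"]
  by (auto simp: integral_unit_def absv_pos field_simps intro!: antisym)

lemma absv_emb:
  fixes c :: "'a::field fps"
  assumes "c \<noteq> 0" shows "absv (emb c) = exp (- real (subdegree c))"
proof -
  from assms obtain u where u: "c = fps_X ^ subdegree c * u" "fps_nth u 0 \<noteq> 0"
    by (rule fps_unit_decompose)
  have "absv (emb c) = absv (emb (fps_X ^ subdegree c * u))"
    by (rule arg_cong[OF u(1)])
  also have "\<dots> = absv (unif :: 'a puiseux) ^ subdegree c * absv (emb u)" by (simp add: unif_def)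
  finally show ?thesis using absv_emb_unit[OF u(2)]
    by (simp add: absv_unif exp_of_nat_mult[symmetric])
qed

lemma absv_emb_le_1: "absv (emb c) \<le> 1"
  by (simp add: absv_le_1_iff integral_emb)

lemma absv_emb_nonunit: "fps_nth c 0 = 0 \<Longrightarrow> absv (emb c) \<le> exp (-1)"
proof (cases "c = 0")
  case False
  assume "fps_nth c 0 = 0"
  then have "subdegree c \<ge> 1" using False by (metis nth_subdegree_nonzero One_nat_def Suc_leI neq0_conv)
  then show ?thesis using absv_emb[OF False] by simp
qed simp

text \<open>Modulo the maximal ideal, an integral equation of \<open>z\<close> has coefficients in \<open>k\<close> and splits into
  linear factors, so \<open>z\<close> is close to one of its roots.\<close>

lemma residue_exists:
  fixes z :: "'a::alg_closed_field puiseux"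
  assumes "absv z \<le> 1"
  obtains l where "absv (z - emb (fps_const l)) < 1"
proof -
  obtain p where p: "lead_coeff p = 1" "ev p z = 0"
    using assms by (auto simp: absv_le_1_iff integral_ring_def)
  define p0 where "p0 = map_poly (\<lambda>c. fps_nth c 0) p"
  have cp0: "coeff p0 i = fps_nth (coeff p i) 0" for i by (simp add: p0_def coeff_map_poly)
  have "p0 \<noteq> 0" using cp0[of "degree p"] p(1) by auto
  then obtain A where A: "p0 = smult (lead_coeff p0) (\<Prod>x\<in>#A. [:-x, 1:])"
    using alg_closed_imp_factorization[of p0] by blast
  have "degree p0 = degree p"
  proof (rule antisym)
    show "degree p0 \<le> degree p" by (rule degree_le) (simp add: cp0 coeff_eq_0)
    show "degree p \<le> degree p0" using p(1) by (intro le_degree) (simp add: cp0)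
  qed
  then have "lead_coeff p0 = 1" using p(1) by (simp add: cp0)
  then have A: "p0 = (\<Prod>x\<in>#A. [:-x, 1:])" using A by simp
  have const_sum: "fps_const (\<Sum>x\<in>B. h x) = (\<Sum>x\<in>B. fps_const (h x))" for h :: "nat \<Rightarrow> 'a" and B
    by (induction B rule: infinite_finite_induct) (simp_all flip: fps_const_add)
  have lift_mult: "map_poly fps_const (f * g) = map_poly fps_const f * map_poly fps_const g"
    for f g :: "'a poly"
    by (intro poly_eqI)
      (simp add: coeff_map_poly coeff_mult const_sum fps_const_mult[symmetric] del: fps_const_mult)
  have lift: "ev (map_poly fps_const (\<Prod>x\<in>#A. [:-x, 1:])) z = (\<Prod>x\<in>#A. z - emb (fps_const x))"
  proof (induction A)
    case (add x A)
    have "map_poly fps_const [:-x, 1:] = [:- fps_const x, 1:]"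
      by (simp add: map_poly_pCons)
    then have "map_poly fps_const (\<Prod>x\<in>#add_mset x A. [:-x, 1:]) =
        [:- fps_const x, 1:] * map_poly fps_const (\<Prod>x\<in>#A. [:-x, 1:])"
      by (simp only: image_mset_add_mset prod_mset.add_mset lift_mult)
    moreover have "emb (fps_const (- x)) = - emb (fps_const x)"
      by (simp only: fps_const_neg[symmetric] emb_simps)
    ultimately show ?case using add by (simp add: left_diff_distrib)
  qed (simp add: map_poly_1 flip: one_pCons)
  have "absv (ev (p - map_poly fps_const p0) z) < 1"
    unfolding ev_altdef
  proof (rule absv_sum_less)
    fix i
    have "fps_nth (coeff (p - map_poly fps_const p0) i) 0 = 0" by (simp add: coeff_map_poly cp0)
    then have "absv (emb (coeff (p - map_poly fps_const p0) i)) \<le> exp (-1)"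
      by (rule absv_emb_nonunit)
    also have "exp (-1) < (1::real)" by simp
    finally have "absv (emb (coeff (p - map_poly fps_const p0) i)) < 1" .
    moreover have "absv z ^ i \<le> 1" using assms by (simp add: power_le_one)
    then have "absv (emb (coeff (p - map_poly fps_const p0) i)) * absv z ^ i \<le>
        absv (emb (coeff (p - map_poly fps_const p0) i)) * 1" by (intro mult_left_mono) auto
    ultimately show "absv (emb (coeff (p - map_poly fps_const p0) i) * z ^ i) < 1" by simp
  qed simp
  then have "absv (ev (map_poly fps_const p0) z) < 1" using p(2) by simp
  then have "(\<Prod>x\<in>#A. absv (z - emb (fps_const x))) < 1"
    using A lift by (simp add: absv_prod_mset)
  moreover have "(\<Prod>x\<in>#A. absv (z - emb (fps_const x))) \<ge> 1"
    if "\<forall>x\<in>#A. absv (z - emb (fps_const x)) \<ge> 1"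
    using that
  proof (induction A)
    case (add x A)
    then show ?case using mult_mono[of 1 "absv (z - emb (fps_const x))" 1] by simp
  qed simp
  ultimately have "\<not> (\<forall>x\<in>#A. absv (z - emb (fps_const x)) \<ge> 1)" by linarith
  then obtain x where "absv (z - emb (fps_const x)) < 1" by (auto simp: not_le)
  then show ?thesis by (rule that)
qed

section \<open>Minimal polynomials and conjugate points\<close>

definition min_poly_of :: "'a::field fps poly \<Rightarrow> 'a puiseux \<Rightarrow> bool" where
  "min_poly_of W a \<longleftrightarrow> lead_coeff W = 1 \<and> ev W a = 0 \<and>
     (\<forall>r. r \<noteq> 0 \<longrightarrow> degree r < degree W \<longrightarrow> ev r a \<noteq> 0)"

lemma min_poly_dvd:
  assumes "min_poly_of W a" "ev h a = 0" obtains q where "h = W * q"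
proof -
  have "lead_coeff W = 1" using assms(1) by (simp add: min_poly_of_def)
  then obtain q r where qr: "h = W * q + r" "r = 0 \<or> degree r < degree W"
    by (rule monic_division)
  then have "ev r a = 0" using assms by (simp add: min_poly_of_def)
  then show ?thesis using qr assms(1) that[of q] by (auto simp: min_poly_of_def)
qed

lemma conjugate_zero:
  assumes "min_poly_of W a" "ev W b = 0" "ev h a = 0" shows "ev h b = 0"
  using min_poly_dvd[OF assms(1,3)] assms(2) by (metis ev_simps(4) mult_zero_left)

text \<open>The constant term of an algebraic equation of least degree inverts its root up to a power of
  \<open>X\<close>.\<close>

lemma inverse_in_field:
  assumes "ev g a \<noteq> 0"
  obtains r n where "ev g a * ev r a = unif ^ n"
proof -
  let ?z = "ev g a"
  obtain p where p: "p \<noteq> 0" "ev p ?z = 0" "\<And>q. q \<noteq> 0 \<Longrightarrow> ev q ?z = 0 \<Longrightarrow> degree p \<le> degree q"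
    using primitive_annihilator by blast
  obtain c q where q: "p = pCons c q" by (rule pCons_cases)
  have c: "c \<noteq> 0"
  proof
    assume "c = 0"
    then have "q \<noteq> 0" "ev q ?z = 0" "degree p = Suc (degree q)" using p q assms by auto
    then show False using p(3) by fastforce
  qed
  obtain u where u: "c = fps_X ^ subdegree c * u" "fps_nth u 0 \<noteq> 0"
    using c by (rule fps_unit_decompose)
  have "emb c = - (?z * ev q ?z)" using p(2) q by (simp add: eq_neg_iff_add_eq_0)
  moreover have "emb c = unif ^ subdegree c * emb u" by (subst u(1)) (simp add: unif_def)
  ultimately have h: "- (?z * ev q ?z) = unif ^ subdegree c * emb u" by simp
  have "?z * ev (smult (- inverse u) (pcompose q g)) a = - (?z * ev q ?z) * emb (inverse u)"
    by (simp only: ev_simps emb_simps ev_pcompose) simp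
  also have "\<dots> = unif ^ subdegree c * (emb u * emb (inverse u))"
    unfolding h by (simp only: mult.assoc)
  also have "emb u * emb (inverse u) = 1"
    using fps_unit_inverse[OF u(2)] by (simp flip: emb_simps)
  finally have "?z * ev (smult (- inverse u) (pcompose q g)) a = unif ^ subdegree c"
    by (simp only: mult_1_right)
  then show ?thesis by (rule that)
qed

lemma conjugate_nonzero:
  assumes "min_poly_of W a" "ev W b = 0" "ev h a \<noteq> 0" shows "ev h b \<noteq> 0"
proof -
  obtain r n where "ev h a * ev r a = unif ^ n" using inverse_in_field[OF assms(3)] by blast
  then have "ev (h * r - [:fps_X ^ n:]) a = 0" by (simp add: unif_def)
  from conjugate_zero[OF assms(1,2) this] have "ev h b * ev r b = unif ^ n" by (simp add: unif_def)
  then show ?thesis by (metis mult_zero_left power_not_zero unif_nonzero)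
qed

text \<open>Clearing denominators turns an integral equation of \<open>g(a) / h(a)\<close> into a polynomial that
  vanishes at \<open>a\<close>, hence at the conjugate \<open>b\<close>.\<close>

lemma conjugate_integral_quotient:
  assumes W: "min_poly_of W a" "ev W b = 0" and h: "ev h a \<noteq> 0"
    and int: "ev g a / ev h a \<in> integral_ring"
  shows "ev g b / ev h b \<in> integral_ring"
proof -
  obtain p where p: "lead_coeff p = 1" "ev p (ev g a / ev h a) = 0"
    using int by (auto simp: integral_ring_def)
  define n where "n = degree p"
  define Q where "Q = (\<Sum>i\<le>n. smult (coeff p i) (g ^ i * h ^ (n - i)))"
  have Q: "ev Q c = ev h c ^ n * ev p (ev g c / ev h c)" if "ev h c \<noteq> 0" for c
  proof -
    have t: "ev h c ^ n * (emb (coeff p i) * (ev g c / ev h c) ^ i) =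
       emb (coeff p i) * (ev g c ^ i * ev h c ^ (n - i))" if "i \<le> n" for i
    proof -
      have "ev h c ^ n = ev h c ^ (n - i) * ev h c ^ i" using that by (simp flip: power_add)
      then show ?thesis using \<open>ev h c \<noteq> 0\<close> by (simp add: power_divide field_simps)
    qed
    then show ?thesis
      unfolding ev_altdef[of p] Q_def ev_sum n_def[symmetric] sum_distrib_left
      by (intro sum.cong refl) (unfold ev_simps, rule t[symmetric], simp)
  qed
  have hb: "ev h b \<noteq> 0" using conjugate_nonzero[OF W h] .
  have "ev Q b = 0" using Q[OF h] p(2) by (intro conjugate_zero[OF W]) simp
  then have "ev p (ev g b / ev h b) = 0" using Q[OF hb] hb by simp
  then show ?thesis using p(1) by (auto simp: integral_ring_def)
qed

text \<open>The slope of \<open>g(a)\<close> is expressed by the integrality of quotients of polynomials in \<open>a\<close>, which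
  conjugation preserves.\<close>

theorem conjugate_absv:
  assumes W: "min_poly_of W a" "ev W b = 0"
  shows "absv (ev g b) = absv (ev g a)"
proof (cases "ev g a = 0")
  case True
  then show ?thesis using conjugate_zero[OF W] by simp
next
  case False
  then obtain m n where s: "slope (ev g a) m n" by (rule slope_exists)
  have a: "a \<in> integral_ring" using W by (auto simp: min_poly_of_def integral_ring_def)
  have "absv (ev g a) \<le> 1" using integral_ev[OF a] by (simp add: absv_le_1_iff)
  then have m: "m \<ge> 0" using s by (simp add: absv_slope[OF s] slope_def zero_le_divide_iff)
  let ?t = "[:fps_X ^ nat m:] :: 'a fps poly"
  have t: "ev ?t c = unif powi m" for c using m by (simp add: unif_def power_int_def)
  have u: "integral_unit (ev (g ^ n) a / ev ?t a)" using s unfolding slope_def t by simp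
  have "ev (g ^ n) b / ev ?t b \<in> integral_ring"
    using u by (intro conjugate_integral_quotient[OF W]) (auto simp: integral_unit_def)
  moreover have "ev ?t b / ev (g ^ n) b \<in> integral_ring"
    using u False by (intro conjugate_integral_quotient[OF W]) (auto simp: integral_unit_def field_simps)
  moreover have "ev g b \<noteq> 0" using conjugate_nonzero[OF W False] .
  ultimately have "slope (ev g b) m n"
    using s unfolding slope_def integral_unit_def t by (simp add: field_simps)
  then show ?thesis using absv_slope s by metis
qed

section \<open>Gauss norms\<close>

definition gauss_norm :: "real \<Rightarrow> 'a::field puiseux poly \<Rightarrow> real" where
  "gauss_norm \<rho> f = Max ((\<lambda>i. absv (coeff f i) * \<rho> ^ i) ` {..degree f})"

text \<open>The number of zeros of \<open>f\<close> on the disc of radius \<open>\<rho>\<close> about the origin, counted with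
  multiplicity and read off from the Newton polygon.\<close>

definition gauss_index :: "real \<Rightarrow> 'a::field puiseux poly \<Rightarrow> nat" where
  "gauss_index \<rho> f = Max {i. i \<le> degree f \<and> absv (coeff f i) * \<rho> ^ i = gauss_norm \<rho> f}"

lemma gauss_norm_attained:
  obtains i where "i \<le> degree f" "absv (coeff f i) * \<rho> ^ i = gauss_norm \<rho> f"
proof -
  have "gauss_norm \<rho> f \<in> (\<lambda>i. absv (coeff f i) * \<rho> ^ i) ` {..degree f}"
    unfolding gauss_norm_def by (rule Max_in) auto
  then obtain i where "i \<le> degree f" "gauss_norm \<rho> f = absv (coeff f i) * \<rho> ^ i" by auto
  then show ?thesis by (intro that[of i]) auto
qed

lemma gauss_norm_le: "(\<And>i. absv (coeff f i) * \<rho> ^ i \<le> B) \<Longrightarrow> gauss_norm \<rho> f \<le> B"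
  by (metis gauss_norm_attained)

lemma gauss_norm_less: "(\<And>i. absv (coeff f i) * \<rho> ^ i < B) \<Longrightarrow> gauss_norm \<rho> f < B"
  by (metis gauss_norm_attained)

lemma gauss_norm_0 [simp]: "gauss_norm \<rho> 0 = 0"
  by (simp add: gauss_norm_def)

context
  fixes \<rho> :: real assumes \<rho>: "\<rho> > 0"
begin

lemma gauss_norm_nonneg: "gauss_norm \<rho> f \<ge> 0"
  using gauss_norm_attained[of f \<rho>] \<rho> by (metis absv_nonneg mult_nonneg_nonneg zero_le_power less_imp_le)

lemma gauss_norm_ge: "absv (coeff f i) * \<rho> ^ i \<le> gauss_norm \<rho> f"
proof (cases "i \<le> degree f")
  case True
  then show ?thesis unfolding gauss_norm_def by (intro Max_ge) auto
next
  case False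
  then show ?thesis using gauss_norm_nonneg[of f] by (simp add: coeff_eq_0)
qed

lemma gauss_norm_pos: "f \<noteq> 0 \<Longrightarrow> gauss_norm \<rho> f > 0"
  using gauss_norm_ge[of f "degree f"] \<rho> absv_pos[of "lead_coeff f"]
  by (metis leading_coeff_0_iff less_le_trans mult_pos_pos zero_less_power)

lemma gauss_index:
  shows "absv (coeff f (gauss_index \<rho> f)) * \<rho> ^ gauss_index \<rho> f = gauss_norm \<rho> f"
    and "f \<noteq> 0 \<Longrightarrow> i > gauss_index \<rho> f \<Longrightarrow> absv (coeff f i) * \<rho> ^ i < gauss_norm \<rho> f"
proof -
  let ?S = "{i. i \<le> degree f \<and> absv (coeff f i) * \<rho> ^ i = gauss_norm \<rho> f}"
  have fin: "finite ?S" by simp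
  have ne: "?S \<noteq> {}" using gauss_norm_attained[of f \<rho>] by blast
  have "gauss_index \<rho> f \<in> ?S" unfolding gauss_index_def by (rule Max_in[OF fin ne])
  then show "absv (coeff f (gauss_index \<rho> f)) * \<rho> ^ gauss_index \<rho> f = gauss_norm \<rho> f" by simp
  assume f: "f \<noteq> 0" and i: "i > gauss_index \<rho> f"
  show "absv (coeff f i) * \<rho> ^ i < gauss_norm \<rho> f"
  proof (cases "i \<le> degree f")
    case True
    have "i \<notin> ?S"
    proof
      assume "i \<in> ?S"
      then have "i \<le> gauss_index \<rho> f" unfolding gauss_index_def by (rule Max_ge[OF fin])
      then show False using i by simp
    qed
    then show ?thesis using True gauss_norm_ge[of f i] by auto
  next
    case False
    then show ?thesis using gauss_norm_pos[OF f] by (simp add: coeff_eq_0)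
  qed
qed

lemma gauss_index_eqI:
  assumes "f \<noteq> 0" "absv (coeff f i) * \<rho> ^ i = gauss_norm \<rho> f"
    "\<And>j. j > i \<Longrightarrow> absv (coeff f j) * \<rho> ^ j < gauss_norm \<rho> f"
  shows "gauss_index \<rho> f = i"
  using gauss_index[of f] assms by (metis linorder_neqE_nat less_irrefl)

lemma gauss_norm_add: "gauss_norm \<rho> (f + g) \<le> max (gauss_norm \<rho> f) (gauss_norm \<rho> g)"
proof (rule gauss_norm_le)
  fix i
  have "absv (coeff (f + g) i) * \<rho> ^ i \<le> max (absv (coeff f i)) (absv (coeff g i)) * \<rho> ^ i"
    using \<rho> absv_add by (intro mult_right_mono) auto
  also have "\<dots> \<le> max (gauss_norm \<rho> f) (gauss_norm \<rho> g)"
    using gauss_norm_ge[of f i] gauss_norm_ge[of g i] by (auto simp: max_def)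
  finally show "absv (coeff (f + g) i) * \<rho> ^ i \<le> max (gauss_norm \<rho> f) (gauss_norm \<rho> g)" .
qed

lemma gauss_norm_uminus: "gauss_norm \<rho> (- f) = gauss_norm \<rho> f"
  and gauss_index_uminus: "gauss_index \<rho> (- f) = gauss_index \<rho> f"
  by (simp_all add: gauss_norm_def gauss_index_def)

lemma gauss_norm_diff: "gauss_norm \<rho> (f - g) \<le> max (gauss_norm \<rho> f) (gauss_norm \<rho> g)"
  using gauss_norm_add[of f "- g"] by (simp add: gauss_norm_uminus)

text \<open>The product of the last dominant terms of \<open>f\<close> and \<open>g\<close> dominates strictly the other terms of
  the same degree in \<open>f g\<close>.\<close>

lemma gauss_mult:
  assumes "f \<noteq> 0" "g \<noteq> 0"
  shows "gauss_norm \<rho> (f * g) = gauss_norm \<rho> f * gauss_norm \<rho> g"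
    and "gauss_index \<rho> (f * g) = gauss_index \<rho> f + gauss_index \<rho> g"
proof -
  let ?I = "gauss_index \<rho> f" and ?J = "gauss_index \<rho> g"
  let ?F = "gauss_norm \<rho> f" and ?G = "gauss_norm \<rho> g"
  have pos: "?F > 0" "?G > 0" using assms gauss_norm_pos by auto
  have term_eq: "absv (coeff f i * coeff g (n - i)) * \<rho> ^ n =
      (absv (coeff f i) * \<rho> ^ i) * (absv (coeff g (n - i)) * \<rho> ^ (n - i))" if "i \<le> n" for i n
    using that by (simp add: algebra_simps flip: power_add)
  have le: "absv (coeff f i * coeff g (n - i)) * \<rho> ^ n \<le> ?F * ?G" if "i \<le> n" for i n
    unfolding term_eq[OF that]
    using gauss_norm_ge pos \<rho> by (intro mult_mono) auto
  have less: "absv (coeff f i * coeff g (n - i)) * \<rho> ^ n < ?F * ?G"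
    if "i \<le> n" "i > ?I \<or> n - i > ?J" for i n
  proof (cases "i > ?I")
    case True
    have "(absv (coeff f i) * \<rho> ^ i) * (absv (coeff g (n - i)) * \<rho> ^ (n - i))
        \<le> (absv (coeff f i) * \<rho> ^ i) * ?G"
      using gauss_norm_ge \<rho> by (intro mult_left_mono) auto
    also have "\<dots> < ?F * ?G"
      using gauss_index(2)[OF assms(1) True] pos by (intro mult_strict_right_mono) auto
    finally show ?thesis unfolding term_eq[OF that(1)] .
  next
    case False
    then have "n - i > ?J" using that by blast
    have "(absv (coeff f i) * \<rho> ^ i) * (absv (coeff g (n - i)) * \<rho> ^ (n - i))
        \<le> ?F * (absv (coeff g (n - i)) * \<rho> ^ (n - i))"
      using gauss_norm_ge \<rho> by (intro mult_right_mono) auto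
    also have "\<dots> < ?F * ?G"
      using gauss_index(2)[OF assms(2) \<open>n - i > ?J\<close>] pos by (intro mult_strict_left_mono) auto
    finally show ?thesis unfolding term_eq[OF that(1)] .
  qed
  have rp: "\<rho> ^ n > 0" for n using \<rho> by simp
  have coeff_le: "absv (coeff (f * g) n) * \<rho> ^ n \<le> ?F * ?G" for n
  proof -
    have "absv (coeff (f * g) n) \<le> ?F * ?G / \<rho> ^ n"
      unfolding coeff_mult using le rp[of n] pos by (intro absv_sum_le) (auto simp: field_simps)
    then show ?thesis using rp[of n] by (simp add: field_simps)
  qed
  have coeff_less: "absv (coeff (f * g) n) * \<rho> ^ n < ?F * ?G" if "n > ?I + ?J" for n
  proof -
    have "i > ?I \<or> n - i > ?J" for i using that by linarith
    then have "absv (coeff (f * g) n) < ?F * ?G / \<rho> ^ n"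
      unfolding coeff_mult using less rp[of n] pos by (intro absv_sum_less) (auto simp: field_simps)
    then show ?thesis using rp[of n] by (simp add: field_simps)
  qed
  let ?n = "?I + ?J"
  have "absv (\<Sum>i\<in>{..?n} - {?I}. coeff f i * coeff g (?n - i)) < ?F * ?G / \<rho> ^ ?n"
  proof (rule absv_sum_less)
    fix i assume i: "i \<in> {..?n} - {?I}"
    then have "i > ?I \<or> ?n - i > ?J" by auto
    then show "absv (coeff f i * coeff g (?n - i)) < ?F * ?G / \<rho> ^ ?n"
      using less[of i ?n] i rp[of ?n] by (simp add: field_simps)
  qed (use pos rp in auto)
  moreover have top: "absv (coeff f ?I * coeff g ?J) = ?F * ?G / \<rho> ^ ?n"
  proof -
    have "absv (coeff f ?I * coeff g ?J) * \<rho> ^ ?n = ?F * ?G"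
      using term_eq[of ?I ?n] gauss_index(1)[of f] gauss_index(1)[of g] by simp
    then show ?thesis using \<rho> by (simp add: eq_divide_eq)
  qed
  moreover have "coeff (f * g) ?n =
      (\<Sum>i\<in>{..?n} - {?I}. coeff f i * coeff g (?n - i)) + coeff f ?I * coeff g ?J"
    unfolding coeff_mult by (subst sum.remove[of _ ?I]) (auto simp: add.commute)
  ultimately have "absv (coeff (f * g) ?n) = ?F * ?G / \<rho> ^ ?n"
    using absv_add_eq[of "\<Sum>i\<in>{..?n} - {?I}. coeff f i * coeff g (?n - i)" "coeff f ?I * coeff g ?J"]
    by simp
  then have eq: "absv (coeff (f * g) ?n) * \<rho> ^ ?n = ?F * ?G" using \<rho> by simp
  show norm: "gauss_norm \<rho> (f * g) = ?F * ?G"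
    using gauss_norm_le[of "f * g" \<rho>, OF coeff_le] gauss_norm_ge[of "f * g" ?n] eq by simp
  show "gauss_index \<rho> (f * g) = ?I + ?J"
    using assms eq coeff_less norm by (intro gauss_index_eqI) auto
qed

lemma gauss_norm_mult: "gauss_norm \<rho> (f * g) = gauss_norm \<rho> f * gauss_norm \<rho> g"
  using gauss_mult(1)[of f g] by (cases "f = 0 \<or> g = 0") auto

lemma gauss_linear:
  shows "gauss_norm \<rho> [:c, 1:] = max (absv c) \<rho>"
    and "gauss_index \<rho> [:c, 1:] = (if absv c \<le> \<rho> then 1 else 0)"
proof -
  have "{..Suc 0} = {0, Suc 0}" by auto
  then show n: "gauss_norm \<rho> [:c, 1:] = max (absv c) \<rho>" by (simp add: gauss_norm_def)
  show "gauss_index \<rho> [:c, 1:] = (if absv c \<le> \<rho> then 1 else 0)"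
    using \<rho> by (intro gauss_index_eqI)
      (auto simp: n coeff_pCons max_def split: nat.splits)
qed

lemma gauss_const:
  shows "gauss_norm \<rho> [:c:] = absv c" and "c \<noteq> 0 \<Longrightarrow> gauss_index \<rho> [:c:] = 0"
proof -
  show n: "gauss_norm \<rho> [:c:] = absv c" by (simp add: gauss_norm_def)
  show "c \<noteq> 0 \<Longrightarrow> gauss_index \<rho> [:c:] = 0"
    by (intro gauss_index_eqI) (auto simp: n coeff_pCons absv_pos split: nat.splits)
qed

text \<open>Each coefficient of \<open>g\<close> differs from that of \<open>f\<close> by less than the dominant term.\<close>

lemma gauss_dominated:
  assumes "gauss_norm \<rho> (f - g) < gauss_norm \<rho> f"
  shows "gauss_norm \<rho> g = gauss_norm \<rho> f" "gauss_index \<rho> g = gauss_index \<rho> f" "g \<noteq> 0"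
proof -
  let ?I = "gauss_index \<rho> f"
  have "f \<noteq> 0"
  proof
    assume "f = 0"
    then show False using assms gauss_norm_nonneg[of "f - g"] by simp
  qed
  have d: "absv (coeff f i - coeff g i) * \<rho> ^ i < gauss_norm \<rho> f" for i
    using gauss_norm_ge[of "f - g" i] assms by simp
  have rp: "\<rho> ^ n > 0" for n using \<rho> by simp
  show n: "gauss_norm \<rho> g = gauss_norm \<rho> f"
  proof (rule antisym)
    show "gauss_norm \<rho> g \<le> gauss_norm \<rho> f" using gauss_norm_diff[of f "f - g"] assms by simp
    show "gauss_norm \<rho> f \<le> gauss_norm \<rho> g" using gauss_norm_add[of "f - g" g] assms by simp
  qed
  then show g: "g \<noteq> 0" using gauss_norm_pos[OF \<open>f \<noteq> 0\<close>] by auto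
  show "gauss_index \<rho> g = ?I"
  proof (rule gauss_index_eqI[OF g])
    have "absv (coeff g ?I - coeff f ?I) < absv (coeff f ?I)"
      using d[of ?I] rp[of ?I] gauss_index(1)[of f] absv_minus_commute mult_less_cancel_right_pos
      by metis
    then have "absv (coeff g ?I) = absv (coeff f ?I)"
      using absv_add_eq[of "coeff g ?I - coeff f ?I" "coeff f ?I"] by simp
    then show "absv (coeff g ?I) * \<rho> ^ ?I = gauss_norm \<rho> g" using gauss_index(1)[of f] n by simp
  next
    fix j assume "j > ?I"
    then have "absv (coeff f j) * \<rho> ^ j < gauss_norm \<rho> f" by (rule gauss_index(2)[OF \<open>f \<noteq> 0\<close>])
    moreover have "absv (coeff g j) \<le> max (absv (coeff f j)) (absv (coeff f j - coeff g j))"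
      using absv_diff[of "coeff f j" "coeff f j - coeff g j"] by simp
    then have "absv (coeff g j) * \<rho> ^ j
        \<le> max (absv (coeff f j)) (absv (coeff f j - coeff g j)) * \<rho> ^ j"
      using rp[of j] by (intro mult_right_mono) auto
    ultimately show "absv (coeff g j) * \<rho> ^ j < gauss_norm \<rho> g"
      using d[of j] n by (auto simp: max_def split: if_splits)
  qed
qed

end

lemma gauss_norm_mono_radius:
  assumes "0 < r" "r \<le> s" shows "gauss_norm r f \<le> gauss_norm s f"
proof (rule gauss_norm_le)
  fix i
  have "absv (coeff f i) * r ^ i \<le> absv (coeff f i) * s ^ i"
    using assms by (intro mult_left_mono power_mono) auto
  also have "\<dots> \<le> gauss_norm s f" using assms by (intro gauss_norm_ge) auto
  finally show "absv (coeff f i) * r ^ i \<le> gauss_norm s f" .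
qed

lemma gauss_cong:
  assumes "degree f = degree g" "\<And>i. absv (coeff f i) = absv (coeff g i)"
  shows "gauss_norm \<rho> f = gauss_norm \<rho> g" "gauss_index \<rho> f = gauss_index \<rho> g"
  using assms by (simp_all add: gauss_norm_def gauss_index_def)

section \<open>Norms of discs\<close>

definition taylor :: "'a::field puiseux \<Rightarrow> 'a fps poly \<Rightarrow> 'a puiseux poly" where
  "taylor a g = pcompose (emb_poly g) [:a, 1:]"

lemma taylor_simps [simp]:
  "taylor a 0 = 0" "taylor a 1 = 1" "taylor a (f + g) = taylor a f + taylor a g"
  "taylor a (f - g) = taylor a f - taylor a g" "taylor a (- f) = - taylor a f"
  "taylor a (f * g) = taylor a f * taylor a g" "taylor a [:c:] = [:emb c:]"
  by (simp_all add: taylor_def pcompose_add pcompose_diff pcompose_uminus pcompose_mult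
      pcompose_const pcompose_1)

lemma taylor_power [simp]: "taylor a (f ^ n) = taylor a f ^ n"
  by (induction n) auto

lemma degree_taylor [simp]: "degree (taylor a g) = degree g"
  by (simp add: taylor_def degree_pcompose)

lemma taylor_eq_0_iff [simp]: "taylor a g = 0 \<longleftrightarrow> g = 0"
  by (simp add: taylor_def pcompose_eq_0_iff)

text \<open>The Taylor coefficients at \<open>a\<close> are the values at \<open>a\<close> of fixed polynomials, the Hasse
  derivatives.\<close>

lemma coeff_taylor_ev: "\<exists>D. \<forall>a. coeff (taylor a g) l = ev D a"
proof (induction g arbitrary: l)
  case 0
  show ?case by (auto intro!: exI[of _ 0])
next
  case (pCons c g)
  have t: "taylor a (pCons c g) = [:emb c:] + [:a, 1:] * taylor a g" for a
    by (simp add: taylor_def pcompose_pCons)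
  show ?case
  proof (cases l)
    case 0
    obtain D where "\<forall>a. coeff (taylor a g) 0 = ev D a" using pCons.IH by blast
    then show ?thesis by (intro exI[of _ "pCons c D"]) (simp add: t 0)
  next
    case (Suc n)
    obtain D D' where "\<forall>a. coeff (taylor a g) l = ev D a" "\<forall>a. coeff (taylor a g) n = ev D' a"
      using pCons.IH by metis
    then show ?thesis by (intro exI[of _ "pCons 0 D + D'"]) (simp add: t Suc)
  qed
qed

lemma coeff_taylor_0: "coeff (taylor a g) 0 = ev g a"
proof -
  have "coeff (taylor a g) 0 = poly (taylor a g) 0" by (simp add: poly_0_coeff_0)
  then show ?thesis by (simp add: taylor_def poly_pcompose ev_def)
qed

text \<open>The supremum of \<open>|g|\<close> on the disc of centre \<open>a\<close> and radius \<open>\<rho>\<close>, and the number of zeros of \<open>g\<close>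
  on it.\<close>

definition disc_norm :: "'a::field puiseux \<Rightarrow> real \<Rightarrow> 'a fps poly \<Rightarrow> real" where
  "disc_norm a \<rho> g = gauss_norm \<rho> (taylor a g)"

definition disc_zeros :: "'a::field puiseux \<Rightarrow> real \<Rightarrow> 'a fps poly \<Rightarrow> nat" where
  "disc_zeros a \<rho> g = gauss_index \<rho> (taylor a g)"

lemma disc_conjugate:
  assumes "min_poly_of W a" "ev W b = 0"
  shows "disc_norm b \<rho> g = disc_norm a \<rho> g" "disc_zeros b \<rho> g = disc_zeros a \<rho> g"
proof -
  have "absv (coeff (taylor b g) i) = absv (coeff (taylor a g) i)" for i
    using coeff_taylor_ev[of g i] conjugate_absv[OF assms] by metis
  then show "disc_norm b \<rho> g = disc_norm a \<rho> g" "disc_zeros b \<rho> g = disc_zeros a \<rho> g"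
    unfolding disc_norm_def disc_zeros_def by (auto intro: gauss_cong)
qed

definition roots :: "'a::field fps poly \<Rightarrow> 'a puiseux multiset" where
  "roots g = proots (emb_poly g)"

lemma emb_poly_roots:
  assumes "g \<noteq> 0"
  shows "emb_poly g = smult (emb (lead_coeff g)) (\<Prod>x\<in>#roots g. [:-x, 1:])"
proof -
  obtain A where A: "emb_poly g = smult (lead_coeff (emb_poly g)) (\<Prod>x\<in>#A. [:-x, 1:])"
    using alg_closed_imp_factorization[of "emb_poly g"] assms by auto
  have "lead_coeff (emb_poly g) \<noteq> 0" using assms by simp
  then have "proots (emb_poly g) = proots (\<Prod>x\<in>#A. [:-x, 1:])"
    by (subst A) (rule proots_smult)
  also have "\<dots> = A"
  proof (induction A)
    case (add x A)
    have "(\<Prod>x\<in>#A. [:-x, 1:]) \<noteq> 0" by (auto simp: prod_mset_zero_iff)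
    then show ?case using add
      by (simp only: image_mset_add_mset prod_mset.add_mset)
         (subst proots_mult, auto)
  qed simp
  finally show ?thesis using A by (simp add: roots_def)
qed

lemma in_roots_iff: "g \<noteq> 0 \<Longrightarrow> x \<in># roots g \<longleftrightarrow> ev g x = 0"
  by (simp add: roots_def ev_def)

lemma size_roots: "g \<noteq> 0 \<Longrightarrow> size (roots g) = degree g"
proof -
  assume "g \<noteq> 0"
  have "degree (\<Prod>x\<in>#A. [:-x, 1:]) = size A" for A :: "'a puiseux multiset"
  proof (induction A)
    case (add x A)
    have "(\<Prod>x\<in>#A. [:-x, 1:]) \<noteq> 0" by (auto simp: prod_mset_zero_iff)
    then have "degree ([:-x, 1:] * (\<Prod>x\<in>#A. [:-x, 1:])) = 1 + size A"
      using add by (subst degree_mult_eq) auto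
    then show ?case by simp
  qed simp
  then have "degree (emb_poly g) = size (roots g)"
    using emb_poly_roots[OF \<open>g \<noteq> 0\<close>] \<open>g \<noteq> 0\<close> by (metis degree_smult_eq emb_eq_0_iff leading_coeff_0_iff)
  then show ?thesis by simp
qed

lemma ev_roots: "g \<noteq> 0 \<Longrightarrow> ev g a = emb (lead_coeff g) * (\<Prod>x\<in>#roots g. a - x)"
proof -
  have "poly (\<Prod>x\<in>#A. [:-x, 1:]) a = (\<Prod>x\<in>#A. a - x)" for A :: "'a puiseux multiset"
    by (induction A) (auto simp del: mult_pCons_left)
  then show "g \<noteq> 0 \<Longrightarrow> ev g a = emb (lead_coeff g) * (\<Prod>x\<in>#roots g. a - x)"
    by (simp add: ev_def emb_poly_roots)
qed

lemma taylor_roots: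
  assumes "g \<noteq> 0"
  shows "taylor a g = [:emb (lead_coeff g):] * (\<Prod>x\<in>#roots g. [:a - x, 1:])"
proof -
  have "pcompose (\<Prod>x\<in>#A. [:-x, 1:]) [:a, 1:] = (\<Prod>x\<in>#A. [:a - x, 1:])" for A :: "'a puiseux multiset"
    by (induction A) (auto simp: pcompose_mult pcompose_pCons pcompose_1 simp del: mult_pCons_left)
  then show ?thesis
    unfolding taylor_def by (subst emb_poly_roots[OF assms]) (simp add: pcompose_smult)
qed

lemma size_filter_sum: "size {#x \<in># A. P x#} = (\<Sum>x\<in>#A. if P x then 1 else 0)"
  by (induction A) auto

context
  fixes \<rho> :: real assumes \<rho>: "\<rho> > 0"
begin

lemma disc_roots:
  assumes "g \<noteq> 0"
  shows "disc_norm a \<rho> g = absv (emb (lead_coeff g)) * (\<Prod>x\<in>#roots g. max (absv (a - x)) \<rho>)"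
    and "disc_zeros a \<rho> g = size {#x \<in># roots g. absv (a - x) \<le> \<rho>#}"
proof -
  let ?P = "\<lambda>A. \<Prod>x\<in>#A. [:a - x, 1:]"
  have nz: "?P A \<noteq> 0" for A by (auto simp: prod_mset_zero_iff)
  have "gauss_norm \<rho> (?P A) = (\<Prod>x\<in>#A. max (absv (a - x)) \<rho>) \<and>
    gauss_index \<rho> (?P A) = size {#x \<in># A. absv (a - x) \<le> \<rho>#}" for A
  proof (induction A)
    case empty
    show ?case using gauss_const[OF \<rho>, of 1] by (simp flip: one_pCons)
  next
    case (add x A)
    have "?P (add_mset x A) = [:a - x, 1:] * ?P A" by (simp del: mult_pCons_left)
    then show ?case
      using add gauss_mult[OF \<rho> _ nz, of "[:a - x, 1:]" A] gauss_linear[OF \<rho>, of "a - x"]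
      by auto
  qed
  moreover have "[:emb (lead_coeff g):] \<noteq> 0" using assms by simp
  ultimately show "disc_norm a \<rho> g = absv (emb (lead_coeff g)) * (\<Prod>x\<in>#roots g. max (absv (a - x)) \<rho>)"
    and "disc_zeros a \<rho> g = size {#x \<in># roots g. absv (a - x) \<le> \<rho>#}"
    using gauss_mult[OF \<rho> _ nz, of "[:emb (lead_coeff g):]" "roots g"] assms
      gauss_const[OF \<rho>, of "emb (lead_coeff g)"]
    unfolding disc_norm_def disc_zeros_def taylor_roots[OF assms] by auto
qed

text \<open>Count the pairs of a root \<open>x\<close> of \<open>W\<close> and a root \<open>z\<close> of \<open>r\<close> at distance at most \<open>\<rho>\<close>. Each \<open>x\<close>
  has as many partners as its conjugate \<open>a\<close>. Each \<open>z\<close> with a partner \<open>x\<close> has the same partners as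
  \<open>x\<close>, again as many as \<open>a\<close> has among the roots of \<open>W\<close>.\<close>

lemma disc_zeros_less:
  assumes W: "min_poly_of W a" and r: "r \<noteq> 0" "degree r < degree W"
  shows "disc_zeros a \<rho> r < disc_zeros a \<rho> W"
proof -
  have "lead_coeff W = 1" using W by (simp add: min_poly_of_def)
  then have Wnz: "W \<noteq> 0" by auto
  let ?near = "\<lambda>x z. absv (x - z) \<le> \<rho>"
  let ?n = "disc_zeros a \<rho> W" and ?l = "disc_zeros a \<rho> r"
  have conj: "ev W x = 0" if "x \<in># roots W" for x using that Wnz by (simp add: in_roots_iff)
  have tri: "?near x w \<longleftrightarrow> ?near z w" if "?near x z" for x z w
    using that absv_add[of "x - z" "z - w"] absv_add[of "z - x" "x - w"] absv_minus_commute[of x z]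
    by (auto simp: max_def split: if_splits)
  have le_n: "disc_zeros z \<rho> W \<le> ?n" for z
  proof (cases "\<exists>x\<in>#roots W. ?near z x")
    case True
    then obtain x where x: "x \<in># roots W" "?near z x" by blast
    have "disc_zeros z \<rho> W = disc_zeros x \<rho> W"
      unfolding disc_roots(2)[OF Wnz] using tri[OF x(2)] by simp
    then show ?thesis using disc_conjugate(2)[OF W conj[OF x(1)]] by simp
  next
    case False
    then have "{#x \<in># roots W. ?near z x#} = {#}" by (auto simp: multiset_eq_iff not_in_iff)
    then show ?thesis unfolding disc_roots(2)[OF Wnz] by (simp only: size_empty)
  qed
  have "a \<in># roots W" using W Wnz by (simp add: in_roots_iff min_poly_of_def)
  then have "a \<in># {#x \<in># roots W. ?near a x#}" using \<rho> by simp
  then have "{#x \<in># roots W. ?near a x#} \<noteq> {#}" by (metis empty_iff set_mset_empty)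
  then have "?n > 0" unfolding disc_roots(2)[OF Wnz] by (simp only: nonempty_has_size)
  have "degree W * ?l = (\<Sum>x\<in>#roots W. ?l)" by (simp add: size_roots[OF Wnz])
  also have "\<dots> = (\<Sum>x\<in>#roots W. disc_zeros x \<rho> r)"
    using disc_conjugate(2)[OF W conj] by (intro arg_cong[where f = sum_mset] image_mset_cong) auto
  also have "\<dots> = (\<Sum>x\<in>#roots W. \<Sum>z\<in>#roots r. if ?near x z then 1 else 0)"
    by (simp add: disc_roots(2)[OF r(1)] size_filter_sum)
  also have "\<dots> = (\<Sum>z\<in>#roots r. \<Sum>x\<in>#roots W. if ?near x z then 1 else 0)"
    by (rule sum_mset.swap)
  also have "\<dots> = (\<Sum>z\<in>#roots r. disc_zeros z \<rho> W)"
    by (simp add: disc_roots(2)[OF Wnz] size_filter_sum absv_minus_commute)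
  also have "\<dots> \<le> (\<Sum>z\<in>#roots r. ?n)" by (rule sum_mset_mono) (rule le_n)
  also have "\<dots> = degree r * ?n" by (simp add: size_roots[OF r(1)])
  finally have "degree W * ?l \<le> degree r * ?n" .
  also have "\<dots> < degree W * ?n" using r(2) \<open>?n > 0\<close> by simp
  finally show ?thesis by simp
qed

lemma disc_norm_mult: "disc_norm a \<rho> (f * g) = disc_norm a \<rho> f * disc_norm a \<rho> g"
  by (simp add: disc_norm_def gauss_norm_mult[OF \<rho>])

lemma disc_norm_add: "disc_norm a \<rho> (f + g) \<le> max (disc_norm a \<rho> f) (disc_norm a \<rho> g)"
  by (simp add: disc_norm_def gauss_norm_add[OF \<rho>])

lemma disc_norm_nonneg: "disc_norm a \<rho> g \<ge> 0"
  by (simp add: disc_norm_def gauss_norm_nonneg[OF \<rho>])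

text \<open>\<open>W q + r\<close> cannot be smaller than \<open>r\<close>, because \<open>r\<close> and \<open>W q\<close> have different numbers of zeros on
  the disc, so that their dominant terms sit in different degrees.\<close>

lemma disc_norm_orthogonal:
  assumes W: "min_poly_of W a" and r: "r = 0 \<or> degree r < degree W"
  shows "disc_norm a \<rho> r \<le> disc_norm a \<rho> (W * q + r)"
    and "disc_norm a \<rho> W * disc_norm a \<rho> q \<le> disc_norm a \<rho> (W * q + r)"
proof -
  show 1: "disc_norm a \<rho> r \<le> disc_norm a \<rho> (W * q + r)"
  proof (cases "r = 0")
    case False
    show ?thesis
    proof (rule ccontr)
      assume "\<not> ?thesis"
      then have "gauss_norm \<rho> (taylor a r - taylor a (- (W * q))) < gauss_norm \<rho> (taylor a r)"
        by (simp add: disc_norm_def add.commute)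
      note dom = gauss_dominated(2,3)[OF \<rho> this]
      then have "q \<noteq> 0" "W \<noteq> 0" by auto
      then have "disc_zeros a \<rho> r = disc_zeros a \<rho> W + gauss_index \<rho> (taylor a q)"
        using dom(1) gauss_mult(2)[OF \<rho>, of "taylor a W" "taylor a q"]
        by (simp add: disc_zeros_def gauss_index_uminus[OF \<rho>])
      then show False using disc_zeros_less[OF W False] r False by simp
    qed
  qed (simp add: disc_norm_nonneg disc_norm_def gauss_norm_nonneg[OF \<rho>])
  have "disc_norm a \<rho> (W * q) = gauss_norm \<rho> (taylor a (W * q + r) - taylor a r)"
    by (simp add: disc_norm_def)
  also have "\<dots> \<le> max (disc_norm a \<rho> (W * q + r)) (disc_norm a \<rho> r)"
    unfolding disc_norm_def by (rule gauss_norm_diff[OF \<rho>])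
  finally show "disc_norm a \<rho> W * disc_norm a \<rho> q \<le> disc_norm a \<rho> (W * q + r)"
    using 1 by (simp add: disc_norm_mult)
qed

end

section \<open>Comparing seminorms with disc norms\<close>

text \<open>The multiplicative seminorms \<open>e\<^sup>-\<^sup>\<nu>\<close> of the semivaluations \<open>\<nu>\<close> of \<open>k[[X]][Y]\<close> with values in
  \<open>[0,\<infinity>]\<close> and \<open>\<nu>(X) = 1\<close>.\<close>

definition poly_seminorm :: "('a::field fps poly \<Rightarrow> real) \<Rightarrow> bool" where
  "poly_seminorm M \<longleftrightarrow> (\<forall>p q. M (p * q) = M p * M q) \<and> (\<forall>p q. M (p + q) \<le> max (M p) (M q)) \<and>
     (\<forall>p. 0 \<le> M p) \<and> (\<forall>c. M [:c:] = absv (emb c)) \<and> M [:0, 1:] \<le> 1"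

lemma poly_seminorm_simps:
  assumes "poly_seminorm M"
  shows "M (p * q) = M p * M q" "M (p + q) \<le> max (M p) (M q)" "0 \<le> M p"
    "M [:c:] = absv (emb c)" "M [:0, 1:] \<le> 1" "M (- p) = M p" "M (p - q) \<le> max (M p) (M q)"
    "M (p ^ n) = M p ^ n" "M 0 = 0"
proof -
  show *: "M (p * q) = M p * M q" "M (p + q) \<le> max (M p) (M q)" "0 \<le> M p"
    "M [:c:] = absv (emb c)" "M [:0, 1:] \<le> 1" for p q c
    using assms by (auto simp: poly_seminorm_def)
  show m: "M (- p) = M p" for p
  proof -
    have "- p = [:-1:] * p" by simp
    also have "M \<dots> = M [:-1:] * M p" by (rule *(1))
    finally show ?thesis using *(4)[of "-1"] by simp
  qed
  show "M (p - q) \<le> max (M p) (M q)" using *(2)[of p "- q"] m[of q] by simp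
  show "M (p ^ n) = M p ^ n"
  proof (induction n)
    case 0
    show ?case using *(4)[of 1] by (simp flip: one_pCons)
  qed (simp add: *)
  show "M 0 = 0" using *(4)[of 0] by simp
qed

lemma poly_seminorm_bound:
  assumes M: "poly_seminorm M" and "\<And>i. absv (emb (coeff p i)) \<le> B" and "B \<ge> 0"
  shows "M p \<le> B"
  using assms(2)
proof (induction p)
  case (pCons c p)
  have "absv (emb c) \<le> B" using pCons.prems[of 0] by simp
  moreover have "M p \<le> B"
  proof (rule pCons.IH)
    show "absv (emb (coeff p i)) \<le> B" for i using pCons.prems[of "Suc i"] by simp
  qed
  moreover have "M [:0, 1:] * M p \<le> 1 * M p"
    using poly_seminorm_simps(3,5)[OF M] by (intro mult_right_mono) auto
  moreover have "pCons c p = [:c:] + [:0, 1:] * p" by simp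
  then have "M (pCons c p) \<le> max (M [:c:]) (M ([:0, 1:] * p))"
    using poly_seminorm_simps(2)[OF M] by metis
  ultimately show ?case by (simp add: poly_seminorm_simps(1,4)[OF M] del: mult_pCons_left)
qed (simp add: poly_seminorm_simps(9)[OF M] assms(3))

lemma pcompose_shift_bound:
  assumes "\<And>i. absv (coeff f i) \<le> B" "absv b \<le> 1" "B \<ge> 0"
  shows "absv (coeff (pcompose f [:b, 1:]) i) \<le> B"
  using assms(1)
proof (induction f arbitrary: i)
  case (pCons c f)
  have IH: "absv (coeff (pcompose f [:b, 1:]) i) \<le> B" for i
  proof (rule pCons.IH)
    show "absv (coeff f i) \<le> B" for i using pCons.prems[of "Suc i"] by simp
  qed
  have c: "absv c \<le> B" using pCons.prems[of 0] by simp
  have bB: "absv (b * coeff (pcompose f [:b, 1:]) i) \<le> B" for i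
    using mult_mono[OF assms(2) IH[of i]] assms(3) by simp
  show ?case
  proof (cases i)
    case 0
    have "absv (c + b * coeff (pcompose f [:b, 1:]) 0) \<le> max (absv c) (absv (b * coeff (pcompose f [:b, 1:]) 0))"
      by (rule absv_add)
    also have "\<dots> \<le> B" using c bB[of 0] by (simp only: max.bounded_iff)
    finally show ?thesis by (simp add: 0 pcompose_pCons)
  next
    case (Suc n)
    have "absv (b * coeff (pcompose f [:b, 1:]) i + coeff (pcompose f [:b, 1:]) n)
       \<le> max (absv (b * coeff (pcompose f [:b, 1:]) i)) (absv (coeff (pcompose f [:b, 1:]) n))"
      by (rule absv_add)
    also have "\<dots> \<le> B" using IH bB by simp
    finally show ?thesis by (simp add: Suc pcompose_pCons)
  qed
qed (simp add: assms(3))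

text \<open>On polynomials of bounded degree the disc norm is equivalent to the largest absolute value of
  a coefficient. The recentering at the origin does not change the latter.\<close>

lemma coeff_le_disc_norm:
  assumes \<rho>: "0 < \<rho>" "\<rho> \<le> 1" and a: "absv a \<le> 1" and deg: "degree r < d"
  shows "absv (emb (coeff r i)) \<le> disc_norm a \<rho> r / \<rho> ^ d"
proof -
  have "pcompose (taylor a r) [:- a, 1:] = pcompose (emb_poly r) (pcompose [:a, 1:] [:- a, 1:])"
    unfolding taylor_def by (rule pcompose_assoc[symmetric])
  also have "pcompose [:a, 1:] [:- a, 1:] = [:0, 1:]" by (simp add: pcompose_pCons)
  finally have eq: "pcompose (taylor a r) [:- a, 1:] = emb_poly r" by simp
  have "absv (coeff (taylor a r) i) \<le> disc_norm a \<rho> r / \<rho> ^ d" for i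
  proof (cases "i \<le> degree r")
    case True
    have "absv (coeff (taylor a r) i) * \<rho> ^ d \<le> absv (coeff (taylor a r) i) * \<rho> ^ i"
      using \<rho> True deg by (intro mult_left_mono power_decreasing) auto
    also have "\<dots> \<le> disc_norm a \<rho> r" unfolding disc_norm_def by (rule gauss_norm_ge[OF \<rho>(1)])
    finally show ?thesis using \<rho> by (simp add: field_simps)
  next
    case False
    then show ?thesis using disc_norm_nonneg[OF \<rho>(1), of a r] \<rho> by (simp add: coeff_eq_0)
  qed
  then have "absv (coeff (pcompose (taylor a r) [:- a, 1:]) i) \<le> disc_norm a \<rho> r / \<rho> ^ d"
    using disc_norm_nonneg[OF \<rho>(1), of a r] a \<rho> by (intro pcompose_shift_bound) auto
  then show ?thesis by (simp add: eq)
qed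

lemma le_of_power_le:
  fixes x y C :: real
  assumes "\<And>n. x ^ n \<le> C * y ^ n" "x \<ge> 0" "y \<ge> 0"
  shows "x \<le> y"
proof (rule ccontr)
  assume "\<not> x \<le> y"
  then have xy: "y < x" "x > 0" using assms by auto
  show False
  proof (cases "y = 0")
    case True
    then show False using assms(1)[of 1] xy by simp
  next
    case False
    then have y: "y > 0" using assms by simp
    then have "1 < x / y" using xy by simp
    then obtain n where "C < (x / y) ^ n" using real_arch_pow by blast
    then have "C * y ^ n < x ^ n" using y by (simp add: power_divide field_simps)
    then show False using assms(1)[of n] by simp
  qed
qed

lemma min_poly_absv_le_1: "min_poly_of W a \<Longrightarrow> absv a \<le> 1"
  by (auto simp: min_poly_of_def integral_ring_def absv_le_1_iff)

text \<open>Expanding \<open>g\<close> in powers of \<open>W\<close> gives \<open>M g \<le> C |g|\<close> with a constant that comes from the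
  comparison of norms on the polynomials of degree less than that of \<open>W\<close>. Applied to the powers of
  \<open>g\<close>, the same constant disappears in the limit.\<close>

theorem seminorm_le_disc_norm:
  assumes M: "poly_seminorm M" and W: "min_poly_of W a" and \<rho>: "0 < \<rho>" "\<rho> \<le> 1"
    and le: "M W \<le> disc_norm a \<rho> W"
  shows "M g \<le> disc_norm a \<rho> g"
proof -
  define C where "C = 1 / \<rho> ^ degree W"
  have C: "C > 0" using \<rho> by (simp add: C_def)
  have lW: "lead_coeff W = 1" using W by (simp add: min_poly_of_def)
  have bound: "M g \<le> C * disc_norm a \<rho> g" for g
  proof (induction "degree g" arbitrary: g rule: less_induct)
    case less
    obtain q r where qr: "g = W * q + r" "r = 0 \<or> degree r < degree W"
      using monic_division[OF lW] by metis
    have orth: "disc_norm a \<rho> r \<le> disc_norm a \<rho> g"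
      "disc_norm a \<rho> W * disc_norm a \<rho> q \<le> disc_norm a \<rho> g"
      using disc_norm_orthogonal[OF \<rho>(1) W qr(2)] by (simp_all add: qr(1))
    have "M r \<le> C * disc_norm a \<rho> r"
    proof (cases "r = 0")
      case False
      then have "degree r < degree W" using qr by simp
      then have "M r \<le> disc_norm a \<rho> r / \<rho> ^ degree W"
        using \<rho> disc_norm_nonneg[OF \<rho>(1), of a r]
        by (intro poly_seminorm_bound[OF M] coeff_le_disc_norm min_poly_absv_le_1[OF W]) auto
      then show ?thesis by (simp add: C_def)
    next
      case True
      have "C * disc_norm a \<rho> 0 \<ge> 0" using C disc_norm_nonneg[OF \<rho>(1), of a 0] by (intro mult_nonneg_nonneg) auto
      then show ?thesis using True by (simp add: poly_seminorm_simps(9)[OF M])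
    qed
    also have "\<dots> \<le> C * disc_norm a \<rho> g" using orth(1) C by simp
    finally have 1: "M r \<le> C * disc_norm a \<rho> g" .
    have 2: "M (W * q) \<le> C * disc_norm a \<rho> g"
    proof (cases "degree q < degree g")
      case True
      have "M W * M q \<le> disc_norm a \<rho> W * (C * disc_norm a \<rho> q)"
        using le less[OF True] disc_norm_nonneg[OF \<rho>(1), of a] poly_seminorm_simps(3)[OF M] by (intro mult_mono) auto
      also have "\<dots> \<le> C * disc_norm a \<rho> g" using orth(2) C by (simp add: mult.left_commute)
      finally show ?thesis by (simp add: poly_seminorm_simps(1)[OF M])
    next
      case False
      \<comment> \<open>A root has a minimal polynomial of positive degree.\<close>
      have "degree W \<noteq> 0"
      proof
        assume "degree W = 0"
        then obtain c where "W = [:c:]" by (rule degree_eq_zeroE)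
        then have "W = 1" using lW by (simp add: one_pCons)
        then show False using W by (simp add: min_poly_of_def)
      qed
      have "q = 0"
      proof (rule ccontr)
        assume "q \<noteq> 0"
        moreover have "W \<noteq> 0" using lW by auto
        ultimately have "degree (W * q) = degree W + degree q" by (simp add: degree_mult_eq)
        then have "degree g = degree W + degree q"
          unfolding qr(1) using qr(2) by (metis add.right_neutral degree_add_eq_left trans_less_add1)
        then show False using False \<open>degree W \<noteq> 0\<close> by simp
      qed
      then show ?thesis using C disc_norm_nonneg[OF \<rho>(1), of a g]
        by (simp add: poly_seminorm_simps(9)[OF M])
    qed
    have "M g \<le> max (M (W * q)) (M r)" unfolding qr(1) by (rule poly_seminorm_simps(2)[OF M])
    then show ?case using 1 2 by simp
  qed
  have pow: "disc_norm a \<rho> (g ^ n) = disc_norm a \<rho> g ^ n" for n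
  proof (induction n)
    case 0
    show ?case using gauss_const(1)[OF \<rho>(1), of 1] by (simp add: disc_norm_def flip: one_pCons)
  qed (simp add: disc_norm_mult[OF \<rho>(1)])
  show ?thesis
  proof (rule le_of_power_le)
    show "M g ^ n \<le> C * disc_norm a \<rho> g ^ n" for n
      using bound[of "g ^ n"] by (simp add: pow poly_seminorm_simps(8)[OF M])
  qed (use poly_seminorm_simps(3)[OF M] disc_norm_nonneg[OF \<rho>(1), of a g] in auto)
qed

text \<open>If \<open>g\<close> has no zero on the disc, then a power of \<open>g\<close> is a constant of \<open>k((X))\<close> up to a smaller
  error, because the residue field of the algebraic closure is \<open>k\<close>. So \<open>M g\<close> is determined.\<close>

lemma seminorm_eq_absv:
  fixes M :: "'a::alg_closed_field fps poly \<Rightarrow> real"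
  assumes M: "poly_seminorm M" and \<rho>: "\<rho> > 0" and le: "\<And>h. M h \<le> disc_norm a \<rho> h"
    and a: "absv a \<le> 1" and g: "g \<noteq> 0" and far: "\<And>x. x \<in># roots g \<Longrightarrow> \<rho> < absv (a - x)"
  shows "M g = absv (ev g a)"
proof -
  let ?z = "ev g a"
  have z: "?z \<noteq> 0"
  proof
    assume "?z = 0"
    then have "a \<in># roots g" using g by (simp add: in_roots_iff)
    then show False using far[of a] \<rho> by simp
  qed
  obtain m n where s: "slope ?z m n" using slope_exists[OF z] by blast
  have n: "n > 0" using s by (simp add: slope_def)
  have "absv ?z \<le> 1" using a integral_ev[of a g] by (simp add: absv_le_1_iff)
  then have m: "m \<ge> 0" using n by (simp add: absv_slope[OF s] zero_le_divide_iff)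
  define B where "B = absv (unif ^ nat m :: 'a puiseux)"
  have tm: "unif powi m = unif ^ nat m" using m by (simp add: power_int_def)
  have B: "B > 0" by (simp add: B_def absv_pos)
  let ?u = "?z ^ n / unif ^ nat m"
  have u: "integral_unit ?u" using s unfolding slope_def tm by simp
  have u1: "absv ?u = 1"
  proof (rule antisym)
    show "absv ?u \<le> 1" using u by (simp only: absv_le_1_iff integral_unit_def)
    have "absv (inverse ?u) \<le> 1" using u unfolding absv_le_1_iff integral_unit_def by blast
    moreover have "absv ?u > 0" using u unfolding integral_unit_def by (intro absv_pos) blast
    ultimately show "1 \<le> absv ?u" unfolding absv_inverse by (simp only: inverse_le_1_iff) linarith
  qed
  obtain l where l: "absv (?u - emb (fps_const l)) < 1" using residue_exists[OF eq_refl[OF u1]] by blast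
  have zB: "absv ?z ^ n = B" using u1 B by (simp add: B_def)
  define h where "h = g ^ n - [:fps_const l * fps_X ^ nat m:]"
  have l0: "l \<noteq> 0"
  proof
    assume "l = 0"
    then have "?u - emb (fps_const l) = ?u" by simp
    with l have "absv ?u < 1" by (simp only:)
    then show False unfolding u1 by simp
  qed
  have "disc_norm a \<rho> h < B"
    unfolding disc_norm_def
  proof (rule gauss_norm_less)
    fix i
    have "gauss_index \<rho> (taylor a g) = 0"
    proof -
      have "{#x \<in># roots g. absv (a - x) \<le> \<rho>#} = {#}"
        by (auto simp: multiset_eq_iff not_in_iff[symmetric] dest: far)
      then show ?thesis using disc_roots(2)[OF \<rho> g, of a] by (simp add: disc_zeros_def)
    qed
    then have idx: "gauss_index \<rho> (taylor a (g ^ n)) = 0 \<and> gauss_norm \<rho> (taylor a (g ^ n)) = B"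
    proof -
      assume g0: "gauss_index \<rho> (taylor a g) = 0"
      then have g1: "gauss_norm \<rho> (taylor a g) = absv ?z"
        using gauss_index(1)[OF \<rho>, of "taylor a g"] by (simp add: coeff_taylor_0)
      have "gauss_index \<rho> (taylor a g ^ k) = 0 \<and> gauss_norm \<rho> (taylor a g ^ k) = absv ?z ^ k" for k
      proof (induction k)
        case 0
        show ?case using gauss_const[OF \<rho>, of 1] by (simp flip: one_pCons)
      next
        case (Suc k)
        then show ?case using g0 g1 gauss_mult[OF \<rho>, of "taylor a g" "taylor a g ^ k"] g by simp
      qed
      then show ?thesis using zB by simp
    qed
    show "absv (coeff (taylor a h) i) * \<rho> ^ i < B"
    proof (cases i)
      case 0
      have "coeff (taylor a h) 0 = ?z ^ n - emb (fps_const l) * unif ^ nat m"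
        by (simp add: h_def coeff_taylor_0[of a g, symmetric] coeff_0_power unif_def)
      also have "\<dots> = unif ^ nat m * (?u - emb (fps_const l))" by (simp add: field_simps)
      finally have "absv (coeff (taylor a h) 0) = B * absv (?u - emb (fps_const l))"
        by (simp only: absv_mult B_def)
      also have "\<dots> < B" using l B by simp
      finally show ?thesis by (simp add: 0)
    next
      case (Suc j)
      have "taylor a (g ^ n) \<noteq> 0" using g by simp
      then have "absv (coeff (taylor a (g ^ n)) i) * \<rho> ^ i < B"
        using gauss_index(2)[OF \<rho>, of "taylor a (g ^ n)" i] idx Suc by simp
      moreover have "coeff (taylor a h) i = coeff (taylor a (g ^ n)) i" by (simp add: h_def Suc)
      ultimately show ?thesis by simp
    qed
  qed
  then have Mh: "M h < B" using le[of h] by simp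
  have "absv (emb (fps_const l * fps_X ^ nat m)) = B"
    using l0 absv_emb_unit[of "fps_const l"] by (simp add: B_def unif_def)
  then have Mc: "M [:fps_const l * fps_X ^ nat m:] = B" by (simp only: poly_seminorm_simps(4)[OF M])
  have "M (g ^ n) \<le> max (M h) (M [:fps_const l * fps_X ^ nat m:])"
    using poly_seminorm_simps(2)[OF M, of h "[:fps_const l * fps_X ^ nat m:]"] by (simp add: h_def)
  moreover have "M [:fps_const l * fps_X ^ nat m:] \<le> max (M (g ^ n)) (M h)"
    using poly_seminorm_simps(7)[OF M, of "g ^ n" h] by (simp add: h_def)
  ultimately have "M g ^ n = B" using Mh Mc by (simp add: poly_seminorm_simps(8)[OF M])
  then have "M g ^ n = absv ?z ^ n" using zB by simp
  then show ?thesis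
    by (rule power_eq_imp_eq_base[OF _ poly_seminorm_simps(3)[OF M] absv_nonneg n])
qed

section \<open>The three-branch relation\<close>

lemma min_poly_conjugate:
  assumes "min_poly_of W a" "ev W b = 0" shows "min_poly_of W b"
  using assms conjugate_nonzero[OF assms] by (simp add: min_poly_of_def)

lemma min_poly_nonzero: "min_poly_of W a \<Longrightarrow> W \<noteq> 0"
  by (auto simp: min_poly_of_def)

lemma min_poly_in_roots: "min_poly_of W a \<Longrightarrow> a \<in># roots W"
  by (simp add: in_roots_iff min_poly_nonzero) (simp add: min_poly_of_def)

lemma disc_norm_min_poly:
  assumes "min_poly_of W b" "\<rho> > 0"
  shows "disc_norm a \<rho> W = (\<Prod>x\<in>#roots W. max (absv (a - x)) \<rho>)"
proof -
  have "lead_coeff W = 1" "W \<noteq> 0" using assms(1) min_poly_nonzero by (auto simp: min_poly_of_def)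
  then show ?thesis using disc_roots(1)[OF assms(2), of W a] by simp
qed

lemma absv_ev_min_poly:
  assumes "min_poly_of W b"
  shows "absv (ev W a) = (\<Prod>x\<in>#roots W. absv (a - x))"
proof -
  have "lead_coeff W = 1" "W \<noteq> 0" using assms(1) min_poly_nonzero by (auto simp: min_poly_of_def)
  then show ?thesis using ev_roots[of W a] by (simp add: absv_prod_mset)
qed

lemma prod_mset_const: "(\<Prod>x\<in>#A. c) = c ^ size A" for c :: real
  by (induction A) auto

text \<open>Both sides are the product of \<open>max |x - y| \<rho>\<close> over all pairs of roots.\<close>

lemma disc_norm_symmetric:
  assumes V: "min_poly_of V a" and W: "min_poly_of W b" and \<rho>: "\<rho> > 0"
  shows "disc_norm a \<rho> W ^ degree V = disc_norm b \<rho> V ^ degree W"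
proof -
  have "disc_norm a \<rho> W ^ degree V = (\<Prod>x\<in>#roots V. disc_norm a \<rho> W)"
    by (simp only: prod_mset_const size_roots[OF min_poly_nonzero[OF V]])
  also have "\<dots> = (\<Prod>x\<in>#roots V. disc_norm x \<rho> W)"
    using disc_conjugate(1)[OF V] in_roots_iff[OF min_poly_nonzero[OF V]]
    by (intro arg_cong[where f = prod_mset] image_mset_cong) auto
  also have "\<dots> = (\<Prod>x\<in>#roots V. \<Prod>y\<in>#roots W. max (absv (x - y)) \<rho>)"
    by (simp only: disc_norm_min_poly[OF W \<rho>])
  also have "\<dots> = (\<Prod>y\<in>#roots W. \<Prod>x\<in>#roots V. max (absv (y - x)) \<rho>)"
    by (subst prod_mset.swap) (simp only: absv_minus_commute)
  also have "\<dots> = (\<Prod>y\<in>#roots W. disc_norm y \<rho> V)"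
    by (simp only: disc_norm_min_poly[OF V \<rho>])
  also have "\<dots> = (\<Prod>y\<in>#roots W. disc_norm b \<rho> V)"
    using disc_conjugate(1)[OF W] in_roots_iff[OF min_poly_nonzero[OF W]]
    by (intro arg_cong[where f = prod_mset] image_mset_cong) auto
  also have "\<dots> = disc_norm b \<rho> V ^ degree W"
    by (simp only: prod_mset_const size_roots[OF min_poly_nonzero[OF W]])
  finally show ?thesis .
qed

lemma ev_symmetric:
  assumes V: "min_poly_of V a" and W: "min_poly_of W b"
  shows "absv (ev W a) ^ degree V = absv (ev V b) ^ degree W"
proof -
  have "absv (ev W a) ^ degree V = (\<Prod>x\<in>#roots V. absv (ev W a))"
    by (simp only: prod_mset_const size_roots[OF min_poly_nonzero[OF V]])
  also have "\<dots> = (\<Prod>x\<in>#roots V. absv (ev W x))"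
    using conjugate_absv[OF V] in_roots_iff[OF min_poly_nonzero[OF V]]
    by (intro arg_cong[where f = prod_mset] image_mset_cong) auto
  also have "\<dots> = (\<Prod>x\<in>#roots V. \<Prod>y\<in>#roots W. absv (x - y))"
    by (simp only: absv_ev_min_poly[OF W])
  also have "\<dots> = (\<Prod>y\<in>#roots W. \<Prod>x\<in>#roots V. absv (y - x))"
    by (subst prod_mset.swap) (simp only: absv_minus_commute)
  also have "\<dots> = (\<Prod>y\<in>#roots W. absv (ev V y))"
    by (simp only: absv_ev_min_poly[OF V])
  also have "\<dots> = (\<Prod>y\<in>#roots W. absv (ev V b))"
    using conjugate_absv[OF W] in_roots_iff[OF min_poly_nonzero[OF W]]
    by (intro arg_cong[where f = prod_mset] image_mset_cong) auto
  also have "\<dots> = absv (ev V b) ^ degree W"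
    by (simp only: prod_mset_const size_roots[OF min_poly_nonzero[OF W]])
  finally show ?thesis .
qed

lemma disc_norm_mono_radius: "0 < r \<Longrightarrow> r \<le> s \<Longrightarrow> disc_norm a r g \<le> disc_norm a s g"
  unfolding disc_norm_def by (rule gauss_norm_mono_radius)

lemma prod_mset_mono_strict:
  fixes f g :: "'b \<Rightarrow> real"
  assumes "\<And>x. x \<in># A \<Longrightarrow> 0 < f x \<and> f x \<le> g x" "a \<in># A" "f a < g a"
  shows "(\<Prod>x\<in>#A. f x) < (\<Prod>x\<in>#A. g x)"
proof -
  obtain B where B: "A = add_mset a B" using assms(2) by (metis mset_add)
  have "0 < (\<Prod>x\<in>#C. f x) \<and> (\<Prod>x\<in>#C. f x) \<le> (\<Prod>x\<in>#C. g x)"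
    if "\<And>x. x \<in># C \<Longrightarrow> 0 < f x \<and> f x \<le> g x" for C
    using that
  proof (induction C)
    case (add x C)
    then have "0 < f x" "f x \<le> g x" "0 < (\<Prod>x\<in>#C. f x)" "(\<Prod>x\<in>#C. f x) \<le> (\<Prod>x\<in>#C. g x)" by auto
    then show ?case by (auto intro!: mult_mono)
  qed simp
  from this[of B] have "0 < (\<Prod>x\<in>#B. f x)" "(\<Prod>x\<in>#B. f x) \<le> (\<Prod>x\<in>#B. g x)"
    using assms(1) B by auto
  moreover have "0 < f a" using assms by blast
  ultimately have "f a * (\<Prod>x\<in>#B. f x) < g a * (\<Prod>x\<in>#B. g x)"
    using assms(3) by (intro mult_less_le_imp_less) auto
  then show ?thesis by (simp add: B)
qed

lemma disc_norm_strict_mono: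
  assumes W: "min_poly_of W a" and "0 < r" "r < s"
  shows "disc_norm a r W < disc_norm a s W"
  unfolding disc_norm_min_poly[OF W \<open>0 < r\<close>] disc_norm_min_poly[OF W less_trans[OF assms(2,3)]]
  using assms(2,3) by (intro prod_mset_mono_strict[OF _ min_poly_in_roots[OF W]]) auto

text \<open>The norm of \<open>W\<close> grows continuously from \<open>0\<close> at radius \<open>0\<close> to \<open>1\<close> at radius \<open>1\<close>, as all roots
  of \<open>W\<close> lie in the open unit disc.\<close>

lemma radius_exists:
  assumes W: "min_poly_of W a" and small: "\<And>x. x \<in># roots W \<Longrightarrow> absv x < 1" and s: "0 < s" "s < 1"
  obtains \<rho> where "0 < \<rho>" "\<rho> < 1" "disc_norm a \<rho> W = s"
proof -
  define h where "h = (\<lambda>\<rho>. \<Prod>x\<in>#roots W. max (absv (a - x)) \<rho>)"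
  have cont: "continuous_on {0..1} (\<lambda>\<rho>::real. \<Prod>x\<in>#A. max (absv (a - x)) \<rho>)" for A
    by (induction A) (auto intro!: continuous_intros continuous_on_max)
  obtain B where B: "roots W = add_mset a B" using min_poly_in_roots[OF W] by (metis mset_add)
  have h0: "h 0 = 0" by (simp add: h_def B)
  have "h 1 = (\<Prod>x\<in>#roots W. 1)"
    unfolding h_def
  proof (intro arg_cong[where f = prod_mset] image_mset_cong)
    fix x assume "x \<in># roots W"
    then have "absv (a - x) < 1"
      using absv_diff[of a x] small min_poly_in_roots[OF W] by (metis max_less_iff_conj order_le_less_trans)
    then show "max (absv (a - x)) 1 = 1" by simp
  qed
  then have h1: "h 1 = 1" by simp
  have "\<exists>\<rho>\<ge>0. \<rho> \<le> 1 \<and> h \<rho> = s"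
    using s h0 h1 cont[of "roots W"] unfolding h_def[symmetric] by (intro IVT') auto
  then obtain \<rho> where \<rho>: "0 \<le> \<rho>" "\<rho> \<le> 1" "h \<rho> = s" by blast
  then have "0 < \<rho>" "\<rho> < 1" using h0 h1 s by (auto simp: less_le)
  then show ?thesis using \<rho>(3) by (intro that[of \<rho>]) (auto simp: h_def disc_norm_min_poly[OF W])
qed

text \<open>Let \<open>\<delta>\<close> be the distance of the roots of \<open>V\<close> and \<open>W\<close>, attained at \<open>a\<close> and \<open>b\<close>, and let \<open>\<rho>\<close>, \<open>\<sigma>\<close>
  be the radii of the discs about \<open>a\<close>, \<open>b\<close> that give \<open>V\<close>, \<open>W\<close> the norms \<open>M V\<close>, \<open>M W\<close>. If \<open>\<rho> < \<delta>\<close>,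
  the first disc contains no root of \<open>W\<close> and determines \<open>M W\<close>, and similarly if \<open>\<sigma> < \<delta>\<close>. If \<open>\<rho>\<close> and
  \<open>\<sigma>\<close> are at least \<open>\<delta>\<close>, the centres of both discs are interchangeable, and each of \<open>M V\<close>, \<open>M W\<close>
  bounds the other.\<close>

theorem three_branches_poly:
  fixes M :: "'a::alg_closed_field fps poly \<Rightarrow> real"
  assumes M: "poly_seminorm M" and V: "min_poly_of V a0" and W: "min_poly_of W b0"
    and nz: "ev W a0 \<noteq> 0"
    and small: "\<And>x. x \<in># roots V \<Longrightarrow> absv x < 1" "\<And>x. x \<in># roots W \<Longrightarrow> absv x < 1"
    and MV: "0 < M V" "M V < 1" and MW: "0 < M W" "M W < 1"
  defines "p \<equiv> M V ^ degree W" and "q \<equiv> M W ^ degree V" and "r \<equiv> absv (ev W a0) ^ degree V"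
  shows "(p \<le> q \<and> q = r) \<or> (q \<le> p \<and> p = r) \<or> (p = q \<and> r \<le> p)"
proof -
  have fin: "finite (set_mset (roots V) \<times> set_mset (roots W))" by simp
  have ne: "set_mset (roots V) \<times> set_mset (roots W) \<noteq> {}"
    using min_poly_in_roots[OF V] min_poly_in_roots[OF W] by auto
  let ?D = "(\<lambda>(x, y). absv (x - y)) ` (set_mset (roots V) \<times> set_mset (roots W))"
  have "Min ?D \<in> ?D" using fin ne by (intro Min_in) auto
  then obtain a b where ab: "a \<in># roots V" "b \<in># roots W" "Min ?D = absv (a - b)" by auto
  have min: "absv (a - b) \<le> absv (x - y)" if "x \<in># roots V" "y \<in># roots W" for x y
    unfolding ab(3)[symmetric] by (rule Min_le) (use that in auto)
  let ?\<delta> = "absv (a - b)"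
  have eva: "ev V a = 0" and evb: "ev W b = 0"
    using ab in_roots_iff min_poly_nonzero[OF V] min_poly_nonzero[OF W] by auto
  have V': "min_poly_of V a" and W': "min_poly_of W b"
    using min_poly_conjugate V W eva evb by auto
  have r: "r = absv (ev W a) ^ degree V" unfolding r_def using conjugate_absv[OF V eva] by simp
  have r': "r = absv (ev V b) ^ degree W" unfolding r ev_symmetric[OF V' W'] ..
  have "ev W a \<noteq> 0" using conjugate_nonzero[OF V eva nz] .
  then have "a \<noteq> b" using evb by auto
  then have \<delta>: "?\<delta> > 0" by (simp add: absv_pos)
  obtain \<rho> where \<rho>: "0 < \<rho>" "\<rho> < 1" "disc_norm a \<rho> V = M V"
    using radius_exists[OF V' small(1) MV] by blast
  obtain \<sigma> where \<sigma>: "0 < \<sigma>" "\<sigma> < 1" "disc_norm b \<sigma> W = M W"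
    using radius_exists[OF W' small(2) MW] by blast
  have dV: "M g \<le> disc_norm a \<rho> g" for g
    using seminorm_le_disc_norm[OF M V', of \<rho>] \<rho> by simp
  have dW: "M g \<le> disc_norm b \<sigma> g" for g
    using seminorm_le_disc_norm[OF M W', of \<sigma>] \<sigma> by simp
  have move: "disc_norm a s g = disc_norm b s g" if "?\<delta> \<le> s" for s g
  proof (cases "g = 0")
    case False
    have s: "s > 0" using that \<delta> by simp
    have "max (absv (a - x)) s = max (absv (b - x)) s" for x
      using absv_add[of "a - b" "b - x"] absv_diff[of "a - x" "a - b"] that by (auto simp: max_def split: if_splits)
    then show ?thesis unfolding disc_roots(1)[OF s False] by simp
  qed (simp add: disc_norm_def)
  have sym: "disc_norm a s W ^ degree V = disc_norm a s V ^ degree W" if "?\<delta> \<le> s" for s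
    using disc_norm_symmetric[OF V' W', of s] move[OF that] that \<delta> by simp
  have nonneg: "disc_norm c s g \<ge> 0" if "s > 0" for c s g by (rule disc_norm_nonneg[OF that])
  \<comment> \<open>No root is closer than \<open>\<delta>\<close>, so the maxima in \<open>disc_norm_min_poly\<close> are the distances.\<close>
  have edge_W: "absv (ev W a) = disc_norm a ?\<delta> W"
    unfolding absv_ev_min_poly[OF W'] disc_norm_min_poly[OF W' \<delta>]
    by (intro arg_cong[where f = prod_mset] image_mset_cong)
       (simp add: max.absorb1 min[OF ab(1)])
  have edge_V: "absv (ev V b) = disc_norm b ?\<delta> V"
    unfolding absv_ev_min_poly[OF V'] disc_norm_min_poly[OF V' \<delta>]
    by (intro arg_cong[where f = prod_mset] image_mset_cong)
       (simp add: max.absorb1 min[OF _ ab(2)] absv_minus_commute[of b])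
  consider "\<rho> < ?\<delta>" | "\<sigma> < ?\<delta>" | "?\<delta> \<le> \<rho>" "?\<delta> \<le> \<sigma>" by linarith
  then show ?thesis
  proof cases
    case 1
    have "M W = absv (ev W a)"
      using min[OF ab(1)] 1 min_poly_nonzero[OF W]
      by (intro seminorm_eq_absv[OF M \<rho>(1) dV min_poly_absv_le_1[OF V']]) force+
    then have q: "q = r" by (simp add: q_def r)
    have "p \<le> disc_norm a ?\<delta> V ^ degree W"
      unfolding p_def \<rho>(3)[symmetric] using 1 \<rho>(1) nonneg
      by (intro power_mono disc_norm_mono_radius) auto
    also have "\<dots> = r" unfolding sym[OF order_refl, symmetric] r edge_W ..
    finally show ?thesis using q by simp
  next
    case 2
    have far: "\<sigma> < absv (b - x)" if "x \<in># roots V" for x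
      using min[OF that ab(2)] 2 absv_minus_commute[of b x] by simp
    have "M V = absv (ev V b)"
      using far min_poly_nonzero[OF V]
      by (intro seminorm_eq_absv[OF M \<sigma>(1) dW min_poly_absv_le_1[OF W']]) auto
    then have p: "p = r" by (simp add: p_def r')
    have "q \<le> disc_norm b ?\<delta> W ^ degree V"
      unfolding q_def \<sigma>(3)[symmetric] using 2 \<sigma>(1) nonneg
      by (intro power_mono disc_norm_mono_radius) auto
    also have "\<dots> = r"
      unfolding move[OF order_refl, symmetric] sym[OF order_refl] r' edge_V ..
    finally show ?thesis using p by simp
  next
    case 3
    have "q \<le> disc_norm a \<rho> W ^ degree V"
      unfolding q_def using dV poly_seminorm_simps(3)[OF M] by (intro power_mono) auto
    also have "\<dots> = p" unfolding sym[OF 3(1)] by (simp add: p_def \<rho>(3))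
    finally have qp: "q \<le> p" .
    have "p \<le> disc_norm b \<sigma> V ^ degree W"
      unfolding p_def using dW poly_seminorm_simps(3)[OF M] by (intro power_mono) auto
    also have "\<dots> = disc_norm b \<sigma> W ^ degree V"
      using sym[OF 3(2)] move[OF 3(2)] by simp
    also have "\<dots> = q" by (simp add: q_def \<sigma>(3))
    finally have "p = q" using qp by simp
    moreover have "r \<le> p"
    proof -
      have "r \<le> disc_norm a \<rho> W ^ degree V"
        unfolding r edge_W using 3 \<delta> nonneg by (intro power_mono disc_norm_mono_radius) auto
      also have "\<dots> = p" unfolding sym[OF 3(1)] by (simp add: p_def \<rho>(3))
      finally show ?thesis .
    qed
    ultimately show ?thesis by simp
  qed
qed

section \<open>Branches and their minimal polynomials\<close>

text \<open>At a point outside the open unit disc the leading term would be strictly dominant.\<close>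

lemma weierstrass_root_small:
  assumes W: "weierstrass W" "ev W x = 0" shows "absv x < 1"
proof (rule ccontr)
  assume "\<not> absv x < 1"
  then have x: "absv x \<ge> 1" by simp
  let ?d = "degree W"
  have "0 = (\<Sum>i<?d. emb (coeff W i) * x ^ i) + x ^ ?d"
    using W by (simp add: ev_altdef weierstrass_def lessThan_Suc_atMost[symmetric])
  then have "x ^ ?d = - (\<Sum>i<?d. emb (coeff W i) * x ^ i)" by (simp add: eq_neg_iff_add_eq_0 add.commute)
  then have "absv (x ^ ?d) = absv (\<Sum>i<?d. emb (coeff W i) * x ^ i)" by simp
  also have "\<dots> < absv x ^ ?d"
  proof (rule absv_sum_less)
    fix i assume "i \<in> {..<?d}"
    then have i: "i < ?d" by simp
    have "absv (emb (coeff W i)) \<le> exp (-1)"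
      using W(1) i by (intro absv_emb_nonunit) (simp add: weierstrass_def)
    then have "absv (emb (coeff W i)) < 1" by (simp add: order_le_less_trans)
    then have "absv (emb (coeff W i)) * absv x ^ i < 1 * absv x ^ i"
      using x by (intro mult_strict_right_mono) auto
    also have "\<dots> \<le> absv x ^ ?d" using x i by (simp add: power_increasing)
    finally show "absv (emb (coeff W i) * x ^ i) < absv x ^ ?d" by simp
  qed (use x in simp)
  finally show False by simp
qed

definition branch_data :: "'a::field pseries \<Rightarrow> 'a fps poly \<Rightarrow> 'a puiseux \<Rightarrow> bool" where
  "branch_data f P a \<longleftrightarrow> weierstrass P \<and> min_poly_of P a \<and> (\<exists>u. u dvd 1 \<and> f = u * fps_of_poly P)"

lemma varX_dvd_iff: "varX dvd f \<longleftrightarrow> (\<forall>j. cf f 0 j = 0)" for f :: "'a::field pseries"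
proof
  assume "varX dvd f"
  then show "\<forall>j. cf f 0 j = 0" by (auto elim!: dvdE simp: cf_varX_mult)
next
  assume f: "\<forall>j. cf f 0 j = 0"
  have "f = varX * Abs_fps (\<lambda>j. Abs_fps (\<lambda>i. cf f (Suc i) j))"
    using f by (intro pseries_eqI) (simp add: cf_varX_mult, simp add: cf_def)
  then show "varX dvd f" by (metis dvd_triv_left)
qed

lemma irreducible_unit_factor:
  assumes "Factorial_Ring.irreducible (p * q)" "\<not> p dvd 1" shows "q dvd 1"
  using assms by (metis Factorial_Ring.irreducible_def)

text \<open>Any root \<open>a\<close> of the Weierstrass polynomial of \<open>f\<close> lies in the open unit disc, so a primitive
  annihilator of \<open>a\<close> has a unit as its leading coefficient and no other one. This makes it a
  Weierstrass polynomial that divides \<open>f\<close>.\<close>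

theorem branch_data_exists:
  fixes f :: "'a::field pseries"
  assumes irr: "Factorial_Ring.irreducible f" and nX: "\<not> varX dvd f"
  obtains P a where "branch_data f P a"
proof -
  define d where "d = (LEAST j. cf f 0 j \<noteq> 0)"
  have ex: "\<exists>j. cf f 0 j \<noteq> 0" using nX by (simp add: varX_dvd_iff)
  have top: "cf f 0 d \<noteq> 0" unfolding d_def by (rule LeastI_ex[OF ex])
  have low: "cf f 0 j = 0" if "j < d" for j
    using not_less_Least[of j "\<lambda>j. cf f 0 j \<noteq> 0"] that by (simp add: d_def)
  obtain u W where W: "u dvd 1" "f = u * fps_of_poly W" "weierstrass W" "degree W = d"
    by (rule weierstrass_preparation[OF low top])
  have "d > 0"
  proof (rule ccontr)
    assume "\<not> d > 0"
    then have "f dvd 1" using top by (simp add: pseries_unit_iff)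
    then show False using irr by (simp add: Factorial_Ring.irreducible_def)
  qed
  then obtain a where a: "ev W a = 0"
    unfolding ev_def using alg_closed_imp_poly_has_root[of "emb_poly W"] W(4) by auto
  have small: "absv a < 1" by (rule weierstrass_root_small[OF W(3) a])
  obtain p where p: "p \<noteq> 0" "ev p a = 0" "\<And>q. q \<noteq> 0 \<Longrightarrow> ev q a = 0 \<Longrightarrow> degree p \<le> degree q"
    "\<exists>i. fps_nth (coeff p i) 0 \<noteq> 0"
    using primitive_annihilator by blast
  define r where "r = (LEAST i. fps_nth (coeff p i) 0 \<noteq> 0)"
  have r1: "fps_nth (coeff p r) 0 \<noteq> 0" unfolding r_def by (rule LeastI_ex[OF p(4)])
  have r2: "fps_nth (coeff p j) 0 = 0" if "j < r" for j
    using not_less_Least[of j "\<lambda>i. fps_nth (coeff p i) 0 \<noteq> 0"] that by (simp add: r_def)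
  \<comment> \<open>The constant coefficient is a multiple of \<open>a\<close>, hence not a unit.\<close>
  have "r \<noteq> 0"
  proof
    assume "r = 0"
    then have c0: "absv (emb (coeff p 0)) = 1" using r1 absv_emb_unit by simp
    obtain c q where q: "p = pCons c q" by (rule pCons_cases)
    have "absv (emb c) = absv (a * ev q a)"
      using p(2) q by (metis absv_uminus add_eq_0_iff ev_simps(8) minus_minus)
    also have "\<dots> \<le> absv a * 1"
      unfolding absv_mult using small by (intro mult_left_mono) (auto simp: absv_le_1_iff intro!: integral_ev, simp flip: absv_le_1_iff)
    finally show False using c0 small q by simp
  qed
  then have rd: "r = degree p" using annihilator_first_unit[OF p(1-3) r2 r1] by blast
  define P where "P = smult (inverse (lead_coeff p)) p"
  have ic: "inverse (lead_coeff p) * lead_coeff p = 1"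
    using fps_unit_inverse[of "lead_coeff p"] r1 rd by (simp add: mult.commute)
  then have ic0: "inverse (lead_coeff p) \<noteq> 0" by (metis mult_zero_left zero_neq_one)
  then have degP: "degree P = degree p" by (simp add: P_def)
  have "coeff P (degree p) = inverse (lead_coeff p) * lead_coeff p" by (simp only: P_def coeff_smult)
  then have lP: "lead_coeff P = 1" unfolding degP ic .
  have wP: "weierstrass P"
    using r2 rd lP by (simp add: weierstrass_def degP P_def)
  have mP: "min_poly_of P a"
    using p(2,3) lP unfolding min_poly_of_def degP by (auto simp: P_def not_less dest: leD)
  obtain q where q: "W = P * q" using min_poly_dvd[OF mP a] by blast
  have fP: "f = fps_of_poly P * (u * fps_of_poly q)"
    using W(2) by (simp add: q fps_of_poly_mult mult_ac)
  have "\<not> fps_of_poly P dvd 1"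
    using weierstrass_low[OF wP, of 0] \<open>r \<noteq> 0\<close> rd degP by (simp add: pseries_unit_iff)
  then have "u * fps_of_poly q dvd 1" using irr irreducible_unit_factor unfolding fP by blast
  then have "branch_data f P a"
    unfolding branch_data_def using wP mP fP by (metis mult.commute)
  then show ?thesis by (rule that)
qed

lemma branch_data_roots_small:
  "branch_data f P a \<Longrightarrow> x \<in># roots P \<Longrightarrow> absv x < 1"
  using weierstrass_root_small weierstrass_nonzero in_roots_iff unfolding branch_data_def by blast

section \<open>Evaluation of power series at a point of a branch\<close>

text \<open>\<open>P(a) = 0\<close>, so the value at \<open>a\<close> of a power series is that of its remainder modulo \<open>P\<close>. No
  convergence is involved.\<close>

definition ev_branch :: "'a::field fps poly \<Rightarrow> 'a puiseux \<Rightarrow> 'a pseries \<Rightarrow> 'a puiseux" where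
  "ev_branch P a g = (THE z. \<exists>q r. g = q * fps_of_poly P + fps_of_poly r \<and> z = ev r a)"

context
  fixes P :: "'a::field fps poly" and a :: "'a puiseux"
  assumes wP: "weierstrass P" and mP: "min_poly_of P a"
begin

lemma ev_branch_eqI: "ev_branch P a (q * fps_of_poly P + fps_of_poly p) = ev p a"
  unfolding ev_branch_def
proof (rule the_equality)
  show "\<exists>q' r. q * fps_of_poly P + fps_of_poly p = q' * fps_of_poly P + fps_of_poly r \<and> ev p a = ev r a"
    by blast
next
  have lP: "lead_coeff P = 1" and aP: "ev P a = 0" using mP by (simp_all add: min_poly_of_def)
  fix z assume "\<exists>q' r. q * fps_of_poly P + fps_of_poly p = q' * fps_of_poly P + fps_of_poly r \<and> z = ev r a"
  then obtain q' r where eq: "q * fps_of_poly P + fps_of_poly p = q' * fps_of_poly P + fps_of_poly r"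
    and z: "z = ev r a" by blast
  obtain s t where st: "p = P * s + t" "t = 0 \<or> degree t < degree P" using monic_division[OF lP] by metis
  obtain s' t' where st': "r = P * s' + t'" "t' = 0 \<or> degree t' < degree P" using monic_division[OF lP] by metis
  have "(q + fps_of_poly s) * fps_of_poly P + fps_of_poly t =
    (q' + fps_of_poly s') * fps_of_poly P + fps_of_poly t'"
    using eq by (simp add: st(1) st'(1) fps_of_poly_add fps_of_poly_mult algebra_simps)
  moreover have "coeff t j = 0" "coeff t' j = 0" if "j \<ge> degree P" for j
    using st(2) st'(2) that by (auto intro: coeff_eq_0)
  ultimately have "t = t'"
    using weierstrass_division_unique(2)[of "degree P" "fps_of_poly P" _ t _ t']
      weierstrass_low[OF wP] weierstrass_top[OF wP] by blast
  then show "z = ev p a" by (simp add: z st(1) st'(1) aP)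
qed

lemma ev_branch_cases:
  obtains q r where "g = q * fps_of_poly P + fps_of_poly r" "ev_branch P a g = ev r a"
    "r = 0 \<or> degree r < degree P"
proof -
  obtain q r where qr: "g = q * fps_of_poly P + fps_of_poly r" "\<And>j. j \<ge> degree P \<Longrightarrow> coeff r j = 0"
    using weierstrass_division[OF weierstrass_low[OF wP] weierstrass_top[OF wP]] by metis
  have "r = 0 \<or> degree r < degree P" using qr(2)[of "degree r"] by (metis leading_coeff_0_iff not_le)
  then show ?thesis using that qr(1) ev_branch_eqI by metis
qed

lemma ev_branch_poly: "ev_branch P a (fps_of_poly p) = ev p a"
  using ev_branch_eqI[of 0 p] by simp

lemma ev_branch_add: "ev_branch P a (g + h) = ev_branch P a g + ev_branch P a h"
proof -
  obtain q r where qr: "g = q * fps_of_poly P + fps_of_poly r" "ev_branch P a g = ev r a"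
    by (rule ev_branch_cases)
  obtain q' r' where qr': "h = q' * fps_of_poly P + fps_of_poly r'" "ev_branch P a h = ev r' a"
    by (rule ev_branch_cases)
  have "g + h = (q + q') * fps_of_poly P + fps_of_poly (r + r')"
    by (simp add: qr(1) qr'(1) fps_of_poly_add algebra_simps)
  then show ?thesis using ev_branch_eqI qr(2) qr'(2) by (metis ev_simps(3))
qed

lemma ev_branch_mult: "ev_branch P a (g * h) = ev_branch P a g * ev_branch P a h"
proof -
  obtain q r where qr: "g = q * fps_of_poly P + fps_of_poly r" "ev_branch P a g = ev r a"
    by (rule ev_branch_cases)
  obtain q' r' where qr': "h = q' * fps_of_poly P + fps_of_poly r'" "ev_branch P a h = ev r' a"
    by (rule ev_branch_cases)
  have "g * h = (q * h + q' * fps_of_poly r) * fps_of_poly P + fps_of_poly (r * r')"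
    by (subst qr(1), subst (2) qr'(1)) (simp add: qr'(1) fps_of_poly_mult algebra_simps)
  then show ?thesis using ev_branch_eqI qr(2) qr'(2) by (metis ev_simps(4))
qed

lemma ev_branch_eq_0_iff: "ev_branch P a g = 0 \<longleftrightarrow> fps_of_poly P dvd g"
proof
  obtain q r where qr: "g = q * fps_of_poly P + fps_of_poly r" "ev_branch P a g = ev r a"
    "r = 0 \<or> degree r < degree P" by (rule ev_branch_cases)
  assume "ev_branch P a g = 0"
  then have "r = 0" using mP qr(2,3) by (auto simp: min_poly_of_def)
  then show "fps_of_poly P dvd g" by (simp add: qr(1))
next
  assume "fps_of_poly P dvd g"
  then obtain q where "g = fps_of_poly P * q" by (rule dvdE)
  then have "g = q * fps_of_poly P + fps_of_poly 0" by (simp add: mult.commute)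
  then show "ev_branch P a g = 0" using ev_branch_eqI[of q 0] by simp
qed

lemma ev_branch_integral: "ev_branch P a g \<in> integral_ring"
proof -
  obtain r where "ev_branch P a g = ev r a" by (rule ev_branch_cases)
  moreover have "a \<in> integral_ring" using mP by (auto simp: min_poly_of_def integral_ring_def)
  ultimately show ?thesis by (simp add: integral_ev)
qed

lemma ev_branch_1: "ev_branch P a 1 = 1"
  using ev_branch_poly[of 1] by simp

lemma ev_branch_power: "ev_branch P a (g ^ n) = ev_branch P a g ^ n"
  by (induction n) (auto simp: ev_branch_1 ev_branch_mult)

lemma ev_branch_varX: "ev_branch P a varX = unif"
  using ev_branch_poly[of "[:fps_X:]"] by (simp add: fps_of_poly_const varX_def unif_def)

text \<open>\<open>fps_of_poly P\<close> generates the kernel of a homomorphism to a field.\<close>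

lemma prime_elem_min_poly: "prime_elem (fps_of_poly P)"
proof (rule prime_elemI)
  show "fps_of_poly P \<noteq> 0" using mP min_poly_nonzero by (metis fps_of_poly_0 fps_of_poly_eq_iff)
  show "\<not> fps_of_poly P dvd 1"
    unfolding ev_branch_eq_0_iff[symmetric] by (simp add: ev_branch_1)
  fix g h assume "fps_of_poly P dvd g * h"
  then show "fps_of_poly P dvd g \<or> fps_of_poly P dvd h"
    unfolding ev_branch_eq_0_iff[symmetric] by (simp add: ev_branch_mult)
qed

end

lemma unit_mult_dvd:
  fixes u f g :: "'a::comm_ring_1"
  assumes "u dvd 1" shows "u * f dvd g \<longleftrightarrow> f dvd g"
proof
  assume "f dvd g"
  then have "u * f dvd 1 * g" by (rule mult_dvd_mono[OF assms])
  then show "u * f dvd g" by simp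
qed (rule dvd_mult_right)

lemma dvd_unit_mult:
  fixes u f g :: "'a::comm_ring_1"
  assumes "u dvd 1" shows "g dvd u * f \<longleftrightarrow> g dvd f"
proof
  assume "g dvd u * f"
  moreover have "u * f dvd f" unfolding unit_mult_dvd[OF assms] by (rule dvd_refl)
  ultimately show "g dvd f" by (rule dvd_trans)
qed (rule dvd_mult)

lemma prime_elem_unit_mult: "u dvd 1 \<Longrightarrow> prime_elem f \<Longrightarrow> prime_elem (u * f)" for u f :: "'a::idom"
  unfolding prime_elem_def by (auto simp: unit_mult_dvd)

lemma prime_elem_varX: "prime_elem (varX :: 'a::field pseries)"
proof (rule prime_elemI)
  \<comment> \<open>\<open>X\<close> generates the kernel of the reduction to \<open>k[[Y]]\<close>.\<close>
  define \<pi> where "\<pi> = (\<lambda>f::'a pseries. Abs_fps (\<lambda>j. cf f 0 j))"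
  have mult: "\<pi> (f * g) = \<pi> f * \<pi> g" for f g
    by (rule fps_ext) (simp add: \<pi>_def cf_mult fps_mult_nth atLeast0AtMost)
  have dvd: "varX dvd f \<longleftrightarrow> \<pi> f = 0" for f
    by (simp add: varX_dvd_iff \<pi>_def fps_eq_iff)
  show "varX dvd f \<or> varX dvd g" if "varX dvd f * g" for f g :: "'a pseries"
    using that by (simp add: dvd mult)
  show "(varX :: 'a pseries) \<noteq> 0" using cf_varX[of 1 0] by (metis cf_0 zero_neq_one)
  show "\<not> (varX :: 'a pseries) dvd 1" by (simp add: pseries_unit_iff cf_varX)
qed

text \<open>Up to a unit, an irreducible series is \<open>X\<close> or a minimal polynomial.\<close>

theorem irreducible_imp_prime_pseries:
  fixes f :: "'a::field pseries"
  assumes irr: "Factorial_Ring.irreducible f" shows "prime_elem f"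
proof (cases "varX dvd f")
  case True
  then obtain u where u: "f = varX * u" by (rule dvdE)
  have "\<not> (varX :: 'a pseries) dvd 1" by (simp add: pseries_unit_iff cf_varX)
  then have "u dvd 1" using irr irreducible_unit_factor unfolding u by blast
  then show ?thesis unfolding u using prime_elem_unit_mult[OF _ prime_elem_varX] by (metis mult.commute)
next
  case False
  then obtain P a where "branch_data f P a" using branch_data_exists irr by blast
  then show ?thesis unfolding branch_data_def
    using prime_elem_min_poly prime_elem_unit_mult by blast
qed

section \<open>Dimensions of quotients\<close>

definition k_subspace :: "'a::field pseries set \<Rightarrow> bool" where
  "k_subspace I \<longleftrightarrow> 0 \<in> I \<and> (\<forall>f\<in>I. \<forall>g\<in>I. f + g \<in> I) \<and> (\<forall>c. \<forall>f\<in>I. cnst c * f \<in> I)"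

lemma k_subspaceD:
  assumes "k_subspace I"
  shows "0 \<in> I" "f \<in> I \<Longrightarrow> g \<in> I \<Longrightarrow> f + g \<in> I" "f \<in> I \<Longrightarrow> cnst c * f \<in> I"
    "f \<in> I \<Longrightarrow> - f \<in> I" "f \<in> I \<Longrightarrow> g \<in> I \<Longrightarrow> f - g \<in> I"
proof -
  show *: "0 \<in> I" "f \<in> I \<Longrightarrow> g \<in> I \<Longrightarrow> f + g \<in> I" "f \<in> I \<Longrightarrow> cnst c * f \<in> I" for f g c
    using assms by (auto simp: k_subspace_def)
  show m: "f \<in> I \<Longrightarrow> - f \<in> I" for f using *(3)[of f "-1"] by simp
  show "f \<in> I \<Longrightarrow> g \<in> I \<Longrightarrow> f - g \<in> I" using *(2)[of f "- g"] m[of g] by simp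
qed

lemma k_subspace_sum: "k_subspace I \<Longrightarrow> (\<And>x. x \<in> A \<Longrightarrow> F x \<in> I) \<Longrightarrow> (\<Sum>x\<in>A. F x) \<in> I"
  by (induction A rule: infinite_finite_induct) (auto simp: k_subspaceD)

lemma quotient_basisI:
  assumes I: "k_subspace I" and fin: "finite B"
    and span: "\<And>f. \<exists>c. f - (\<Sum>b\<in>B. cnst (c b) * b) \<in> I"
    and indep: "\<And>c b. (\<Sum>b\<in>B. cnst (c b) * b) \<in> I \<Longrightarrow> b \<in> B \<Longrightarrow> c b = 0"
  shows "quotient_basis I B"
  unfolding quotient_basis_def
proof (intro conjI allI fin)
  fix f
  obtain c where c: "f - (\<Sum>b\<in>B. cnst (c b) * b) \<in> I" using span by blast
  let ?c = "\<lambda>b. if b \<in> B then c b else 0"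
  show "\<exists>!c. (\<forall>b. b \<notin> B \<longrightarrow> c b = 0) \<and> f - (\<Sum>b\<in>B. cnst (c b) * b) \<in> I"
  proof (rule ex1I[of _ ?c])
    have "(\<Sum>b\<in>B. cnst (?c b) * b) = (\<Sum>b\<in>B. cnst (c b) * b)" by (intro sum.cong) auto
    then show "(\<forall>b. b \<notin> B \<longrightarrow> ?c b = 0) \<and> f - (\<Sum>b\<in>B. cnst (?c b) * b) \<in> I" using c by simp
  next
    fix c' assume c': "(\<forall>b. b \<notin> B \<longrightarrow> c' b = 0) \<and> f - (\<Sum>b\<in>B. cnst (c' b) * b) \<in> I"
    have "(f - (\<Sum>b\<in>B. cnst (c b) * b)) - (f - (\<Sum>b\<in>B. cnst (c' b) * b)) \<in> I"
      using k_subspaceD(5)[OF I c conjunct2[OF c']] .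
    then have "(\<Sum>b\<in>B. cnst (c' b - c b) * b) \<in> I"
      by (simp add: left_diff_distrib sum_subtractf)
    then have "c' b = c b" if "b \<in> B" for b using indep[of "\<lambda>b. c' b - c b" b] that by simp
    then show "c' = ?c" using c' by auto
  qed
qed

lemma quotient_basisD:
  assumes "quotient_basis I B" and I: "k_subspace I"
  shows "finite B" and "\<exists>c. f - (\<Sum>b\<in>B. cnst (c b) * b) \<in> I"
    and "(\<Sum>b\<in>B. cnst (c b) * b) \<in> I \<Longrightarrow> b \<in> B \<Longrightarrow> c b = 0"
proof -
  have ex1: "\<exists>!c. (\<forall>b. b \<notin> B \<longrightarrow> c b = 0) \<and> f - (\<Sum>b\<in>B. cnst (c b) * b) \<in> I" for f
    using assms(1) by (simp add: quotient_basis_def)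
  show "finite B" using assms(1) by (simp add: quotient_basis_def)
  show "\<exists>c. f - (\<Sum>b\<in>B. cnst (c b) * b) \<in> I" using ex1[of f] by blast
  assume c: "(\<Sum>b\<in>B. cnst (c b) * b) \<in> I" and b: "b \<in> B"
  let ?c = "\<lambda>b. if b \<in> B then c b else 0"
  have "(\<Sum>b\<in>B. cnst (?c b) * b) = (\<Sum>b\<in>B. cnst (c b) * b)" by (intro sum.cong) auto
  then have "0 - (\<Sum>b\<in>B. cnst (?c b) * b) \<in> I" using k_subspaceD(4)[OF I c] by simp
  moreover have "0 - (\<Sum>b\<in>B. cnst ((\<lambda>_. 0) b) * b) \<in> I" using k_subspaceD(1)[OF I] by simp
  moreover have uniq: "d = e" if "(\<forall>b. b \<notin> B \<longrightarrow> d b = 0) \<and> 0 - (\<Sum>b\<in>B. cnst (d b) * b) \<in> I"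
    "(\<forall>b. b \<notin> B \<longrightarrow> e b = 0) \<and> 0 - (\<Sum>b\<in>B. cnst (e b) * b) \<in> I" for d e
    using ex1[of 0] that by blast
  ultimately have "?c = (\<lambda>_. 0)" by (intro uniq) auto
  from fun_cong[OF this, of b] show "c b = 0" using b by simp
qed

interpretation coords: vector_space "\<lambda>(c::'a::field) (f::'b \<Rightarrow> 'a) x. c * f x"
  by unfold_locales (auto simp: algebra_simps fun_eq_iff)

lemma sum_fun_apply_eq: "(\<Sum>i\<in>A. F i) x = (\<Sum>i\<in>A. F i x)"
  for F :: "'c \<Rightarrow> 'b \<Rightarrow> 'a::comm_monoid_add"
  by (induction A rule: infinite_finite_induct) auto

text \<open>The coordinates of the elements of one basis with respect to another are linearly independent
  vectors.\<close>

lemma quotient_basis_card_le: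
  fixes I :: "'a::field pseries set"
  assumes I: "k_subspace I" and B: "quotient_basis I B" and B': "quotient_basis I B'"
  shows "card B' \<le> card B"
proof -
  note fin = quotient_basisD(1)[OF B I] and fin' = quotient_basisD(1)[OF B' I]
  have "\<forall>b'. \<exists>c. (\<forall>b. b \<notin> B \<longrightarrow> c b = 0) \<and> b' - (\<Sum>b\<in>B. cnst (c b) * b) \<in> I"
    using B unfolding quotient_basis_def by blast
  then obtain C where C0: "\<And>b' b. b \<notin> B \<Longrightarrow> C b' b = 0"
    and C: "\<And>b'. b' - (\<Sum>b\<in>B. cnst (C b' b) * b) \<in> I" by metis
  have rel: "l b' = 0" if z: "\<And>b. (\<Sum>b'\<in>B'. l b' * C b' b) = 0" and b': "b' \<in> B'" for l b'
  proof -
    have "(\<Sum>b'\<in>B'. cnst (l b') * (\<Sum>b\<in>B. cnst (C b' b) * b)) =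
        (\<Sum>b\<in>B. cnst (\<Sum>b'\<in>B'. l b' * C b' b) * b)"
    proof -
      have cs: "cnst (\<Sum>x\<in>A. h x) = (\<Sum>x\<in>A. cnst (h x))" for A and h :: "'a pseries \<Rightarrow> 'a"
        by (induction A rule: infinite_finite_induct) auto
      show ?thesis
        unfolding sum_distrib_left cs sum_distrib_right by (subst sum.swap) (simp add: mult_ac)
    qed
    then have "(\<Sum>b'\<in>B'. cnst (l b') * b') = (\<Sum>b'\<in>B'. cnst (l b') * (b' - (\<Sum>b\<in>B. cnst (C b' b) * b)))"
      using z by (simp add: right_diff_distrib sum_subtractf)
    also have "\<dots> \<in> I" using C k_subspaceD(3)[OF I] by (intro k_subspace_sum[OF I]) auto
    finally show ?thesis using quotient_basisD(3)[OF B' I, of l b'] b' by blast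
  qed
  have inj: "inj_on C B'"
  proof (rule inj_onI, rule ccontr)
    fix p q assume pq: "p \<in> B'" "q \<in> B'" "C p = C q" "p \<noteq> q"
    let ?l = "\<lambda>b'. if b' = p then 1 else if b' = q then - 1 else (0::'a)"
    have "(\<Sum>b'\<in>B'. ?l b' * C b' b) = 0" for b
    proof -
      have "(\<Sum>b'\<in>B'. ?l b' * C b' b) = (\<Sum>b'\<in>{p, q}. ?l b' * C b' b)"
        using pq fin' by (intro sum.mono_neutral_right) auto
      then show ?thesis using pq by simp
    qed
    then show False using rel[of ?l p] pq by simp
  qed
  have "coords.independent (C ` B')"
  proof (rule coords.independent_if_scalars_zero)
    show "finite (C ` B')" using fin' by simp
    fix h v assume z: "(\<Sum>x\<in>C ` B'. (\<lambda>b. h x * x b)) = 0" and v: "v \<in> C ` B'"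
    have "(\<Sum>b'\<in>B'. h (C b') * C b' b) = 0" for b
      using fun_cong[OF z, of b] by (simp add: sum.reindex[OF inj] sum_fun_apply_eq)
    then show "h v = 0" using rel[of "\<lambda>b'. h (C b')"] v by auto
  qed
  moreover have "C ` B' \<subseteq> coords.span ((\<lambda>b b'. if b' = b then 1 else 0) ` B)"
  proof
    fix v assume "v \<in> C ` B'"
    then obtain b' where v: "v = C b'" by blast
    have "v = (\<Sum>b\<in>B. (\<lambda>x. C b' b * (if x = b then 1 else 0)))"
    proof
      fix x
      show "v x = (\<Sum>b\<in>B. (\<lambda>x. C b' b * (if x = b then 1 else 0))) x"
        using C0 fin by (cases "x \<in> B") (simp_all add: v sum_fun_apply_eq if_distrib cong: if_cong)
    qed
    also have "\<dots> \<in> coords.span ((\<lambda>b b'. if b' = b then 1 else 0) ` B)"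
      by (intro coords.span_sum coords.span_scale coords.span_base) auto
    finally show "v \<in> coords.span ((\<lambda>b b'. if b' = b then 1 else 0) ` B)" .
  qed
  ultimately have "card (C ` B') \<le> card ((\<lambda>b b'. if b' = b then 1 else (0::'a)) ` B)"
    using coords.independent_span_bound fin by blast
  also have "\<dots> \<le> card B" using fin by (rule card_image_le)
  finally show ?thesis by (simp add: card_image[OF inj])
qed

definition codim :: "'a::field pseries set \<Rightarrow> nat \<Rightarrow> bool" where
  "codim I n \<longleftrightarrow> (\<exists>B. quotient_basis I B \<and> card B = n)"

lemma codim_unique: "k_subspace I \<Longrightarrow> codim I m \<Longrightarrow> codim I n \<Longrightarrow> m = n"
  unfolding codim_def by (meson le_antisym quotient_basis_card_le)

lemma quotient_dim_codim:
  assumes "k_subspace I" "codim I n" shows "quotient_dim I = enat n"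
proof -
  have ex: "\<exists>B. quotient_basis I B" using assms(2) by (auto simp: codim_def)
  then have "quotient_basis I (SOME B. quotient_basis I B)" by (rule someI_ex)
  then have "codim I (card (SOME B. quotient_basis I B))" by (auto simp: codim_def)
  then show ?thesis using ex codim_unique[OF assms] by (simp add: quotient_dim_def)
qed

text \<open>A generating set of least cardinality is a basis.\<close>

lemma codim_exists:
  assumes I: "k_subspace I" and "finite S"
    and "\<And>f. \<exists>c. f - (\<Sum>b\<in>S. cnst (c b) * b) \<in> I"
  obtains n where "codim I n"
proof -
  let ?span = "\<lambda>B. finite B \<and> (\<forall>f. \<exists>c. f - (\<Sum>b\<in>B. cnst (c b) * b) \<in> I)"
  have "?span S" using assms by blast
  then obtain B where B: "?span B" and min: "\<And>B'. ?span B' \<Longrightarrow> card B \<le> card B'"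
    using ex_has_least_nat[of ?span S card] by auto
  have "quotient_basis I B"
  proof (rule quotient_basisI[OF I])
    fix c b assume c: "(\<Sum>b\<in>B. cnst (c b) * b) \<in> I" and b: "b \<in> B"
    show "c b = 0"
    proof (rule ccontr)
      assume cb: "c b \<noteq> 0"
      have "\<exists>d. f - (\<Sum>b\<in>B - {b}. cnst (d b) * b) \<in> I" for f
      proof -
        obtain e where e: "f - (\<Sum>b\<in>B. cnst (e b) * b) \<in> I" using B by blast
        define t where "t = e b / c b"
        have t: "e b = t * c b" using cb by (simp add: t_def)
        have "f - (\<Sum>b\<in>B. cnst (e b) * b) + cnst t * (\<Sum>b\<in>B. cnst (c b) * b) \<in> I"
          by (intro k_subspaceD[OF I] e c)
        also have "f - (\<Sum>b\<in>B. cnst (e b) * b) + cnst t * (\<Sum>b\<in>B. cnst (c b) * b) =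
            f - (\<Sum>x\<in>B. cnst (e x - t * c x) * x)"
          by (simp add: sum_distrib_left sum_subtractf left_diff_distrib mult.assoc)
        also have "(\<Sum>x\<in>B. cnst (e x - t * c x) * x) = (\<Sum>x\<in>B - {b}. cnst (e x - t * c x) * x)"
          using B b by (simp add: sum.remove[of B b] t)
        finally show ?thesis by (intro exI[of _ "\<lambda>x. e x - t * c x"])
      qed
      then have "card B \<le> card (B - {b})" using B by (intro min) auto
      then show False using B b by (metis card_Diff1_less not_le)
    qed
  qed (use B in auto)
  then show ?thesis using that by (auto simp: codim_def)
qed


section \<open>Intersection numbers\<close>

lemma k_subspace_ideal2: "k_subspace (ideal2 f g)"
  unfolding k_subspace_def
proof (intro conjI ballI allI)
  show "0 \<in> ideal2 f g" unfolding ideal2_def by (auto intro!: exI[of _ 0])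
  fix p q assume "p \<in> ideal2 f g" "q \<in> ideal2 f g"
  then obtain a b c d where "p = a * f + b * g" "q = c * f + d * g" by (auto simp: ideal2_def)
  then have "p + q = (a + c) * f + (b + d) * g" by (simp add: algebra_simps)
  then show "p + q \<in> ideal2 f g" unfolding ideal2_def by blast
next
  fix c p assume "p \<in> ideal2 f g"
  then obtain a b where "p = a * f + b * g" by (auto simp: ideal2_def)
  then have "cnst c * p = (cnst c * a) * f + (cnst c * b) * g" by (simp add: algebra_simps)
  then show "cnst c * p \<in> ideal2 f g" unfolding ideal2_def by blast
qed

lemma ideal2I: "a * f + b * g \<in> ideal2 f g"
  unfolding ideal2_def by blast

lemma ideal2E: "p \<in> ideal2 f g \<Longrightarrow> (\<And>a b. p = a * f + b * g \<Longrightarrow> thesis) \<Longrightarrow> thesis"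
  unfolding ideal2_def by blast

lemma ideal2_subset:
  assumes "f \<in> ideal2 f' g'" "g \<in> ideal2 f' g'" shows "ideal2 f g \<subseteq> ideal2 f' g'"
proof
  fix p assume "p \<in> ideal2 f g"
  then obtain a b where p: "p = a * f + b * g" by (rule ideal2E)
  obtain a1 b1 where f: "f = a1 * f' + b1 * g'" using assms(1) by (rule ideal2E)
  obtain a2 b2 where g: "g = a2 * f' + b2 * g'" using assms(2) by (rule ideal2E)
  have "p = (a * a1 + b * a2) * f' + (a * b1 + b * b2) * g'"
    unfolding p f g by (simp add: algebra_simps)
  then show "p \<in> ideal2 f' g'" unfolding ideal2_def by blast
qed

lemma ideal2_gens: "f \<in> ideal2 f g" "g \<in> ideal2 f g"
  using ideal2I[of 1 f 0 g] ideal2I[of 0 f 1 g] by simp_all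

lemma ideal2_multiples: "f dvd p \<Longrightarrow> p \<in> ideal2 f g" "g dvd p \<Longrightarrow> p \<in> ideal2 f g"
  using ideal2I[of _ f 0 g] ideal2I[of 0 f _ g] by (auto elim!: dvdE simp: mult.commute)

lemma ideal2_commute: "ideal2 f g = ideal2 g f"
  by (intro equalityI ideal2_subset ideal2_gens)

lemma ideal2_unit:
  assumes "u dvd 1" "v dvd 1" shows "ideal2 (u * f) (v * g) = ideal2 f g"
  using assms by (intro equalityI ideal2_subset ideal2_multiples) (auto simp: unit_mult_dvd)

lemma ideal2_cong:
  assumes "f dvd g - h" shows "ideal2 f g = ideal2 f h"
proof -
  have "ideal2 f g \<subseteq> ideal2 f h" if dvd: "f dvd g - h" for g h
  proof (intro ideal2_subset ideal2_gens)
    have "(g - h) + h \<in> ideal2 f h"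
      by (intro k_subspaceD(2)[OF k_subspace_ideal2] ideal2_multiples(1) dvd ideal2_gens)
    then show "g \<in> ideal2 f h" by simp
  qed
  moreover have "f dvd h - g" using assms by (metis dvd_minus_iff minus_diff_eq)
  ultimately show ?thesis using assms by blast
qed

lemma codim_whole: "codim (ideal2 f 1) 0"
proof -
  have "p \<in> ideal2 f 1" for p using ideal2I[of 0 f p 1] by simp
  then have "quotient_basis (ideal2 f 1) {}" by (intro quotient_basisI[OF k_subspace_ideal2]) auto
  then show ?thesis unfolding codim_def by (intro exI[of _ "{}"]) simp
qed

text \<open>A basis modulo \<open>(f, g)\<close> together with \<open>g\<close> times a basis modulo \<open>(f, h)\<close> is a basis modulo
  \<open>(f, g h)\<close>.\<close>

lemma codim_mult:
  assumes f: "prime_elem f" "\<not> f dvd g"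
    and g: "codim (ideal2 f g) n" and h: "codim (ideal2 f h) m"
  shows "codim (ideal2 f (g * h)) (n + m)"
proof -
  obtain B where B: "quotient_basis (ideal2 f g) B" "card B = n" using g by (auto simp: codim_def)
  obtain D where D: "quotient_basis (ideal2 f h) D" "card D = m" using h by (auto simp: codim_def)
  note Bp = quotient_basisD[OF B(1) k_subspace_ideal2] and Dp = quotient_basisD[OF D(1) k_subspace_ideal2]
  have "g \<noteq> 0" using f(2) by auto
  then have inj: "inj_on (\<lambda>d. g * d) D" by (intro inj_onI) simp
  have disj: "B \<inter> (\<lambda>d. g * d) ` D = {}"
  proof (rule ccontr)
    assume "B \<inter> (\<lambda>d. g * d) ` D \<noteq> {}"
    then obtain b where b: "b \<in> B" "b \<in> (\<lambda>d. g * d) ` D" by blast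
    then have "b \<in> ideal2 f g" by (auto intro: ideal2_multiples)
    moreover have "(\<Sum>x\<in>B. cnst (if x = b then 1 else 0) * x) = b"
    proof -
      have "(\<Sum>x\<in>B. cnst (if x = b then 1 else 0) * x) = (\<Sum>x\<in>B. if x = b then b else 0)"
        by (intro sum.cong) auto
      then show ?thesis using Bp(1) b(1) by simp
    qed
    ultimately show False using Bp(3)[of "\<lambda>x. if x = b then 1 else 0" b] b(1) by simp
  qed
  let ?E = "B \<union> (\<lambda>d. g * d) ` D"
  have split: "(\<Sum>x\<in>?E. cnst (c x) * x) = (\<Sum>b\<in>B. cnst (c b) * b) + g * (\<Sum>d\<in>D. cnst (c (g * d)) * d)" for c
    using Bp(1) Dp(1) disj
    by (subst sum.union_disjoint) (auto simp: sum.reindex[OF inj] sum_distrib_left mult.left_commute)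
  have "quotient_basis (ideal2 f (g * h)) ?E"
  proof (rule quotient_basisI[OF k_subspace_ideal2])
    show "finite ?E" using Bp(1) Dp(1) by simp
    fix p
    obtain c a s where c: "p - (\<Sum>b\<in>B. cnst (c b) * b) = a * f + s * g"
      using Bp(2)[of p] by (auto elim!: ideal2E)
    obtain c' a' s' where c': "s - (\<Sum>d\<in>D. cnst (c' d) * d) = a' * f + s' * h"
      using Dp(2)[of s] by (auto elim!: ideal2E)
    define e where "e = (\<lambda>x. if x \<in> B then c x else c' (THE d. d \<in> D \<and> x = g * d))"
    have eB: "(\<Sum>b\<in>B. cnst (e b) * b) = (\<Sum>b\<in>B. cnst (c b) * b)"
      by (intro sum.cong) (auto simp: e_def)
    have "e (g * d) = c' d" if "d \<in> D" for d
    proof -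
      have "(THE d'. d' \<in> D \<and> g * d = g * d') = d" using that \<open>g \<noteq> 0\<close> by (intro the_equality) auto
      then show ?thesis using that disj unfolding e_def by auto
    qed
    then have eD: "(\<Sum>d\<in>D. cnst (e (g * d)) * d) = (\<Sum>d\<in>D. cnst (c' d) * d)"
      by (intro sum.cong) auto
    have "p - (\<Sum>x\<in>?E. cnst (e x) * x) = (p - (\<Sum>b\<in>B. cnst (c b) * b)) - g * (\<Sum>d\<in>D. cnst (c' d) * d)"
      unfolding split eB eD by simp
    also have "\<dots> = a * f + g * (s - (\<Sum>d\<in>D. cnst (c' d) * d))"
      unfolding c by (simp add: algebra_simps)
    also have "\<dots> = (a + g * a') * f + s' * (g * h)" unfolding c' by (simp add: algebra_simps)
    finally have pe: "p - (\<Sum>x\<in>?E. cnst (e x) * x) = (a + g * a') * f + s' * (g * h)" .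
    have "p - (\<Sum>x\<in>?E. cnst (e x) * x) \<in> ideal2 f (g * h)" unfolding pe by (rule ideal2I)
    then show "\<exists>c. p - (\<Sum>x\<in>?E. cnst (c x) * x) \<in> ideal2 f (g * h)" by (rule exI[of _ e])
  next
    fix c x assume sum: "(\<Sum>x\<in>?E. cnst (c x) * x) \<in> ideal2 f (g * h)" and x: "x \<in> ?E"
    let ?b = "\<Sum>b\<in>B. cnst (c b) * b" and ?d = "\<Sum>d\<in>D. cnst (c (g * d)) * d"
    obtain a s where as: "?b + g * ?d = a * f + s * (g * h)" using sum unfolding split by (rule ideal2E)
    then have "?b = a * f + (s * h - ?d) * g" by (simp add: algebra_simps eq_diff_eq)
    then have "?b \<in> ideal2 f g" by (simp only: ideal2I)
    then have cB: "c b = 0" if "b \<in> B" for b using Bp(3)[of c b] that by blast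
    then have "?b = 0" by (intro sum.neutral) auto
    then have "g * (?d - s * h) = f * a" using as by (simp add: algebra_simps)
    then have "f dvd g * (?d - s * h)" by (metis dvd_triv_left)
    then have "f dvd ?d - s * h" using f by (simp add: prime_elem_dvd_mult_iff)
    then obtain a' where "?d - s * h = f * a'" by (rule dvdE)
    then have "?d = a' * f + s * h" by (simp add: algebra_simps)
    then have "?d \<in> ideal2 f h" by (simp only: ideal2I)
    then have "c (g * d) = 0" if "d \<in> D" for d using Dp(3)[of "\<lambda>d. c (g * d)" d] that by blast
    then show "c x = 0" using x cB by auto
  qed
  moreover have "card ?E = n + m"
    using Bp(1) Dp(1) disj B(2) D(2) by (subst card_Un_disjoint) (auto simp: card_image[OF inj])
  ultimately show ?thesis unfolding codim_def by blast
qed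

lemma codim_weierstrass_varX:
  fixes P :: "'a::field fps poly"
  assumes P: "weierstrass P"
  shows "codim (ideal2 (fps_of_poly P) varX) (degree P)"
proof -
  let ?I = "ideal2 (fps_of_poly P) varX" and ?B = "(\<lambda>j. fps_X ^ j :: 'a pseries) ` {..<degree P}"
  have X: "fps_nth (fps_X ^ j :: 'a pseries) l = (if l = j then 1 else 0)" for j l by simp
  have inj: "inj_on (\<lambda>j. fps_X ^ j :: 'a pseries) {..<degree P}"
  proof (rule inj_onI)
    fix i j assume "(fps_X ^ i :: 'a pseries) = fps_X ^ j"
    then show "i = j" using X[of i i] X[of j i] by (metis zero_neq_one)
  qed
  have sum: "(\<Sum>b\<in>?B. cnst (c b) * b) = (\<Sum>j<degree P. cnst (c (fps_X ^ j)) * fps_X ^ j)" for c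
    by (simp add: sum.reindex[OF inj])
  have cf_sum': "cf (\<Sum>j<degree P. cnst (e j) * fps_X ^ j) i l = (if i = 0 \<and> l < degree P then e l else 0)"
    for e :: "nat \<Rightarrow> 'a" and i l
  proof -
    have "cf (fps_X ^ j :: 'a pseries) i l = (if i = 0 \<and> l = j then 1 else 0)" for j
      by (simp add: cf_def X)
    then have "cf (\<Sum>j<degree P. cnst (e j) * fps_X ^ j) i l =
        (\<Sum>j<degree P. if j = l then (if i = 0 then e l else 0) else 0)"
      unfolding cf_sum cf_cnst_mult by (intro sum.cong) auto
    then show ?thesis by simp
  qed
  have "quotient_basis ?I ?B"
  proof (rule quotient_basisI[OF k_subspace_ideal2])
    fix p
    obtain q r where qr: "p = q * fps_of_poly P + fps_of_poly r" "\<And>j. j \<ge> degree P \<Longrightarrow> coeff r j = 0"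
      using weierstrass_division[OF weierstrass_low[OF P] weierstrass_top[OF P]] by metis
    define c where "c = (\<lambda>b :: 'a pseries. fps_nth (coeff r (THE j. b = fps_X ^ j)) 0)"
    have the: "(THE j'. (fps_X ^ j :: 'a pseries) = fps_X ^ j') = j" for j
    proof (rule the_equality)
      fix j' assume "(fps_X ^ j :: 'a pseries) = fps_X ^ j'"
      then show "j' = j" using X[of j j] X[of j' j] by (metis zero_neq_one)
    qed simp
    have "varX dvd fps_of_poly r - (\<Sum>b\<in>?B. cnst (c b) * b)"
      unfolding varX_dvd_iff sum using qr(2) by (simp add: cf_sum' c_def the)
    then have "fps_of_poly r - (\<Sum>b\<in>?B. cnst (c b) * b) \<in> ?I" by (rule ideal2_multiples)
    moreover have "q * fps_of_poly P \<in> ?I" by (rule ideal2_multiples) simp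
    ultimately have "q * fps_of_poly P + (fps_of_poly r - (\<Sum>b\<in>?B. cnst (c b) * b)) \<in> ?I"
      by (intro k_subspaceD(2)[OF k_subspace_ideal2])
    then show "\<exists>c. p - (\<Sum>b\<in>?B. cnst (c b) * b) \<in> ?I" unfolding qr(1) by (intro exI[of _ c]) (simp only: add_diff_eq)
  next
    fix c b assume c: "(\<Sum>b\<in>?B. cnst (c b) * b) \<in> ?I" and b: "b \<in> ?B"
    obtain a s where as: "(\<Sum>j<degree P. cnst (c (fps_X ^ j)) * fps_X ^ j) = a * fps_of_poly P + s * varX"
      using c unfolding sum by (rule ideal2E)
    obtain j where j: "b = fps_X ^ j" "j < degree P" using b by auto
    have "c b = cf (\<Sum>j<degree P. cnst (c (fps_X ^ j)) * fps_X ^ j) 0 j"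
      using j by (simp add: cf_sum')
    also have "\<dots> = cf (fps_of_poly P * a) 0 j + cf (varX * s) 0 j"
      unfolding as by (simp only: cf_add mult.commute)
    also have "\<dots> = 0"
      using weierstrass_low[OF P] j(2)
      by (simp add: cf_varX_mult, simp add: cf_mult del: cf_fps_of_poly)
    finally show "c b = 0" .
  qed simp
  then show ?thesis unfolding codim_def by (intro exI[of _ ?B]) (simp add: card_image[OF inj])
qed

text \<open>An integral equation of \<open>w\<close> expresses all its powers by those of exponent less than its
  degree, so one power of \<open>X\<close> clears all denominators.\<close>

lemma bounded_denominators:
  assumes w: "w \<in> integral_ring" and s: "unif ^ k * w = ev s a"
  obtains C where "\<And>N. \<exists>h. unif ^ C * w ^ N = ev h a"
proof -
  obtain p where p: "lead_coeff p = 1" "ev p w = 0" using w by (auto simp: integral_ring_def)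
  define e where "e = degree p"
  have "\<exists>h. unif ^ (k * e) * w ^ N = ev h a" for N
  proof -
    obtain q r where qr: "monom 1 N = p * q + r" "r = 0 \<or> degree r < degree p"
      using monic_division[OF p(1)] by metis
    have "w ^ N = ev (monom 1 N) w" by simp
    also have "\<dots> = ev r w" unfolding qr(1) using p(2) by simp
    finally have wN: "w ^ N = (\<Sum>i\<le>degree r. emb (coeff r i) * w ^ i)" by (simp add: ev_altdef)
    have t: "unif ^ (k * e) * (emb (coeff r i) * w ^ i) =
      ev (smult (coeff r i * fps_X ^ (k * (e - i))) (s ^ i)) a" if "i \<le> degree r" for i
    proof (cases "r = 0")
      case False
      then have "i \<le> e" using that qr(2) by (simp add: e_def)
      then have "k * e = k * (e - i) + k * i" by (simp flip: distrib_left)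
      then have "unif ^ (k * e) * (emb (coeff r i) * w ^ i) =
         emb (coeff r i) * unif ^ (k * (e - i)) * (unif ^ k * w) ^ i"
        by (simp add: power_add power_mult power_mult_distrib)
      then show ?thesis unfolding s by (simp add: unif_def)
    qed simp
    have "unif ^ (k * e) * w ^ N = ev (\<Sum>i\<le>degree r. smult (coeff r i * fps_X ^ (k * (e - i))) (s ^ i)) a"
      unfolding wN sum_distrib_left ev_sum by (intro sum.cong refl t) simp
    then show ?thesis by blast
  qed
  then show ?thesis by (rule that)
qed

context
  fixes P :: "'a::field fps poly" and a :: "'a puiseux"
  assumes wP: "weierstrass P" and mP: "min_poly_of P a"
begin

lemma codim_varX_power: "codim (ideal2 (fps_of_poly P) (varX ^ n)) (n * degree P)"
proof (induction n)
  case 0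
  show ?case by (simp add: codim_whole)
next
  case (Suc n)
  have "\<not> fps_of_poly P dvd varX"
    unfolding ev_branch_eq_0_iff[OF wP mP, symmetric] by (simp add: ev_branch_varX[OF wP mP])
  from codim_mult[OF prime_elem_min_poly[OF wP mP] this codim_weierstrass_varX[OF wP] Suc]
  show ?case by simp
qed

text \<open>The ideal \<open>(P, g)\<close> contains a power of \<open>X\<close>, modulo which the dimension is known.\<close>

lemma codim_branch_exists:
  assumes "ev_branch P a g \<noteq> 0" obtains n where "codim (ideal2 (fps_of_poly P) g) n"
proof -
  obtain s where s: "ev_branch P a g = ev s a" by (rule ev_branch_cases[OF wP mP])
  then obtain r n where rn: "ev s a * ev r a = unif ^ n" using inverse_in_field assms by metis
  have "ev_branch P a (g * fps_of_poly r) = ev_branch P a (varX ^ n)"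
    using rn by (simp add: ev_branch_mult[OF wP mP] ev_branch_power[OF wP mP] ev_branch_varX[OF wP mP]
      ev_branch_poly[OF wP mP] s)
  then have "ev_branch P a (g * fps_of_poly r - varX ^ n) = 0"
    using ev_branch_add[OF wP mP, of "g * fps_of_poly r - varX ^ n" "varX ^ n"] by simp
  then have "fps_of_poly P dvd g * fps_of_poly r - varX ^ n" by (simp add: ev_branch_eq_0_iff[OF wP mP])
  then have "ideal2 (fps_of_poly P) (varX ^ n) = ideal2 (fps_of_poly P) (g * fps_of_poly r)"
    by (rule ideal2_cong[symmetric])
  also have "\<dots> \<subseteq> ideal2 (fps_of_poly P) g"
    by (intro ideal2_subset ideal2_gens ideal2_multiples) simp
  finally have sub: "ideal2 (fps_of_poly P) (varX ^ n) \<subseteq> ideal2 (fps_of_poly P) g" .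
  obtain B where B: "quotient_basis (ideal2 (fps_of_poly P) (varX ^ n)) B"
    using codim_varX_power by (auto simp: codim_def)
  show ?thesis
  proof (rule codim_exists[OF k_subspace_ideal2 quotient_basisD(1)[OF B k_subspace_ideal2]])
    fix f show "\<exists>c. f - (\<Sum>b\<in>B. cnst (c b) * b) \<in> ideal2 (fps_of_poly P) g"
      using quotient_basisD(2)[OF B k_subspace_ideal2, of f] sub by blast
  qed (rule that)
qed

text \<open>Both sides are determined by multiplicativity and the value at \<open>X\<close>. If \<open>|g(a)\<^sup>n| = |X\<^sup>m|\<close>, the
  powers of \<open>g(a)\<^sup>n / X\<^sup>m\<close> and of its inverse have bounded denominators. So for all \<open>N\<close> the
  codimensions of \<open>g\<^sup>n\<^sup>N\<close> and \<open>X\<^sup>m\<^sup>N\<close>, which are linear in \<open>N\<close>, differ by at most a constant. Hence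
  they are equal.\<close>

theorem codim_eq_absv:
  assumes g: "ev_branch P a g \<noteq> 0" and n: "codim (ideal2 (fps_of_poly P) g) D"
  shows "exp (- real D) = absv (ev_branch P a g) ^ degree P"
proof -
  note pr = prime_elem_min_poly[OF wP mP]
  let ?z = "ev_branch P a g" and ?f = "fps_of_poly P" and ?d = "degree P"
  obtain s where s: "?z = ev s a" by (rule ev_branch_cases[OF wP mP])
  obtain m n where sl: "slope ?z m n" using slope_exists[OF g] by blast
  have np: "n > 0" using sl by (simp add: slope_def)
  have "absv ?z \<le> 1" by (simp add: absv_le_1_iff ev_branch_integral[OF wP mP])
  then have "m \<ge> 0" using np by (simp add: absv_slope[OF sl] zero_le_divide_iff)
  then obtain M where M: "m = int M" by (metis nonneg_int_cases)
  have u: "integral_unit (?z ^ n / unif ^ M)" using sl by (simp add: slope_def M)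
  obtain r k where rk: "ev (s ^ n) a * ev r a = unif ^ k"
    using inverse_in_field[of "s ^ n" a] g s by auto
  have w1: "unif ^ M * (?z ^ n / unif ^ M) = ev (s ^ n) a" by (simp add: s)
  have "unif ^ k * (unif ^ M / ?z ^ n) = (ev (s ^ n) a * ev r a) * unif ^ M / ?z ^ n"
    unfolding rk by simp
  also have "\<dots> = ev r a * unif ^ M" using g s by (simp add: field_simps)
  finally have w2: "unif ^ k * (unif ^ M / ?z ^ n) = ev (r * [:fps_X ^ M:]) a" by (simp add: unif_def)
  have inv: "unif ^ M / ?z ^ n \<in> integral_ring" using u by (simp add: integral_unit_def)
  obtain C1 where C1: "\<And>N. \<exists>h. unif ^ C1 * (?z ^ n / unif ^ M) ^ N = ev h a"
    using bounded_denominators[OF _ w1] u unfolding integral_unit_def by blast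
  obtain C2 where C2: "\<And>N. \<exists>h. unif ^ C2 * (unif ^ M / ?z ^ n) ^ N = ev h a"
    using bounded_denominators[OF inv w2] by blast
  have ndvd: "\<not> ?f dvd p" if "ev_branch P a p \<noteq> 0" for p
    using that by (simp add: ev_branch_eq_0_iff[OF wP mP])
  have gpow: "codim (ideal2 ?f (g ^ N)) (N * D)" for N
  proof (induction N)
    case (Suc N)
    from codim_mult[OF pr ndvd[OF g] n Suc] show ?case by simp
  qed (simp add: codim_whole)
  have evX: "ev_branch P a (varX ^ N) = unif ^ N" for N
    by (simp add: ev_branch_power[OF wP mP] ev_branch_varX[OF wP mP])
  \<comment> \<open>Divisibility on the branch bounds codimensions.\<close>
  have cmp: "i * ?d + j * D \<ge> i' * ?d + j' * D"
    if "unif ^ i * ?z ^ j = unif ^ i' * ?z ^ j' * ev h a" for i j i' j' h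
  proof -
    let ?p = "varX ^ i * g ^ j" and ?q = "(varX ^ i' * g ^ j') * fps_of_poly h"
    have nz: "ev_branch P a (varX ^ N) \<noteq> 0" "ev_branch P a (varX ^ N * g ^ L) \<noteq> 0" for N L
      using g by (simp_all add: ev_branch_mult[OF wP mP] ev_branch_varX[OF wP mP] ev_branch_power[OF wP mP])
    have eq: "ev_branch P a ?p = ev_branch P a ?q"
      using that by (simp add: ev_branch_mult[OF wP mP] ev_branch_varX[OF wP mP] ev_branch_power[OF wP mP] ev_branch_poly[OF wP mP])
    then have "ev_branch P a (?p - ?q) = 0" using ev_branch_add[OF wP mP, of "?p - ?q" ?q] by simp
    then have "?f dvd ?p - ?q" by (simp add: ev_branch_eq_0_iff[OF wP mP])
    then have id: "ideal2 ?f ?p = ideal2 ?f ?q" by (rule ideal2_cong)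
    have cp: "codim (ideal2 ?f (varX ^ N * g ^ L)) (N * ?d + L * D)" for N L
      by (rule codim_mult[OF pr ndvd[OF nz(1)] codim_varX_power gpow])
    have "ev_branch P a (fps_of_poly h) \<noteq> 0"
      using eq nz(2)[of i j] by (metis ev_branch_mult[OF wP mP] mult_zero_right)
    then obtain t where "codim (ideal2 ?f (fps_of_poly h)) t" by (rule codim_branch_exists)
    from codim_mult[OF pr ndvd[OF nz(2)] cp this]
    have "codim (ideal2 ?f ?q) ((i' * ?d + j' * D) + t)" .
    then have "i * ?d + j * D = (i' * ?d + j' * D) + t"
      using cp[of i j] codim_unique[OF k_subspace_ideal2] id by metis
    then show ?thesis by simp
  qed
  have le1: "M * N * ?d \<le> C1 * ?d + n * N * D" for N
  proof -
    obtain h where "unif ^ C1 * (?z ^ n / unif ^ M) ^ N = ev h a" using C1 by blast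
    then have "unif ^ C1 * ?z ^ (n * N) = unif ^ (M * N) * ?z ^ 0 * ev h a"
      unfolding power_mult[of ?z n N] power_mult[of unif M N] by (simp add: power_divide field_simps)
    from cmp[OF this] show ?thesis by simp
  qed
  have le2: "n * N * D \<le> (C2 + M * N) * ?d" for N
  proof -
    obtain h where "unif ^ C2 * (unif ^ M / ?z ^ n) ^ N = ev h a" using C2 by blast
    then have "unif ^ (C2 + M * N) * ?z ^ 0 = unif ^ 0 * ?z ^ (n * N) * ev h a"
      using g unfolding power_mult[of ?z n N] power_mult[of unif M N] power_add
      by (simp add: power_divide field_simps)
    from cmp[OF this] show ?thesis by simp
  qed
  have "M * ?d = n * D"
  proof (rule ccontr)
    assume "M * ?d \<noteq> n * D"
    then consider "M * ?d \<ge> n * D + 1" | "n * D \<ge> M * ?d + 1" by linarith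
    then show False
    proof cases
      case 1
      then have "(n * D + 1) * (C1 * ?d + 1) \<le> (M * ?d) * (C1 * ?d + 1)" by (rule mult_right_mono) simp
      then show False using le1[of "C1 * ?d + 1"] by (simp add: algebra_simps)
    next
      case 2
      then have "(M * ?d + 1) * (C2 * ?d + 1) \<le> (n * D) * (C2 * ?d + 1)" by (rule mult_right_mono) simp
      then show False using le2[of "C2 * ?d + 1"] by (simp add: algebra_simps)
    qed
  qed
  then have "real M * real ?d = real n * real D" by (metis of_nat_mult)
  then have "real ?d * (real M / real n) = real D" using np by (simp add: field_simps)
  moreover have "absv ?z ^ ?d = exp (real ?d * - (real M / real n))"
    unfolding absv_slope[OF sl] M by (simp flip: exp_of_nat_mult)
  ultimately show ?thesis by simp
qed

end

theorem intersection_branches: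
  fixes f g :: "'a::field pseries"
  assumes f: "branch_data f P a" and g: "branch_data g Q b" and ndvd: "\<not> f dvd g"
  obtains n where "intersection f g = enat n" "exp (- real n) = absv (ev Q a) ^ degree P" "ev Q a \<noteq> 0"
proof -
  obtain u where u: "u dvd 1" "f = u * fps_of_poly P" using f by (auto simp: branch_data_def)
  obtain v where v: "v dvd 1" "g = v * fps_of_poly Q" using g by (auto simp: branch_data_def)
  have P: "weierstrass P" "min_poly_of P a" using f by (auto simp: branch_data_def)
  have nd: "\<not> fps_of_poly P dvd fps_of_poly Q"
    using ndvd u v unit_mult_dvd[OF u(1)] dvd_unit_mult[OF v(1)] by metis
  then have nz: "ev_branch P a (fps_of_poly Q) \<noteq> 0" by (simp add: ev_branch_eq_0_iff[OF P])
  then obtain n where n: "codim (ideal2 (fps_of_poly P) (fps_of_poly Q)) n"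
    by (rule codim_branch_exists[OF P])
  have "intersection f g = quotient_dim (ideal2 (fps_of_poly P) (fps_of_poly Q))"
    using u v by (simp add: intersection_def ideal2_unit)
  also have "\<dots> = enat n" by (rule quotient_dim_codim[OF k_subspace_ideal2 n])
  finally show ?thesis using that codim_eq_absv[OF P nz n] nz by (simp add: ev_branch_poly[OF P])
qed

lemma intersection_varX:
  assumes f: "branch_data f P a" shows "intersection varX f = enat (degree P)"
proof -
  obtain u where u: "u dvd 1" "f = u * fps_of_poly P" using f by (auto simp: branch_data_def)
  have P: "weierstrass P" using f by (auto simp: branch_data_def)
  have "ideal2 varX f = ideal2 (u * fps_of_poly P) (1 * varX)" using u ideal2_commute by simp
  also have "\<dots> = ideal2 (fps_of_poly P) varX" by (rule ideal2_unit) (use u in auto)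
  finally show ?thesis
    unfolding intersection_def
    using quotient_dim_codim[OF k_subspace_ideal2 codim_weierstrass_varX[OF P]] by simp
qed

lemma intersection_unit: "u dvd 1 \<Longrightarrow> v dvd 1 \<Longrightarrow> intersection (u * f) (v * g) = intersection f g"
  by (simp add: intersection_def ideal2_unit)

section \<open>Semivaluations and multiplicative seminorms\<close>

lemma semivaluationD:
  assumes "semivaluation \<nu>"
  shows "\<nu> (f * g) = \<nu> f + \<nu> g" "min (\<nu> f) (\<nu> g) \<le> \<nu> (f + g)" "\<nu> 0 = \<infinity>"
    "c \<noteq> 0 \<Longrightarrow> \<nu> (cnst c) = 0"
  using assms by (auto simp: semivaluation_def)

lemma semivaluation_1: "semivaluation \<nu> \<Longrightarrow> \<nu> 1 = 0"
  using semivaluationD(4)[of \<nu> 1] by simp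

lemma semivaluation_unit:
  assumes "semivaluation \<nu>" "u dvd 1" shows "\<nu> u = 0"
proof -
  obtain v where "1 = u * v" using assms(2) by (rule dvdE)
  then have "\<nu> u + \<nu> v = 0" using semivaluationD(1)[OF assms(1)] semivaluation_1[OF assms(1)] by metis
  then show ?thesis by simp
qed

lemma semivaluation_unit_mult: "semivaluation \<nu> \<Longrightarrow> u dvd 1 \<Longrightarrow> \<nu> (u * f) = \<nu> f"
  by (simp add: semivaluationD(1) semivaluation_unit)

lemma semivaluation_power: "semivaluation \<nu> \<Longrightarrow> \<nu> (f ^ n) = of_nat n * \<nu> f"
  by (induction n) (auto simp: semivaluation_1 semivaluationD(1) distrib_right)

lemma semivaluation_sum_pos:
  "semivaluation \<nu> \<Longrightarrow> \<nu> f > 0 \<Longrightarrow> \<nu> g > 0 \<Longrightarrow> \<nu> (f + g) > 0"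
  using semivaluationD(2)[of \<nu> f g] by (metis less_le_trans min_less_iff_conj)

lemma semivaluation_mult_pos: "semivaluation \<nu> \<Longrightarrow> \<nu> f > 0 \<Longrightarrow> \<nu> (f * g) > 0"
  by (simp add: semivaluationD(1) add_pos_nonneg)

definition valuation_of :: "('a::field pseries \<Rightarrow> real) \<Rightarrow> real \<Rightarrow> 'a pseries \<Rightarrow> ennreal" where
  "valuation_of N t = (\<lambda>g. if N g = 0 then \<infinity> else ennreal (t * - ln (N g)))"

lemma semivaluation_valuation_of:
  assumes mult: "\<And>f g. N (f * g) = N f * N g" and add: "\<And>f g. N (f + g) \<le> max (N f) (N g)"
    and N: "\<And>f. 0 \<le> N f" "\<And>f. N f \<le> 1" "N 0 = 0" "\<And>c. c \<noteq> 0 \<Longrightarrow> N (cnst c) = 1" and t: "t > 0"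
  shows "semivaluation (valuation_of N t)"
  unfolding semivaluation_def
proof (intro conjI allI impI)
  have pos: "N f > 0" if "N f \<noteq> 0" for f using N(1)[of f] that by simp
  fix f g
  show "valuation_of N t (f * g) = valuation_of N t f + valuation_of N t g"
  proof (cases "N f = 0 \<or> N g = 0")
    case False
    then have p: "N f > 0" "N g > 0" using pos by auto
    have "ennreal (t * - ln (N f)) + ennreal (t * - ln (N g)) = ennreal (t * - ln (N f) + t * - ln (N g))"
      using t p N(2)[of f] N(2)[of g] by (intro ennreal_plus[symmetric] mult_nonneg_nonneg) auto
    then show ?thesis using False p by (simp add: valuation_of_def mult ln_mult algebra_simps)
  qed (auto simp: valuation_of_def mult)
  show "min (valuation_of N t f) (valuation_of N t g) \<le> valuation_of N t (f + g)"
  proof (cases "N (f + g) = 0")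
    case False
    have main: "valuation_of N t h \<le> valuation_of N t (f + g)" if "N (f + g) \<le> N h" for h
    proof -
      have "N h > 0" using that pos[OF False] by simp
      then have "ln (N (f + g)) \<le> ln (N h)" using that pos[OF False] by simp
      then show ?thesis using False \<open>N h > 0\<close> t by (auto simp: valuation_of_def intro!: ennreal_leI)
    qed
    show ?thesis using add[of f g] main[of f] main[of g]
      by (metis max_def min.coboundedI1 min.coboundedI2)
  qed (simp add: valuation_of_def)
  show "valuation_of N t 0 = \<infinity>" using N(3) by (simp add: valuation_of_def)
  fix c :: 'a assume "c \<noteq> 0"
  then show "valuation_of N t (cnst c) = 0" using N(4) by (simp add: valuation_of_def)
qed

lemma enn2real_add_finite:
  assumes "a \<noteq> \<infinity>" "b \<noteq> \<infinity>" shows "enn2real (a + b) = enn2real a + enn2real b"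
proof -
  obtain x y where "a = ennreal x" "0 \<le> x" "b = ennreal y" "0 \<le> y"
    using assms by (metis ennreal_cases infinity_ennreal_def)
  then show ?thesis by (simp flip: ennreal_plus)
qed

text \<open>The division by \<open>\<nu> X\<close> normalises the value of \<open>X\<close>.\<close>

definition norm_of :: "('a::field pseries \<Rightarrow> ennreal) \<Rightarrow> 'a fps poly \<Rightarrow> real" where
  "norm_of \<nu> p = (if \<nu> (fps_of_poly p) = \<infinity> then 0
     else exp (- (enn2real (\<nu> (fps_of_poly p)) / enn2real (\<nu> varX))))"

lemma poly_seminorm_norm_of:
  assumes \<nu>: "semivaluation \<nu>" and X: "0 < \<nu> varX" "\<nu> varX < \<infinity>"
  shows "poly_seminorm (norm_of \<nu>)"
  unfolding poly_seminorm_def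
proof (intro conjI allI)
  define t where "t = enn2real (\<nu> varX)"
  have t: "t > 0" using X by (simp add: t_def enn2real_positive_iff)
  fix p q
  show "norm_of \<nu> (p * q) = norm_of \<nu> p * norm_of \<nu> q"
    by (simp add: norm_of_def fps_of_poly_mult semivaluationD(1)[OF \<nu>] enn2real_add_finite
        add_divide_distrib exp_add[symmetric])
  show "norm_of \<nu> (p + q) \<le> max (norm_of \<nu> p) (norm_of \<nu> q)"
  proof (cases "\<nu> (fps_of_poly (p + q)) = \<infinity>")
    case False
    have main: "norm_of \<nu> (p + q) \<le> norm_of \<nu> h"
      if le: "\<nu> (fps_of_poly h) \<le> \<nu> (fps_of_poly (p + q))" for h
    proof -
      have "\<nu> (fps_of_poly h) \<noteq> \<infinity>" using le False by (auto simp: top_unique)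
      moreover have "enn2real (\<nu> (fps_of_poly h)) \<le> enn2real (\<nu> (fps_of_poly (p + q)))"
        using le False by (intro enn2real_mono) (auto simp: less_top)
      ultimately show ?thesis using False t unfolding norm_of_def t_def[symmetric]
        by (simp add: divide_right_mono)
    qed
    show ?thesis
      using semivaluationD(2)[OF \<nu>, of "fps_of_poly p" "fps_of_poly q"] main[of p] main[of q]
      unfolding fps_of_poly_add[symmetric] by (metis max.coboundedI1 max.coboundedI2 min_def)
  qed (simp add: norm_of_def le_max_iff_disj)
  show "0 \<le> norm_of \<nu> p" by (simp add: norm_of_def)
  show "norm_of \<nu> [:0, 1:] \<le> 1" using t by (simp add: norm_of_def t_def)
  fix c
  show "norm_of \<nu> [:c:] = absv (emb c)"
  proof (cases "c = 0")
    case False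
    obtain u where u: "c = fps_X ^ subdegree c * u" "fps_nth u 0 \<noteq> 0"
      using False by (rule fps_unit_decompose)
    have "fps_of_poly [:c:] = fps_const (fps_X ^ subdegree c * u)"
      unfolding fps_of_poly_const by (rule arg_cong[OF u(1)])
    also have "\<dots> = varX ^ subdegree c * fps_const u"
      by (simp add: varX_def fps_const_power flip: fps_const_mult)
    finally have c: "fps_of_poly [:c:] = varX ^ subdegree c * fps_const u" .
    have "fps_const u dvd 1" using u(2) by (simp add: pseries_unit_iff cf_def)
    then have "\<nu> (fps_of_poly [:c:]) = of_nat (subdegree c) * \<nu> varX"
      unfolding c by (simp add: semivaluationD(1)[OF \<nu>] semivaluation_power[OF \<nu>] semivaluation_unit[OF \<nu>])
    also have "\<dots> = ennreal (real (subdegree c) * t)"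
      using X t by (simp add: t_def ennreal_mult ennreal_of_nat_eq_real_of_nat)
    finally have "norm_of \<nu> [:c:] = exp (- (real (subdegree c) * t / t))"
      using t by (simp add: norm_of_def t_def)
    then show ?thesis using t False by (simp add: absv_emb)
  qed (simp add: norm_of_def semivaluationD(3)[OF \<nu>])
qed

section \<open>Disc valuations\<close>

text \<open>A seminorm of \<open>k[[X]][Y]\<close> with \<open>|Y| < 1\<close> extends to power series by continuity. The maximum
  with \<open>|Y|\<^sup>n\<close> makes the norms of the truncations a decreasing sequence.\<close>

context
  fixes M :: "'a::field fps poly \<Rightarrow> real"
  assumes M: "poly_seminorm M" and Y: "M [:0, 1:] < 1"
begin

definition trunc :: "nat \<Rightarrow> 'a pseries \<Rightarrow> 'a fps poly" where
  "trunc n g = (\<Sum>j<n. monom (fps_nth g j) j)"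

definition trunc_norm :: "nat \<Rightarrow> 'a pseries \<Rightarrow> real" where
  "trunc_norm n g = max (M (trunc n g)) (M [:0, 1:] ^ n)"

definition ext_norm :: "'a pseries \<Rightarrow> real" where
  "ext_norm g = (INF n. trunc_norm n g)"

lemma coeff_trunc: "coeff (trunc n g) j = (if j < n then fps_nth g j else 0)"
  by (simp add: trunc_def coeff_sum)

lemma poly_seminorm_le_1: "M p \<le> 1"
  by (rule poly_seminorm_bound[OF M]) (auto simp: absv_emb_le_1)

lemma poly_seminorm_monom_dvd:
  assumes "\<And>j. j < n \<Longrightarrow> coeff p j = 0" shows "M p \<le> M [:0, 1:] ^ n"
proof -
  have "monom 1 n dvd p" using assms by (simp add: monom_1_dvd_iff')
  then obtain q where q: "p = monom 1 n * q" by (rule dvdE)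
  have "monom 1 n = ([:0, 1:] :: 'a fps poly) ^ n" by (simp add: monom_altdef)
  then have "M p = M [:0, 1:] ^ n * M q"
    unfolding q by (simp only: poly_seminorm_simps(1,8)[OF M])
  also have "\<dots> \<le> M [:0, 1:] ^ n * 1"
    using poly_seminorm_le_1 poly_seminorm_simps(3)[OF M] by (intro mult_left_mono) auto
  finally show ?thesis by simp
qed

lemma trunc_norm_nonneg: "0 \<le> trunc_norm n g"
  using poly_seminorm_simps(3)[OF M] by (simp add: trunc_norm_def le_max_iff_disj)

lemma trunc_norm_tendsto: "(\<lambda>n. trunc_norm n g) \<longlonglongrightarrow> ext_norm g"
  unfolding ext_norm_def
proof (rule LIMSEQ_decseq_INF)
  show "bdd_below (range (\<lambda>n. trunc_norm n g))"
    by (rule bdd_belowI[of _ 0]) (auto simp: trunc_norm_nonneg)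
  show "decseq (\<lambda>n. trunc_norm n g)"
  proof (rule decseq_SucI)
    fix n
    have "trunc (Suc n) g = trunc n g + monom (fps_nth g n) n" by (simp add: trunc_def)
    then have "M (trunc (Suc n) g) \<le> max (M (trunc n g)) (M (monom (fps_nth g n) n))"
      using poly_seminorm_simps(2)[OF M] by simp
    moreover have "M (monom (fps_nth g n) n) \<le> M [:0, 1:] ^ n" by (rule poly_seminorm_monom_dvd) simp
    moreover have "M [:0, 1:] ^ Suc n \<le> M [:0, 1:] ^ n"
      using Y poly_seminorm_simps(3)[OF M] by (intro power_decreasing) auto
    ultimately show "trunc_norm (Suc n) g \<le> trunc_norm n g" by (auto simp: trunc_norm_def)
  qed
qed

lemma Y_power_tendsto: "(\<lambda>n. M [:0, 1:] ^ n) \<longlonglongrightarrow> 0"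
  using Y poly_seminorm_simps(3)[OF M] by (intro LIMSEQ_realpow_zero) auto

lemma ext_norm_nonneg: "0 \<le> ext_norm g"
  by (rule LIMSEQ_le_const[OF trunc_norm_tendsto]) (auto simp: trunc_norm_nonneg)

lemma ext_norm_le_1: "ext_norm g \<le> 1"
proof (rule LIMSEQ_le_const2[OF trunc_norm_tendsto])
  have "M [:0, 1:] ^ n \<le> 1" for n using Y poly_seminorm_simps(3)[OF M] by (intro power_le_one) auto
  then show "\<exists>N. \<forall>n\<ge>N. trunc_norm n g \<le> 1" by (auto simp: trunc_norm_def poly_seminorm_le_1)
qed

lemma ext_norm_poly: "ext_norm (fps_of_poly p) = M p"
proof (rule LIMSEQ_unique[OF trunc_norm_tendsto])
  have "trunc n (fps_of_poly p) = p" if "n > degree p" for n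
    using that by (intro poly_eqI) (auto simp: coeff_trunc coeff_eq_0)
  then have "\<forall>\<^sub>F n in sequentially. max (M p) (M [:0, 1:] ^ n) = trunc_norm n (fps_of_poly p)"
    unfolding eventually_sequentially by (intro exI[of _ "Suc (degree p)"]) (auto simp: trunc_norm_def)
  moreover have "(\<lambda>n. max (M p) (M [:0, 1:] ^ n)) \<longlonglongrightarrow> max (M p) 0"
    by (intro tendsto_max tendsto_const Y_power_tendsto)
  ultimately show "(\<lambda>n. trunc_norm n (fps_of_poly p)) \<longlonglongrightarrow> M p"
    using poly_seminorm_simps(3)[OF M, of p] by (simp add: tendsto_cong max_absorb1)
qed

lemma ext_norm_add: "ext_norm (g + h) \<le> max (ext_norm g) (ext_norm h)"
proof (rule LIMSEQ_le[OF trunc_norm_tendsto tendsto_max[OF trunc_norm_tendsto trunc_norm_tendsto]])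
  have "trunc n (g + h) = trunc n g + trunc n h" for n by (rule poly_eqI) (simp add: coeff_trunc)
  then have "trunc_norm n (g + h) \<le> max (trunc_norm n g) (trunc_norm n h)" for n
    using poly_seminorm_simps(2)[OF M, of "trunc n g" "trunc n h"] by (auto simp: trunc_norm_def)
  then show "\<exists>N. \<forall>n\<ge>N. trunc_norm n (g + h) \<le> max (trunc_norm n g) (trunc_norm n h)" by blast
qed

lemma ext_norm_mult: "ext_norm (g * h) = ext_norm g * ext_norm h"
proof -
  let ?t = "\<lambda>n. M [:0, 1:] ^ n" and ?a = "\<lambda>n. M (trunc n g)" and ?b = "\<lambda>n. M (trunc n h)"
  note lims = trunc_norm_tendsto[of g] trunc_norm_tendsto[of h] trunc_norm_tendsto[of "g * h"]
  have bounds: "0 \<le> ?a n" "?a n \<le> 1" "0 \<le> ?b n" "?b n \<le> 1" "0 \<le> ?t n" "?t n \<le> 1" for n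
    using Y poly_seminorm_simps(3)[OF M] poly_seminorm_le_1 by (auto intro: power_le_one)
  have "coeff (trunc n g * trunc n h) j = coeff (trunc n (g * h)) j" if "j < n" for n j
    using that by (auto simp: coeff_mult coeff_trunc fps_mult_nth atLeast0AtMost intro!: sum.cong)
  then have diff: "M (trunc n (g * h) - trunc n g * trunc n h) \<le> ?t n" for n
    by (intro poly_seminorm_monom_dvd) simp
  have up: "trunc_norm n (g * h) \<le> trunc_norm n g * trunc_norm n h + ?t n" for n
  proof -
    have "M (trunc n (g * h)) \<le> max (M (trunc n (g * h) - trunc n g * trunc n h)) (M (trunc n g * trunc n h))"
      using poly_seminorm_simps(2)[OF M, of "trunc n (g * h) - trunc n g * trunc n h" "trunc n g * trunc n h"] by simp
    then have "M (trunc n (g * h)) \<le> max (?t n) (?a n * ?b n)"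
      using diff[of n] by (auto simp: poly_seminorm_simps(1)[OF M])
    moreover have "?a n * ?b n \<le> trunc_norm n g * trunc_norm n h"
      using bounds by (intro mult_mono) (auto simp: trunc_norm_def le_max_iff_disj)
    moreover have "0 \<le> trunc_norm n g * trunc_norm n h" by (simp add: trunc_norm_nonneg)
    ultimately show ?thesis using bounds[of n] by (auto simp: trunc_norm_def[of n "g * h"])
  qed
  have low: "trunc_norm n g * trunc_norm n h \<le> trunc_norm n (g * h)" for n
  proof -
    have "M (trunc n g * trunc n h) \<le> max (M (trunc n (g * h))) (M (trunc n (g * h) - trunc n g * trunc n h))"
      using poly_seminorm_simps(7)[OF M, of "trunc n (g * h)" "trunc n (g * h) - trunc n g * trunc n h"] by simp
    then have ab: "?a n * ?b n \<le> trunc_norm n (g * h)"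
      using diff[of n] by (auto simp: trunc_norm_def poly_seminorm_simps(1)[OF M])
    have "max x t * max y t \<le> max (x * y) t"
      if "0 \<le> x" "x \<le> 1" "0 \<le> y" "y \<le> 1" "0 \<le> t" "t \<le> 1" for x y t :: real
    proof -
      have "t * max y t \<le> t * 1" "max x t * t \<le> 1 * t"
        using that mult_left_mono[of "max y t" 1 t] mult_right_mono[of "max x t" 1 t] by auto
      then show ?thesis
        by (cases "x \<le> t"; cases "y \<le> t") (auto simp: max_def split: if_splits)
    qed
    from this[OF bounds[of n]]
    have "trunc_norm n g * trunc_norm n h \<le> max (?a n * ?b n) (?t n)"
      by (simp only: trunc_norm_def)
    also have "\<dots> \<le> trunc_norm n (g * h)" using ab by (simp add: trunc_norm_def[of n "g * h"])
    finally show ?thesis .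
  qed
  have "(\<lambda>n. trunc_norm n g * trunc_norm n h + ?t n) \<longlonglongrightarrow> ext_norm g * ext_norm h + 0"
    by (intro tendsto_add tendsto_mult lims Y_power_tendsto)
  then have "ext_norm (g * h) \<le> ext_norm g * ext_norm h + 0"
    by (rule LIMSEQ_le[OF lims(3)]) (use up in blast)
  moreover have "ext_norm g * ext_norm h \<le> ext_norm (g * h)"
    by (rule LIMSEQ_le[OF tendsto_mult[OF lims(1,2)] lims(3)]) (use low in blast)
  ultimately show ?thesis by simp
qed

lemma poly_seminorm_extends:
  obtains \<nu> where "semivaluation \<nu>" "\<And>p. M p \<noteq> 0 \<Longrightarrow> \<nu> (fps_of_poly p) = ennreal (- ln (M p))"
proof
  show "semivaluation (valuation_of ext_norm 1)"
  proof (rule semivaluation_valuation_of)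
    show "ext_norm 0 = 0" using ext_norm_poly[of 0] poly_seminorm_simps(9)[OF M] by simp
    fix c :: 'a assume "c \<noteq> 0"
    then show "ext_norm (cnst c) = 1"
      using ext_norm_poly[of "[:fps_const c:]"] absv_emb_unit[of "fps_const c"]
      by (simp add: cnst_def fps_of_poly_const poly_seminorm_simps(4)[OF M])
  qed (auto simp: ext_norm_mult ext_norm_add ext_norm_nonneg ext_norm_le_1)
  fix p assume "M p \<noteq> 0"
  then show "valuation_of ext_norm 1 (fps_of_poly p) = ennreal (- ln (M p))"
    by (simp add: valuation_of_def ext_norm_poly)
qed

end

lemma poly_seminorm_disc_norm:
  assumes \<rho>: "0 < \<rho>" "\<rho> \<le> 1" and a: "absv a \<le> 1"
  shows "poly_seminorm (disc_norm a \<rho>)"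
proof -
  have "taylor a [:0, 1:] = [:a, 1:]" by (simp add: taylor_def pcompose_pCons)
  then have "disc_norm a \<rho> [:0, 1:] \<le> 1" using \<rho> a by (simp add: disc_norm_def gauss_linear[OF \<rho>(1)])
  then show ?thesis
    unfolding poly_seminorm_def
    by (simp add: disc_norm_mult[OF \<rho>(1)] disc_norm_add[OF \<rho>(1)] disc_norm_nonneg[OF \<rho>(1)])
       (simp add: disc_norm_def gauss_const[OF \<rho>(1)])
qed

lemma disc_norm_lt_1:
  assumes \<rho>: "0 < \<rho>" "\<rho> < 1" and W: "min_poly_of W b" and a: "absv a < 1"
    and small: "\<And>x. x \<in># roots W \<Longrightarrow> absv x < 1"
  shows "0 < disc_norm a \<rho> W" "disc_norm a \<rho> W < 1"
proof -
  have bd: "0 < max (absv (a - x)) \<rho> \<and> max (absv (a - x)) \<rho> < 1" if "x \<in># roots W" for x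
    using \<rho> absv_diff[of a x] a small[OF that] by (auto simp: less_max_iff_disj)
  moreover have "(\<Prod>x\<in>#roots W. max (absv (a - x)) \<rho>) < (\<Prod>x\<in>#roots W. 1)"
    using bd min_poly_in_roots[OF W]
    by (intro prod_mset_mono_strict[OF _ min_poly_in_roots[OF W]]) (meson less_imp_le)+
  ultimately show "disc_norm a \<rho> W < 1" by (simp add: disc_norm_min_poly[OF W \<rho>(1)])
  show "0 < disc_norm a \<rho> W"
    unfolding disc_norm_def by (rule gauss_norm_pos[OF \<rho>(1)]) (simp add: min_poly_nonzero[OF W])
qed

text \<open>The norm of a second branch on a disc. If the disc reaches exactly the point where the two
  branches separate, the three-branch relation leaves the value open, and shrinking the disc
  decides.\<close>

lemma disc_norm_second_branch:
  fixes V W :: "'a::alg_closed_field fps poly"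
  assumes \<rho>: "0 < \<rho>" "\<rho> < 1" and V: "min_poly_of V a" and W: "min_poly_of W b" and nz: "ev W a \<noteq> 0"
    and small: "\<And>x. x \<in># roots V \<Longrightarrow> absv x < 1" "\<And>x. x \<in># roots W \<Longrightarrow> absv x < 1"
  shows "disc_norm a \<rho> W ^ degree V = max (disc_norm a \<rho> V ^ degree W) (absv (ev W a) ^ degree V)"
proof -
  let ?p = "\<lambda>\<rho>. disc_norm a \<rho> V ^ degree W" and ?q = "\<lambda>\<rho>. disc_norm a \<rho> W ^ degree V"
  let ?r = "absv (ev W a) ^ degree V"
  have a: "absv a < 1" using small(1) min_poly_in_roots[OF V] by blast
  have rel: "(?p s \<le> ?q s \<and> ?q s = ?r) \<or> (?q s \<le> ?p s \<and> ?p s = ?r) \<or> (?p s = ?q s \<and> ?r \<le> ?p s)"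
    if s: "0 < s" "s < 1" for s
    using s a disc_norm_lt_1[OF s V a small(1)] disc_norm_lt_1[OF s W a small(2)]
    by (intro three_branches_poly[OF poly_seminorm_disc_norm V W nz small]) auto
  consider "?q \<rho> = max (?p \<rho>) ?r" | "?q \<rho> \<le> ?p \<rho>" "?p \<rho> = ?r" using rel[OF \<rho>] by (auto simp: max_def)
  then show ?thesis
  proof cases
    case 2
    let ?s = "\<rho> / 2"
    have s: "0 < ?s" "?s < 1" "?s < \<rho>" using \<rho> by auto
    have dW: "degree W > 0"
      using min_poly_in_roots[OF W] size_roots[OF min_poly_nonzero[OF W]] by (metis empty_iff gr0I set_mset_empty size_eq_0_iff_empty)
    have "disc_norm a ?s V < disc_norm a \<rho> V" by (rule disc_norm_strict_mono[OF V s(1,3)])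
    then have "?p ?s < ?r"
      unfolding 2(2)[symmetric] using disc_norm_nonneg[OF s(1), of a V] dW by (intro power_strict_mono) auto
    then have "?r = ?q ?s" using rel[OF s(1,2)] by auto
    also have "\<dots> \<le> ?q \<rho>"
      using s disc_norm_nonneg[OF s(1), of a W] by (intro power_mono disc_norm_mono_radius) auto
    finally show ?thesis using 2 by simp
  qed
qed


section \<open>Changes of coordinates\<close>

definition automorphism_pair ::
    "('a::field pseries \<Rightarrow> 'a pseries) \<Rightarrow> ('a pseries \<Rightarrow> 'a pseries) \<Rightarrow> bool" where
  "automorphism_pair F G \<longleftrightarrow> endo F \<and> endo G \<and> (\<forall>f. F (G f) = f) \<and> (\<forall>f. G (F f) = f)"

lemma endo_unit: "endo F \<Longrightarrow> u dvd 1 \<Longrightarrow> F u dvd 1"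
  by (metis dvd_def endo_simps(2,5))

text \<open>The induction of \<open>endo_eqI\<close> only pulls out factors \<open>X\<close> here, so the image of \<open>Y\<close> may be
  arbitrary.\<close>

lemma endo_fixes_X_series:
  assumes F: "endo F" "F varX = varX" shows "F (fps_const s) = fps_const s"
proof -
  have "order_ge n (F (fps_const s) - fps_const s)" for n
  proof (induction n arbitrary: s)
    case (Suc n)
    have "s = fps_const (fps_nth s 0) + fps_X * fps_shift 1 s"
      by (rule fps_ext) (simp add: fps_X_mult_nth)
    then have "fps_const s = fps_const (fps_const (fps_nth s 0) + fps_X * fps_shift 1 s)"
      by (rule arg_cong)
    also have "\<dots> = cnst (fps_nth s 0) + varX * fps_const (fps_shift 1 s)"
      by (simp add: cnst_def varX_def flip: fps_const_add fps_const_mult)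
    finally have s: "fps_const s = cnst (fps_nth s 0) + varX * fps_const (fps_shift 1 s)" .
    have "F (fps_const s) - fps_const s =
        varX * (F (fps_const (fps_shift 1 s)) - fps_const (fps_shift 1 s))"
      by (subst s, subst s) (simp add: endo_simps[OF F(1)] F(2) algebra_simps)
    then show ?case using order_ge_mult[OF order_ge_varX Suc] by simp
  qed simp
  then show ?thesis using order_ge_imp_zero by (metis right_minus_eq)
qed

definition swap_vars :: "'a::field pseries \<Rightarrow> 'a pseries" where
  "swap_vars f = subst2 f varY varX"

definition shear :: "'a::field fps \<Rightarrow> 'a pseries \<Rightarrow> 'a pseries" where
  "shear s f = subst2 f varX (varY + fps_const s)"

lemma swap_vars:
  shows endo_swap_vars: "endo swap_vars" and swap_vars_X: "swap_vars varX = varY"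
    and swap_vars_Y: "swap_vars varY = varX"
  unfolding swap_vars_def
  by (rule endo_subst2 subst2_varX subst2_varY; rule order_ge_varX order_ge_varY)+

lemma swap_vars_involution: "swap_vars (swap_vars f) = f"
proof -
  have "endo (\<lambda>f::'a pseries. f)" by (simp add: endo_def)
  then show ?thesis
    using endo_eqI[OF endo_comp[OF endo_swap_vars endo_swap_vars], of "\<lambda>f. f" f]
    by (simp add: swap_vars_X swap_vars_Y order_ge_varX order_ge_varY del: One_nat_def)
qed

context
  fixes s :: "'a::field fps" assumes s: "fps_nth s 0 = 0"
begin

lemma order_ge_shear: "order_ge 1 (varY + fps_const s)"
proof -
  have "cf (varY + fps_const s) 0 0 = 0" unfolding cf_add using s by (simp add: cf_varY) (simp add: cf_def)
  then show ?thesis by (simp only: order_ge_1_iff)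
qed

lemma shear:
  shows endo_shear: "endo (shear s)" and shear_X: "shear s varX = varX"
    and shear_Y: "shear s varY = varY + fps_const s"
  unfolding shear_def
  by (rule endo_subst2 subst2_varX subst2_varY; rule order_ge_varX order_ge_shear)+

end

lemma shear_inverse:
  assumes s: "fps_nth s 0 = 0" shows "shear s (shear (- s) f) = f"
proof -
  have s': "fps_nth (- s) 0 = 0" using s by simp
  have id: "endo (\<lambda>f::'a pseries. f)" by (simp add: endo_def)
  have "shear s (fps_const s) = fps_const s"
    by (rule endo_fixes_X_series[OF endo_shear[OF s] shear_X[OF s]])
  then have "shear s (fps_const (- s)) = - fps_const s"
    using endo_simps(6)[OF endo_shear[OF s], of "fps_const s"] by simp
  then have "shear s (shear (- s) varY) = varY"
    by (simp add: shear_Y[OF s'] shear_Y[OF s] endo_simps(1)[OF endo_shear[OF s]] del: fps_const_neg)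
  moreover have "shear s (shear (- s) varX) = varX" by (simp add: shear_X[OF s] shear_X[OF s'])
  ultimately show ?thesis
    using endo_eqI[OF endo_comp[OF endo_shear[OF s] endo_shear[OF s']] id, of f]
    by (simp add: order_ge_varX order_ge_varY del: One_nat_def)
qed

text \<open>By Weierstrass preparation \<open>f\<close> is \<open>Y + s(X)\<close> up to a unit. The shear \<open>Y \<mapsto> Y - s(X)\<close> followed
  by the exchange of the variables moves it to \<open>X\<close>.\<close>

lemma straighten_Y:
  fixes f :: "'a::field pseries"
  assumes "cf f 0 0 = 0" "cf f 0 1 \<noteq> 0"
  obtains F G u where "automorphism_pair F G" "u dvd 1" "F f = u * varX"
proof -
  obtain u W where W: "u dvd 1" "f = u * fps_of_poly W" "weierstrass W" "degree W = 1"
    by (rule weierstrass_preparation[of 1 f]) (use assms in auto)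
  define s where "s = coeff W 0"
  have s: "fps_nth s 0 = 0" using W by (simp add: weierstrass_def s_def)
  then have s': "fps_nth (- s) 0 = 0" by simp
  have "W = [:s, 1:]"
  proof (rule poly_eqI)
    fix i show "coeff W i = coeff [:s, 1:] i"
      using W(3,4) by (cases i; cases "i - 1") (auto simp: s_def weierstrass_def coeff_eq_0 coeff_pCons split: nat.split)
  qed
  then have fW: "fps_of_poly W = fps_const s + varY"
    by (simp add: fps_of_poly_pCons varY_def)
  let ?F = "\<lambda>f. swap_vars (shear (- s) f)" and ?G = "\<lambda>f. shear s (swap_vars f)"
  have "?F (?G f) = f" "?G (?F f) = f" for f
    using shear_inverse[OF s] shear_inverse[OF s'] by (simp_all add: swap_vars_involution)
  moreover have "endo ?F" by (rule endo_comp[OF endo_swap_vars endo_shear[OF s']])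
  moreover have "endo ?G" by (rule endo_comp[OF endo_shear[OF s] endo_swap_vars])
  ultimately have pair: "automorphism_pair ?F ?G" unfolding automorphism_pair_def by blast
  have F: "endo ?F" using pair by (simp add: automorphism_pair_def)
  have "shear (- s) (fps_const s) = fps_const s"
    by (rule endo_fixes_X_series[OF endo_shear[OF s'] shear_X[OF s']])
  then have "shear (- s) (fps_of_poly W) = varY"
    by (simp add: fW endo_simps(1)[OF endo_shear[OF s']] shear_Y[OF s'])
  then have "?F f = ?F u * varX"
    by (simp add: W(2) endo_simps(2)[OF endo_shear[OF s']] endo_simps(2)[OF endo_swap_vars] swap_vars_Y)
  then show ?thesis using that[OF pair endo_unit[OF F W(1)]] by blast
qed

text \<open>After an exchange of the variables, if necessary, the equation has a linear term in \<open>Y\<close>.\<close>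

theorem straighten_smooth:
  fixes f :: "'a::field pseries"
  assumes "f \<noteq> 0" "mult f = 1"
  obtains F G u where "automorphism_pair F G" "u dvd 1" "F f = u * varX"
proof -
  have lin: "cf f 0 0 = 0" "cf f 1 0 \<noteq> 0 \<or> cf f 0 1 \<noteq> 0"
    using iffD1[OF mult_eq_1_nonzero_linear[OF assms(1)] assms(2)] by auto
  show ?thesis
  proof (cases "cf f 0 1 = 0")
    case False
    then show ?thesis using straighten_Y[of f] lin that by blast
  next
    case True
    obtain f1 f2 where "f = cnst (cf f 0 0) + varX * f1 + varY * f2"
      using pseries_split[of f] by metis
    then have f: "f = varX * f1 + varY * f2" using lin by simp
    have c10: "cf f1 0 0 = cf f 1 0" by (subst f) (simp add: cf_varX_mult cf_varY_mult)
    have sf: "swap_vars f = varY * swap_vars f1 + varX * swap_vars f2"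
      by (subst f) (simp add: endo_simps[OF endo_swap_vars] swap_vars_X swap_vars_Y)
    have loc: "cf (swap_vars h) 0 0 = cf h 0 0" for h :: "'a pseries"
    proof -
      obtain h1 h2 where h: "h = cnst (cf h 0 0) + varX * h1 + varY * h2"
        using pseries_split[of h] by metis
      have "swap_vars h = cnst (cf h 0 0) + varY * swap_vars h1 + varX * swap_vars h2"
        by (subst h) (simp add: endo_simps[OF endo_swap_vars] swap_vars_X swap_vars_Y)
      then show ?thesis by (simp add: cf_cnst cf_varX cf_varY)
    qed
    have "cf (swap_vars f) 0 0 = 0" "cf (swap_vars f) 0 1 \<noteq> 0"
      using True lin c10 loc[of f1] by (simp_all add: sf cf_varX_mult cf_varY_mult cf_varX cf_varY)
    then obtain F G u where FG: "automorphism_pair F G" "u dvd 1" "F (swap_vars f) = u * varX"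
      by (rule straighten_Y)
    have "automorphism_pair (\<lambda>f. F (swap_vars f)) (\<lambda>f. swap_vars (G f))"
      using FG(1) endo_comp[OF _ endo_swap_vars, of F] endo_comp[OF endo_swap_vars, of G]
      unfolding automorphism_pair_def by (simp add: swap_vars_involution)
    then show ?thesis using that FG(2,3) by blast
  qed
qed

context
  fixes F G :: "'a::field pseries \<Rightarrow> 'a pseries"
  assumes pair: "automorphism_pair F G"
begin

lemma automorphism_simps:
  shows "endo F" "endo G" "F (G f) = f" "G (F f) = f"
  using pair by (auto simp: automorphism_pair_def)

lemma automorphism_dvd: "F f dvd F g \<longleftrightarrow> f dvd g"
proof
  assume "F f dvd F g"
  then obtain h where "F g = F f * h" by (rule dvdE)
  then have "G (F g) = G (F f) * G h" by (simp only: endo_simps(2)[OF automorphism_simps(2)])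
  then show "f dvd g" by (simp add: automorphism_simps)
next
  assume "f dvd g"
  then obtain h where "g = f * h" by (rule dvdE)
  then show "F f dvd F g" by (simp add: endo_simps(2)[OF automorphism_simps(1)])
qed

lemma automorphism_unit: "F f dvd 1 \<longleftrightarrow> f dvd 1"
  using automorphism_dvd[of f 1] by (simp add: endo_simps(5)[OF automorphism_simps(1)])

lemma automorphism_irreducible:
  assumes "Factorial_Ring.irreducible f" shows "Factorial_Ring.irreducible (F f)"
proof (rule Factorial_Ring.irreducibleI)
  have f: "f \<noteq> 0" "\<not> f dvd 1" using assms by (auto simp: Factorial_Ring.irreducible_def)
  show "F f \<noteq> 0"
  proof
    assume "F f = 0"
    then have "G (F f) = 0" by (simp add: endo_simps(4)[OF automorphism_simps(2)])
    then show False using f by (simp add: automorphism_simps)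
  qed
  show "\<not> F f dvd 1" using f by (simp add: automorphism_unit)
  fix p q assume "F f = p * q"
  then have "G (F f) = G (p * q)" by simp
  then have "f = G p * G q"
    by (simp only: automorphism_simps(4) endo_simps(2)[OF automorphism_simps(2)])
  then have "G p dvd 1 \<or> G q dvd 1" using assms by (simp add: Factorial_Ring.irreducible_def)
  then show "p dvd 1 \<or> q dvd 1" using automorphism_unit[of "G p"] automorphism_unit[of "G q"]
    by (simp add: automorphism_simps)
qed

lemma automorphism_ideal2: "F p \<in> ideal2 (F f) (F g) \<longleftrightarrow> p \<in> ideal2 f g"
proof
  assume "F p \<in> ideal2 (F f) (F g)"
  then obtain a b where "F p = a * F f + b * F g" by (rule ideal2E)
  then have "G (F p) = G (a * F f + b * F g)" by simp
  then have "p = G a * f + G b * g"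
    by (simp add: endo_simps(1,2)[OF automorphism_simps(2)] automorphism_simps)
  then show "p \<in> ideal2 f g" by (simp only: ideal2I)
next
  assume "p \<in> ideal2 f g"
  then obtain a b where "p = a * f + b * g" by (rule ideal2E)
  then have "F p = F a * F f + F b * F g" by (simp add: endo_simps(1,2)[OF automorphism_simps(1)])
  then show "F p \<in> ideal2 (F f) (F g)" by (simp only: ideal2I)
qed

lemma automorphism_codim: "codim (ideal2 f g) n \<Longrightarrow> codim (ideal2 (F f) (F g)) n"
proof -
  assume "codim (ideal2 f g) n"
  then obtain B where B: "quotient_basis (ideal2 f g) B" "card B = n" by (auto simp: codim_def)
  note Bp = quotient_basisD[OF B(1) k_subspace_ideal2]
  note F = automorphism_simps(1)
  have inj: "inj_on F B" by (rule inj_on_inverseI[of _ G]) (simp add: automorphism_simps)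
  have Fsum: "F (\<Sum>b\<in>B. cnst (c b) * b) = (\<Sum>b\<in>B. cnst (c b) * F b)" for c
    by (induction B rule: infinite_finite_induct) (auto simp: endo_simps[OF F])
  have "quotient_basis (ideal2 (F f) (F g)) (F ` B)"
  proof (rule quotient_basisI[OF k_subspace_ideal2])
    fix p
    obtain c where c: "G p - (\<Sum>b\<in>B. cnst (c b) * b) \<in> ideal2 f g" using Bp(2) by blast
    have "F (G p - (\<Sum>b\<in>B. cnst (c b) * b)) \<in> ideal2 (F f) (F g)"
      using c by (simp only: automorphism_ideal2)
    moreover have "F (G p - (\<Sum>b\<in>B. cnst (c b) * b)) = p - (\<Sum>b\<in>F ` B. cnst (c (G b)) * b)"
      by (simp add: endo_simps(7)[OF F] Fsum sum.reindex[OF inj] automorphism_simps)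
    ultimately show "\<exists>c. p - (\<Sum>b\<in>F ` B. cnst (c b) * b) \<in> ideal2 (F f) (F g)"
      by (intro exI[of _ "\<lambda>b. c (G b)"]) simp
  next
    fix c b assume c: "(\<Sum>b\<in>F ` B. cnst (c b) * b) \<in> ideal2 (F f) (F g)" and b: "b \<in> F ` B"
    have "F (\<Sum>b\<in>B. cnst (c (F b)) * b) \<in> ideal2 (F f) (F g)"
      using c by (simp add: Fsum sum.reindex[OF inj])
    then have "(\<Sum>b\<in>B. cnst (c (F b)) * b) \<in> ideal2 f g" by (simp only: automorphism_ideal2)
    then show "c b = 0" using Bp(3)[of "\<lambda>b. c (F b)"] b by blast
  qed (use Bp(1) in simp)
  then show ?thesis using B(2) card_image[OF inj] by (auto simp: codim_def)
qed

lemma automorphism_semivaluation: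
  assumes "semivaluation \<nu>" shows "semivaluation (\<lambda>f. \<nu> (F f))"
  using semivaluationD[OF assms] unfolding semivaluation_def
  by (simp add: endo_simps[OF automorphism_simps(1)])

end

lemma automorphism_intersection:
  assumes pair: "automorphism_pair F G"
  shows "intersection (F f) (F g) = intersection f g"
proof -
  have pair': "automorphism_pair G F" using pair by (auto simp: automorphism_pair_def)
  have iff: "codim (ideal2 (F f) (F g)) n \<longleftrightarrow> codim (ideal2 f g) n" for n
    using automorphism_codim[OF pair, of f g n] automorphism_codim[OF pair', of "F f" "F g" n]
    by (auto simp: automorphism_simps[OF pair])
  show ?thesis
  proof (cases "\<exists>n. codim (ideal2 f g) n")
    case True
    then obtain n where "codim (ideal2 f g) n" by blast
    then show ?thesis using iff quotient_dim_codim[OF k_subspace_ideal2]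
      unfolding intersection_def by metis
  next
    case False
    then have "\<nexists>B. quotient_basis (ideal2 f g) B" "\<nexists>B. quotient_basis (ideal2 (F f) (F g)) B"
      using iff unfolding codim_def by blast+
    then show ?thesis by (simp add: intersection_def quotient_dim_def)
  qed
qed

section \<open>Valuations and three branches\<close>

definition min_twice :: "real \<Rightarrow> real \<Rightarrow> real \<Rightarrow> bool" where
  "min_twice x y z \<longleftrightarrow> (y \<le> x \<and> y = z) \<or> (x \<le> y \<and> x = z) \<or> (x = y \<and> x \<le> z)"

definition smooth_branch :: "'a::field pseries \<Rightarrow> bool" where
  "smooth_branch f \<longleftrightarrow> f \<noteq> 0 \<and> mult f = 1"

text \<open>In coordinates in which \<open>Z(f\<^sub>0)\<close> is the axis \<open>X = 0\<close>, the intersection number with \<open>Z(f\<^sub>0)\<close> is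
  the degree in \<open>Y\<close> of the Weierstrass polynomial.\<close>

lemma straightened_branch:
  fixes f0 f :: "'a::field pseries"
  assumes pair: "automorphism_pair F G" and f0: "u dvd 1" "F f0 = u * varX"
    and f: "Factorial_Ring.irreducible f" "\<not> f0 dvd f"
  obtains P a where "branch_data (F f) P a" "intersection f0 f = enat (degree P)" "degree P > 0"
proof -
  have "\<not> varX dvd F f"
    using f(2) automorphism_dvd[OF pair, of f0 f] unit_mult_dvd[OF f0(1)] by (simp add: f0(2))
  then obtain P a where Pa: "branch_data (F f) P a"
    using branch_data_exists[OF automorphism_irreducible[OF pair f(1)]] by blast
  have "intersection f0 f = intersection (u * varX) (1 * F f)"
    using automorphism_intersection[OF pair, of f0 f] by (simp add: f0(2))
  also have "\<dots> = intersection varX (F f)" by (rule intersection_unit) (use f0 in auto)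
  also have "\<dots> = enat (degree P)" by (rule intersection_varX[OF Pa])
  finally have i: "intersection f0 f = enat (degree P)" .
  have "P \<noteq> 0" "a \<in># roots P"
    using Pa min_poly_in_roots min_poly_nonzero by (auto simp: branch_data_def)
  then have "degree P > 0" using size_roots[of P] by (cases "degree P") auto
  then show ?thesis using that Pa i by blast
qed

text \<open>The relation of \<open>three_branches_poly\<close> for the seminorm \<open>e\<^sup>-\<^sup>\<nu>\<close>, rewritten additively. The
  absolute value of one equation at a point of the other branch becomes an intersection number.\<close>

theorem three_branches:
  fixes f0 f g :: "'a::alg_closed_field pseries"
  assumes f0: "smooth_branch f0" and f: "Factorial_Ring.irreducible f" "\<not> f0 dvd f"
    and g: "Factorial_Ring.irreducible g" "\<not> f0 dvd g" and fg: "\<not> f dvd g"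
  obtains d e n where "d > 0" "e > 0" "intersection f0 f = enat d" "intersection f0 g = enat e"
    "intersection f g = enat n"
    "\<And>\<nu>. semivaluation \<nu> \<Longrightarrow> (\<And>h. h \<in> {f0, f, g} \<Longrightarrow> 0 < \<nu> h \<and> \<nu> h < \<infinity>) \<Longrightarrow>
       min_twice (enn2real (\<nu> f) * real e) (enn2real (\<nu> g) * real d) (enn2real (\<nu> f0) * real n)"
proof -
  obtain F G u where pair: "automorphism_pair F G" and u: "u dvd 1" "F f0 = u * varX"
    using straighten_smooth f0 unfolding smooth_branch_def by metis
  obtain P a where P: "branch_data (F f) P a" "intersection f0 f = enat (degree P)" "degree P > 0"
    using straightened_branch[OF pair u f] by blast
  obtain Q b where Q: "branch_data (F g) Q b" "intersection f0 g = enat (degree Q)" "degree Q > 0"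
    using straightened_branch[OF pair u g] by blast
  have "\<not> F f dvd F g" using fg automorphism_dvd[OF pair] by simp
  then obtain n where n: "intersection (F f) (F g) = enat n"
    "exp (- real n) = absv (ev Q a) ^ degree P" "ev Q a \<noteq> 0"
    using intersection_branches[OF P(1) Q(1)] by blast
  have "min_twice (enn2real (\<nu> f) * real (degree Q)) (enn2real (\<nu> g) * real (degree P))
      (enn2real (\<nu> f0) * real n)"
    if \<nu>: "semivaluation \<nu>" and fin: "\<And>h. h \<in> {f0, f, g} \<Longrightarrow> 0 < \<nu> h \<and> \<nu> h < \<infinity>" for \<nu>
  proof -
    define \<mu> where "\<mu> = (\<lambda>h. \<nu> (G h))"
    have pair': "automorphism_pair G F" using pair by (auto simp: automorphism_pair_def)
    have \<mu>: "semivaluation \<mu>" unfolding \<mu>_def by (rule automorphism_semivaluation[OF pair' \<nu>])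
    have \<mu>F: "\<mu> (F h) = \<nu> h" for h by (simp add: \<mu>_def automorphism_simps[OF pair])
    have X: "\<mu> varX = \<nu> f0"
      using \<mu>F[of f0] semivaluation_unit_mult[OF \<mu> u(1)] by (simp add: u(2))
    have val: "\<mu> (fps_of_poly R) = \<nu> h" if "branch_data (F h) R c" for R c h
      using that \<mu>F[of h] semivaluation_unit_mult[OF \<mu>] by (auto simp: branch_data_def)
    define t where "t = enn2real (\<nu> f0)"
    have t: "t > 0" using fin[of f0] by (simp add: t_def enn2real_positive_iff)
    have M: "norm_of \<mu> P = exp (- (enn2real (\<nu> f) / t))" "norm_of \<mu> Q = exp (- (enn2real (\<nu> g) / t))"
      using fin[of f] fin[of g] val[OF P(1)] val[OF Q(1)] by (auto simp: norm_of_def X t_def)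
    have sn: "poly_seminorm (norm_of \<mu>)"
      by (rule poly_seminorm_norm_of[OF \<mu>]) (use fin[of f0] X in auto)
    have pos: "enn2real (\<nu> f) > 0" "enn2real (\<nu> g) > 0"
      using fin by (auto simp: enn2real_positive_iff)
    let ?p = "norm_of \<mu> P ^ degree Q" and ?q = "norm_of \<mu> Q ^ degree P" and ?r = "absv (ev Q a) ^ degree P"
    have rel: "(?p \<le> ?q \<and> ?q = ?r) \<or> (?q \<le> ?p \<and> ?p = ?r) \<or> (?p = ?q \<and> ?r \<le> ?p)"
      using P(1) Q(1) n(3) branch_data_roots_small[OF P(1)] branch_data_roots_small[OF Q(1)] pos t
      by (intro three_branches_poly[OF sn]) (auto simp: branch_data_def M)
    have p: "?p = exp (- (enn2real (\<nu> f) * real (degree Q) / t))"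
      by (simp add: M mult.commute flip: exp_of_nat_mult)
    have q: "?q = exp (- (enn2real (\<nu> g) * real (degree P) / t))"
      by (simp add: M mult.commute flip: exp_of_nat_mult)
    have r: "?r = exp (- (t * real n / t))" using n(2) t by simp
    show ?thesis
      using rel t unfolding p q r min_twice_def t_def[symmetric]
      by (simp add: divide_le_cancel) (auto simp: field_simps)
  qed
  moreover have "intersection f g = enat n" using automorphism_intersection[OF pair] n(1) by simp
  ultimately show ?thesis using that[of "degree P" "degree Q" n] P Q by blast
qed

text \<open>The quasi-monomial valuation at the point of contact complexity \<open>c\<close> on the segment from \<open>f0\<close>
  to \<open>f\<close>.\<close>

theorem branch_valuation:
  fixes f0 f :: "'a::alg_closed_field pseries"
  assumes f0: "smooth_branch f0" and f: "Factorial_Ring.irreducible f" "\<not> f0 dvd f" and c: "c > 0"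
    and d: "intersection f0 f = enat d"
  obtains \<nu> where "semivaluation \<nu>" "\<nu> f0 = 1" "\<nu> f = ennreal (real d * c)"
    "\<And>g e n. Factorial_Ring.irreducible g \<Longrightarrow> \<not> f0 dvd g \<Longrightarrow> \<not> f dvd g \<Longrightarrow>
       intersection f0 g = enat e \<Longrightarrow> intersection f g = enat n \<Longrightarrow>
       \<nu> g = ennreal (real e * min c (real n / (real d * real e)))"
proof -
  obtain F G u where pair: "automorphism_pair F G" and u: "u dvd 1" "F f0 = u * varX"
    using straighten_smooth f0 unfolding smooth_branch_def by metis
  obtain P a where P: "branch_data (F f) P a" "intersection f0 f = enat (degree P)" "degree P > 0"
    using straightened_branch[OF pair u f] by blast
  have dP: "degree P = d" using P(2) d by simp
  have d0: "d > 0" using P(3) dP by simp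
  have mP: "min_poly_of P a" using P(1) by (simp add: branch_data_def)
  note smallP = branch_data_roots_small[OF P(1)]
  have a: "absv a < 1" using smallP min_poly_in_roots[OF mP] by blast
  obtain \<rho> where \<rho>: "0 < \<rho>" "\<rho> < 1" "disc_norm a \<rho> P = exp (- (real d * c))"
    using radius_exists[OF mP smallP, of "exp (- (real d * c))"] c d0 by auto
  let ?M = "disc_norm a \<rho>"
  have M: "poly_seminorm ?M" using \<rho> a by (intro poly_seminorm_disc_norm) auto
  have "taylor a [:0, 1:] = [:a, 1:]" by (simp add: taylor_def pcompose_pCons)
  then have "?M [:0, 1:] < 1" using \<rho> a by (simp add: disc_norm_def gauss_linear[OF \<rho>(1)])
  then obtain \<mu> where \<mu>: "semivaluation \<mu>"
    and val: "\<And>p. ?M p \<noteq> 0 \<Longrightarrow> \<mu> (fps_of_poly p) = ennreal (- ln (?M p))"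
    using poly_seminorm_extends[OF M] by blast
  have X: "\<mu> varX = 1"
  proof -
    have "?M [:fps_X:] = exp (- 1)"
      using absv_unif by (simp add: poly_seminorm_simps(4)[OF M] unif_def)
    then show ?thesis using val[of "[:fps_X:]"] by (simp add: fps_of_poly_const varX_def)
  qed
  have valb: "\<mu> (F h) = ennreal (- ln (?M R))" if R: "branch_data (F h) R b" for h R b
  proof -
    have "R \<noteq> 0" using R min_poly_nonzero unfolding branch_data_def by blast
    then have "?M R \<noteq> 0"
      using gauss_norm_pos[OF \<rho>(1), of "taylor a R"] by (simp add: disc_norm_def)
    then show ?thesis
      using R semivaluation_unit_mult[OF \<mu>] val[of R] by (auto simp: branch_data_def)
  qed
  show ?thesis
  proof (rule that[of "\<lambda>h. \<mu> (F h)"])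
    show "semivaluation (\<lambda>h. \<mu> (F h))" by (rule automorphism_semivaluation[OF pair \<mu>])
    show "\<mu> (F f0) = 1" using X semivaluation_unit_mult[OF \<mu> u(1)] by (simp add: u(2))
    show "\<mu> (F f) = ennreal (real d * c)" by (simp add: valb[OF P(1)] \<rho>(3))
    fix g e n assume g: "Factorial_Ring.irreducible g" "\<not> f0 dvd g" and fg: "\<not> f dvd g"
      and e: "intersection f0 g = enat e" and n: "intersection f g = enat n"
    obtain Q b where Q: "branch_data (F g) Q b" "intersection f0 g = enat (degree Q)" "degree Q > 0"
      using straightened_branch[OF pair u g] by blast
    have dQ: "degree Q = e" and e0: "e > 0" using Q(2,3) e by auto
    have mQ: "min_poly_of Q b" using Q(1) by (simp add: branch_data_def)
    have "\<not> F f dvd F g" using fg automorphism_dvd[OF pair] by simp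
    then obtain n' where n': "intersection (F f) (F g) = enat n'"
      "exp (- real n') = absv (ev Q a) ^ degree P" "ev Q a \<noteq> 0"
      using intersection_branches[OF P(1) Q(1)] by blast
    have "n' = n" using n'(1) n automorphism_intersection[OF pair, of f g] by simp
    have pos: "0 < ?M Q" using disc_norm_lt_1[OF \<rho>(1,2) mQ a branch_data_roots_small[OF Q(1)]] by blast
    have "?M Q ^ d = max (exp (- (real d * c)) ^ e) (exp (- real n))"
      using disc_norm_second_branch[OF \<rho>(1,2) mP mQ n'(3) smallP branch_data_roots_small[OF Q(1)]]
        n'(2) \<open>n' = n\<close> by (simp add: dP dQ \<rho>(3))
    also have "\<dots> = exp (- min (real e * (real d * c)) (real n))"
      by (simp add: max_def min_def flip: exp_of_nat_mult)
    finally have "ln (?M Q ^ d) = - min (real e * (real d * c)) (real n)" by simp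
    then have "real d * - ln (?M Q) = min (real e * (real d * c)) (real n)"
      using pos by (simp add: ln_realpow)
    then have "- ln (?M Q) = min (real e * (real d * c)) (real n) / real d"
      using d0 by (simp add: field_simps)
    also have "\<dots> = real e * min c (real n / (real d * real e))"
      using d0 e0 by (auto simp: min_def field_simps)
    finally show "\<mu> (F g) = ennreal (real e * min c (real n / (real d * real e)))"
      by (simp only: valb[OF Q(1)])
  qed
qed

section \<open>Other semivaluations\<close>

text \<open>A series divisible by all powers of \<open>f\<close> has infinite order, so it vanishes.\<close>

lemma branch_power_decomposition:
  fixes f g :: "'a::field pseries"
  assumes "Factorial_Ring.irreducible f" "g \<noteq> 0"
  obtains k h where "g = f ^ k * h" "\<not> f dvd h"
proof -
  have "cf f 0 0 = 0" using assms(1) by (auto simp: Factorial_Ring.irreducible_def pseries_unit_iff)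
  then have f1: "order_ge 1 f" by (simp only: order_ge_1_iff)
  have ex: "\<exists>n. \<not> f ^ Suc n dvd g"
  proof (rule ccontr)
    assume "\<nexists>n. \<not> f ^ Suc n dvd g"
    then have dvd: "f ^ Suc n dvd g" for n by blast
    have "order_ge (Suc n) g" for n
    proof -
      obtain h where "g = f ^ Suc n * h" using dvd[of n] by (rule dvdE)
      then have "g = h * f ^ Suc n" by (simp only: mult.commute)
      then show ?thesis using order_ge_mult_left[OF order_ge_power[OF f1, of "Suc n"]] by simp
    qed
    then have "order_ge n g" for n using order_ge_mono[of "Suc n" g n] by simp
    then have "g = 0" by (rule order_ge_imp_zero)
    then show False using assms(2) by simp
  qed
  define k where "k = (LEAST n. \<not> f ^ Suc n dvd g)"
  have k: "\<not> f ^ Suc k dvd g" unfolding k_def by (rule LeastI_ex[OF ex])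
  have "f ^ k dvd g"
  proof (cases k)
    case (Suc j)
    then show ?thesis using not_less_Least[of j "\<lambda>n. \<not> f ^ Suc n dvd g"] by (simp add: k_def)
  qed simp
  then obtain h where h: "g = f ^ k * h" by (rule dvdE)
  have "\<not> f dvd h"
  proof
    assume "f dvd h"
    then have "f ^ k * f dvd f ^ k * h" by (rule mult_dvd_mono[OF dvd_refl])
    then show False using k h by (simp add: mult.commute)
  qed
  then show ?thesis using h that by blast
qed

lemma branch_power_unique:
  fixes f :: "'a::field pseries"
  assumes "f \<noteq> 0" "f ^ k * h = f ^ j * h'" "\<not> f dvd h" "\<not> f dvd h'" shows "k = j"
proof -
  have "\<not> k < j" if "f ^ k * h = f ^ j * h'" "\<not> f dvd h" for k j h h'
  proof
    assume "k < j"
    then obtain i where j: "j = k + Suc i" using less_imp_add_positive by (metis gr0_implies_Suc)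
    have "f ^ k * h = f ^ k * (f * (f ^ i * h'))" using that(1) by (simp add: j power_add mult.assoc)
    then have "h = f * (f ^ i * h')" using assms(1) by simp
    then show False using that(2) by (metis dvd_triv_left)
  qed
  from this[OF assms(2,3)] this[OF assms(2)[symmetric] assms(4)] show ?thesis by simp
qed

text \<open>The order of vanishing along the branch \<open>Z(f)\<close> is additive because \<open>f\<close> is prime.\<close>

theorem order_valuation:
  fixes f :: "'a::field pseries"
  assumes irr: "Factorial_Ring.irreducible f" and t: "t > 0"
  obtains \<nu> where "semivaluation \<nu>" "\<nu> f = ennreal t" "\<And>g. \<not> f dvd g \<Longrightarrow> \<nu> g = 0"
proof -
  have pr: "prime_elem f" by (rule irreducible_imp_prime_pseries[OF irr])
  have f0: "f \<noteq> 0" using irr by (simp add: Factorial_Ring.irreducible_def)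
  define N where "N = (\<lambda>g. if g = 0 then 0 else exp (- real (THE k. \<exists>h. g = f ^ k * h \<and> \<not> f dvd h)))"
  have N: "N (f ^ k * h) = exp (- real k)" if h: "\<not> f dvd h" for k h
  proof -
    have "(THE j. \<exists>h'. f ^ k * h = f ^ j * h' \<and> \<not> f dvd h') = k"
      using h branch_power_unique[OF f0] by (intro the_equality) metis+
    moreover have "f ^ k * h \<noteq> 0" using h f0 by auto
    ultimately show ?thesis by (simp add: N_def)
  qed
  have mult: "N (g * h) = N g * N h" for g h
  proof (cases "g = 0 \<or> h = 0")
    case False
    then obtain k g' j h' where g: "g = f ^ k * g'" "\<not> f dvd g'" and h: "h = f ^ j * h'" "\<not> f dvd h'"
      using branch_power_decomposition[OF irr] by metis
    have "g * h = f ^ (k + j) * (g' * h')" by (simp add: g h power_add)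
    moreover have "\<not> f dvd g' * h'" using pr g h by (simp add: prime_elem_dvd_mult_iff)
    ultimately have "N (g * h) = exp (- real (k + j))" using N by metis
    then show ?thesis using N[OF g(2), of k] N[OF h(2), of j] by (simp add: g(1) h(1) flip: exp_add)
  qed (auto simp: N_def)
  have dvdN: "N g \<le> exp (- real k)" if "f ^ k dvd g" for g k
  proof (cases "g = 0")
    case False
    then obtain j h where g: "g = f ^ j * h" "\<not> f dvd h" using branch_power_decomposition[OF irr] by metis
    have "k \<le> j"
    proof (rule ccontr)
      assume "\<not> k \<le> j"
      then have "f ^ Suc j dvd f ^ k" by (intro le_imp_power_dvd) simp
      then have "f ^ j * f dvd f ^ j * h" using that g(1) by (metis dvd_trans power_Suc2)
      then show False using g(2) f0 by simp
    qed
    then show ?thesis using N[OF g(2), of j] by (simp add: g(1))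
  qed (simp add: N_def)
  have add: "N (g + h) \<le> max (N g) (N h)" for g h
  proof (cases "g = 0 \<or> h = 0")
    case False
    then obtain k g' j h' where g: "g = f ^ k * g'" "\<not> f dvd g'" and h: "h = f ^ j * h'" "\<not> f dvd h'"
      using branch_power_decomposition[OF irr] by metis
    have "f ^ min k j dvd f ^ k * g'" "f ^ min k j dvd f ^ j * h'"
      by (meson dvd_mult2 le_imp_power_dvd min.cobounded1 min.cobounded2)+
    then have "N (g + h) \<le> exp (- real (min k j))" unfolding g(1) h(1) by (intro dvdN dvd_add)
    then show ?thesis using N[OF g(2), of k] N[OF h(2), of j] by (auto simp: g(1) h(1) min_def max_def split: if_splits)
  qed (auto simp: N_def)
  have nu: "\<not> f dvd 1" using pr by (simp add: prime_elem_def)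
  have unitN: "N g = 1" if "\<not> f dvd g" for g using N[OF that, of 0] by simp
  show ?thesis
  proof (rule that[of "valuation_of N t"])
    show "semivaluation (valuation_of N t)"
    proof (rule semivaluation_valuation_of[OF mult add])
      fix c :: 'a assume "c \<noteq> 0"
      then have "cnst c dvd 1" by (simp add: pseries_unit_iff cf_cnst)
      then have "\<not> f dvd cnst c" using nu dvd_trans by blast
      then show "N (cnst c) = 1" by (rule unitN)
    qed (use t in \<open>auto simp: N_def\<close>)
    show "valuation_of N t f = ennreal t" using N[OF nu, of 1] by (simp add: valuation_of_def)
    show "valuation_of N t g = 0" if "\<not> f dvd g" for g
      using unitN[OF that] by (simp add: valuation_of_def)
  qed
qed

lemma trivial_valuation:
  obtains \<nu> :: "'a::field pseries \<Rightarrow> ennreal" where "semivaluation \<nu>" "\<And>g. g \<noteq> 0 \<Longrightarrow> \<nu> g = 0"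
proof
  let ?N = "\<lambda>g::'a pseries. if g = 0 then 0 else (1::real)"
  show "semivaluation (valuation_of ?N 1)"
  proof (rule semivaluation_valuation_of)
    fix c :: 'a assume "c \<noteq> 0"
    then have "cf (cnst c) 0 0 \<noteq> 0" by (simp add: cf_cnst)
    then show "?N (cnst c) = 1" by auto
  qed auto
  show "valuation_of ?N 1 g = 0" if "g \<noteq> 0" for g using that by (simp add: valuation_of_def)
qed

lemma semivaluation_scale:
  assumes "semivaluation \<nu>" "0 < a" shows "semivaluation (\<lambda>g. ennreal a * \<nu> g)"
  unfolding semivaluation_def
proof (intro conjI allI impI)
  fix f g
  show "ennreal a * \<nu> (f * g) = ennreal a * \<nu> f + ennreal a * \<nu> g"
    by (simp add: semivaluationD(1)[OF assms(1)] distrib_left)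
  show "min (ennreal a * \<nu> f) (ennreal a * \<nu> g) \<le> ennreal a * \<nu> (f + g)"
    using semivaluationD(2)[OF assms(1), of f g] by (auto simp: min_le_iff_disj intro: mult_left_mono)
qed (use semivaluationD[OF assms(1)] assms(2) in \<open>auto simp: ennreal_mult_top\<close>)

lemma semivaluation_power_pos:
  assumes "semivaluation \<nu>" "\<nu> (f ^ n) > 0" shows "\<nu> f > 0"
proof (rule ccontr)
  assume "\<not> \<nu> f > 0"
  then have "\<nu> f = 0" by simp
  then show False using assms(2) unfolding semivaluation_power[OF assms(1)] by simp
qed

text \<open>Two branches meet only at the origin, so a semivaluation that is positive on both of them is
  centered there.\<close>

theorem semivaluation_centered:
  fixes f g :: "'a::field pseries"
  assumes \<nu>: "semivaluation \<nu>" and f: "Factorial_Ring.irreducible f" and g: "Factorial_Ring.irreducible g"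
    and ndvd: "\<not> f dvd g" and pos: "\<nu> f > 0" "\<nu> g > 0" and h: "h \<in> maxideal"
  shows "\<nu> h > 0"
proof -
  have nX: "\<not> (varX :: 'a pseries) dvd 1" by (simp add: pseries_unit_iff cf_varX)
  have from_X: "\<nu> varX > 0" if p: "Factorial_Ring.irreducible p" "varX dvd p" "\<nu> p > 0" for p
  proof -
    obtain u where u: "p = varX * u" using p(2) by (rule dvdE)
    then have "u dvd 1" using p(1) nX irreducible_unit_factor by blast
    then have "\<nu> (u * varX) = \<nu> varX" by (rule semivaluation_unit_mult[OF \<nu>])
    then show ?thesis using p(3) by (simp add: u mult.commute)
  qed
  have X: "\<nu> varX > 0"
  proof (cases "varX dvd f")
    case False
    then obtain P a where "branch_data f P a" using branch_data_exists[OF f] by blast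
    then obtain u where P: "weierstrass P" "min_poly_of P a" and u: "u dvd 1" "f = u * fps_of_poly P"
      by (auto simp: branch_data_def)
    have "\<not> fps_of_poly P dvd g" using ndvd by (simp add: u unit_mult_dvd)
    then have z: "ev_branch P a g \<noteq> 0" by (simp add: ev_branch_eq_0_iff[OF P])
    obtain s where s: "ev_branch P a g = ev s a" by (rule ev_branch_cases[OF P])
    then obtain r n where rn: "ev s a * ev r a = unif ^ n" using inverse_in_field z by metis
    have "ev_branch P a (g * fps_of_poly r) = ev_branch P a (varX ^ n)"
      using rn by (simp add: ev_branch_mult[OF P] ev_branch_power[OF P] ev_branch_varX[OF P]
        ev_branch_poly[OF P] s)
    then have "ev_branch P a (varX ^ n - g * fps_of_poly r) = 0"
      using ev_branch_add[OF P, of "varX ^ n - g * fps_of_poly r" "g * fps_of_poly r"] by simp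
    then have "f dvd varX ^ n - g * fps_of_poly r" by (simp add: ev_branch_eq_0_iff[OF P] u unit_mult_dvd)
    then obtain q where "varX ^ n - g * fps_of_poly r = f * q" by (rule dvdE)
    then have "varX ^ n = f * q + g * fps_of_poly r" by (simp add: diff_eq_eq)
    then have "\<nu> (varX ^ n) > 0" using pos \<nu> by (simp add: semivaluation_sum_pos semivaluation_mult_pos)
    then show ?thesis by (rule semivaluation_power_pos[OF \<nu>])
  qed (use from_X f pos in blast)
  have Y: "\<nu> varY > 0"
  proof -
    have "\<exists>p. Factorial_Ring.irreducible p \<and> \<nu> p > 0 \<and> \<not> varX dvd p"
    proof (rule ccontr)
      assume "\<not> ?thesis"
      then have "varX dvd f" "varX dvd g" using f g pos by auto
      then obtain u v where uv: "f = varX * u" "g = varX * v" by (auto elim!: dvdE)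
      then have "u dvd 1" using f nX irreducible_unit_factor by blast
      then have "f dvd g" unfolding uv by (metis dvd_triv_left mult.commute unit_mult_dvd)
      then show False using ndvd by simp
    qed
    then obtain p P a where p: "\<nu> p > 0" "branch_data p P a" using branch_data_exists by metis
    then obtain u where P: "weierstrass P" and u: "u dvd 1" "p = u * fps_of_poly P"
      by (auto simp: branch_data_def)
    have "\<nu> (fps_of_poly P) > 0" using p(1) semivaluation_unit_mult[OF \<nu> u(1)] by (simp add: u(2))
    moreover have "varX dvd varY ^ degree P - fps_of_poly P"
      using weierstrass_cf[OF P] by (auto simp: varX_dvd_iff varY_def cf_def)
    then obtain q where "varY ^ degree P - fps_of_poly P = varX * q" by (rule dvdE)
    then have "varY ^ degree P = varX * q + fps_of_poly P" by (simp add: diff_eq_eq)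
    ultimately have "\<nu> (varY ^ degree P) > 0"
      using X \<nu> by (simp add: semivaluation_sum_pos semivaluation_mult_pos)
    then show ?thesis by (rule semivaluation_power_pos[OF \<nu>])
  qed
  obtain h1 h2 where "h = cnst (cf h 0 0) + varX * h1 + varY * h2" using pseries_split[of h] by metis
  then have "h = varX * h1 + varY * h2" using h by (simp add: maxideal_def)
  then show ?thesis using X Y \<nu> by (simp add: semivaluation_sum_pos semivaluation_mult_pos)
qed

section \<open>The tropicalization of a family of branches\<close>

lemma EW_tree_eq: "EW_tree m x = (\<lambda>(c, i). EW_rel m x `` {(c, i)}) ` (UNIV \<times> {1..m})"
  by (auto simp: EW_tree_def EW_segments_def quotient_def)

locale branch_family =
  fixes m :: nat and x :: "nat \<Rightarrow> 'a::alg_closed_field pseries"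
  assumes m: "m \<ge> 1" and smooth: "smooth_branch (x 0)"
    and irr: "\<And>i. i \<le> m \<Longrightarrow> Factorial_Ring.irreducible (x i)"
    and distinct_branches: "\<And>i j. i \<le> m \<Longrightarrow> j \<le> m \<Longrightarrow> i \<noteq> j \<Longrightarrow> \<not> x i dvd x j"
begin

definition deg :: "nat \<Rightarrow> nat" where
  "deg i = the_enat (intersection (x 0) (x i))"

definition int_num :: "nat \<Rightarrow> nat \<Rightarrow> nat" where
  "int_num i j = the_enat (intersection (x i) (x j))"

definition kap :: "nat \<Rightarrow> nat \<Rightarrow> real" where
  "kap i j = real (int_num i j) / (real (deg i) * real (deg j))"

lemma pair_data:
  assumes "i \<in> {1..m}" "j \<in> {1..m}" "i \<noteq> j"
  shows "deg i > 0" "intersection (x 0) (x i) = enat (deg i)"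
    "intersection (x i) (x j) = enat (int_num i j)"
    "\<And>\<nu>. semivaluation \<nu> \<Longrightarrow> (\<And>h. h \<in> {x 0, x i, x j} \<Longrightarrow> 0 < \<nu> h \<and> \<nu> h < \<infinity>) \<Longrightarrow>
      min_twice (enn2real (\<nu> (x i)) * real (deg j)) (enn2real (\<nu> (x j)) * real (deg i))
        (enn2real (\<nu> (x 0)) * real (int_num i j))"
proof -
  have nd: "\<not> x 0 dvd x i" "\<not> x 0 dvd x j" "\<not> x i dvd x j"
    using assms distinct_branches by auto
  obtain d e n where den: "d > 0" "e > 0" "intersection (x 0) (x i) = enat d"
    "intersection (x 0) (x j) = enat e" "intersection (x i) (x j) = enat n"
    "\<And>\<nu>. semivaluation \<nu> \<Longrightarrow> (\<And>h. h \<in> {x 0, x i, x j} \<Longrightarrow> 0 < \<nu> h \<and> \<nu> h < \<infinity>) \<Longrightarrow>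
       min_twice (enn2real (\<nu> (x i)) * real e) (enn2real (\<nu> (x j)) * real d) (enn2real (\<nu> (x 0)) * real n)"
    by (rule three_branches[OF smooth irr nd(1) irr nd(2,3)]) (use assms in auto)
  have e: "deg i = d" "deg j = e" "int_num i j = n" using den by (simp_all add: deg_def int_num_def)
  show "deg i > 0" "intersection (x 0) (x i) = enat (deg i)"
    "intersection (x i) (x j) = enat (int_num i j)" using den e by simp_all
  show "min_twice (enn2real (\<nu> (x i)) * real (deg j)) (enn2real (\<nu> (x j)) * real (deg i))
        (enn2real (\<nu> (x 0)) * real (int_num i j))"
    if "semivaluation \<nu>" "\<And>h. h \<in> {x 0, x i, x j} \<Longrightarrow> 0 < \<nu> h \<and> \<nu> h < \<infinity>" for \<nu>
    unfolding e using that by (rule den(6))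
qed

lemma deg_data:
  assumes "i \<in> {1..m}" shows "deg i > 0" "intersection (x 0) (x i) = enat (deg i)"
proof -
  have "\<not> x 0 dvd x i" using assms distinct_branches by auto
  obtain F G u where pair: "automorphism_pair F G" and u: "u dvd 1" "F (x 0) = u * varX"
    using straighten_smooth smooth unfolding smooth_branch_def by metis
  have ir: "Factorial_Ring.irreducible (x i)" using irr assms by simp
  obtain P :: "'a fps poly" and a where "branch_data (F (x i)) P a"
    "intersection (x 0) (x i) = enat (degree P)" "degree P > 0"
    by (rule straightened_branch[OF pair u ir \<open>\<not> x 0 dvd x i\<close>])
  then show "deg i > 0" "intersection (x 0) (x i) = enat (deg i)" by (simp_all add: deg_def)
qed

lemma contact_eq:
  assumes "i \<in> {1..m}" "j \<in> {1..m}"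
  shows "contact (x 0) (x i) (x j) = (if i = j then \<infinity> else ennreal (kap i j))"
proof (cases "i = j")
  case False
  have "\<not> same_curve (x i) (x j)" using distinct_branches[of i j] assms False by (simp add: same_curve_def)
  moreover have "ennreal_of_enat (enat n) = ennreal (real n)" for n
    by (simp add: ennreal_of_nat_eq_real_of_nat)
  ultimately show ?thesis
    using False pair_data(3)[OF assms False] deg_data[OF assms(1)] deg_data[OF assms(2)]
    by (simp add: contact_def kap_def divide_ennreal ennreal_mult[symmetric])
qed (simp add: contact_def same_curve_def)

definition meet :: "real \<Rightarrow> nat \<Rightarrow> nat \<Rightarrow> real" where
  "meet c i j = (if i = j then c else min c (kap i j))"

text \<open>The vector \<open>w\<^sup>P\<close> of an interior point \<open>P\<close>, in real instead of extended arithmetic.\<close>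

definition interior_vec :: "real \<Rightarrow> nat \<Rightarrow> nat \<Rightarrow> real" where
  "interior_vec c i = (\<lambda>j. if j = 0 then 1 else if j \<le> m then real (deg j) * meet c i j else 0)"

lemma kap_nonneg: "kap i j \<ge> 0"
  by (simp add: kap_def)

lemma w_rep_interior:
  assumes i: "i \<in> {1..m}" and c: "c > 0"
  shows "w_rep m x (ennreal c, i) = interior_vec c i"
proof
  fix j
  show "w_rep m x (ennreal c, i) j = interior_vec c i j"
  proof (cases "j \<in> {1..m}")
    case True
    have "min (ennreal c) (contact (x 0) (x i) (x j)) = ennreal (meet c i j)"
      using c kap_nonneg[of i j] by (auto simp: contact_eq[OF i True] meet_def min_def)
    moreover have "ennreal_of_enat (intersection (x 0) (x j)) = ennreal (real (deg j))"
      using deg_data(2)[OF True] by (simp add: ennreal_of_nat_eq_real_of_nat)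
    moreover have "meet c i j \<ge> 0" using c kap_nonneg by (simp add: meet_def)
    ultimately show ?thesis
      using True c by (simp add: interior_vec_def ennreal_mult[symmetric])
  next
    case False
    then show ?thesis using c by (cases "j = 0") (auto simp: interior_vec_def)
  qed
qed

lemma trop_branch_valuation:
  assumes i: "i \<in> {1..m}" and c: "c > 0"
  obtains \<nu> where "semivaluation \<nu>" "\<nu> (x 0) = 1"
    "\<And>j. j \<in> {1..m} \<Longrightarrow> \<nu> (x j) = ennreal (real (deg j) * meet c i j)"
proof -
  have nd: "\<not> x 0 dvd x i" using i distinct_branches by auto
  have ir: "Factorial_Ring.irreducible (x i)" using irr i by simp
  obtain \<nu> where \<nu>: "semivaluation \<nu>" "\<nu> (x 0) = 1" "\<nu> (x i) = ennreal (real (deg i) * c)"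
    and other: "\<And>g e n. Factorial_Ring.irreducible g \<Longrightarrow> \<not> x 0 dvd g \<Longrightarrow> \<not> x i dvd g \<Longrightarrow>
       intersection (x 0) g = enat e \<Longrightarrow> intersection (x i) g = enat n \<Longrightarrow>
       \<nu> g = ennreal (real e * min c (real n / (real (deg i) * real e)))"
    using branch_valuation[OF smooth ir nd c deg_data(2)[OF i]] by metis
  have "\<nu> (x j) = ennreal (real (deg j) * meet c i j)" if j: "j \<in> {1..m}" for j
  proof (cases "i = j")
    case True
    then show ?thesis using \<nu>(3) by (simp add: meet_def)
  next
    case False
    have "\<nu> (x j) = ennreal (real (deg j) * min c (real (int_num i j) / (real (deg i) * real (deg j))))"
      by (rule other) (use irr distinct_branches i j False deg_data(2)[OF j] pair_data(3)[OF i j False] in auto)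
    then show ?thesis using False by (simp add: meet_def kap_def)
  qed
  then show ?thesis using that \<nu> by blast
qed

text \<open>A centered semivaluation retracts to the point of the tree that lies on the segment along
  which the relative value is largest.\<close>

lemma trop_centered:
  assumes \<nu>: "semivaluation \<nu>" and fin: "\<And>j. j \<le> m \<Longrightarrow> 0 < \<nu> (x j) \<and> \<nu> (x j) < \<infinity>"
    and i: "i \<in> {1..m}"
    and max: "\<And>j. j \<in> {1..m} \<Longrightarrow>
      enn2real (\<nu> (x j)) * real (deg i) \<le> enn2real (\<nu> (x i)) * real (deg j)"
  defines "t \<equiv> enn2real (\<nu> (x 0))"
  defines "c \<equiv> enn2real (\<nu> (x i)) / (t * real (deg i))"
  shows "t > 0" "c > 0" "trop m x \<nu> = (\<lambda>j. t * interior_vec c i j)"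
proof -
  show t: "t > 0" using fin[of 0] by (simp add: t_def enn2real_positive_iff)
  have di: "deg i > 0" by (rule deg_data(1)[OF i])
  have vi: "enn2real (\<nu> (x i)) > 0" using fin[of i] i by (simp add: enn2real_positive_iff)
  then show c: "c > 0" using t di by (simp add: c_def)
  have vc: "enn2real (\<nu> (x i)) = t * real (deg i) * c" using t di by (simp add: c_def)
  show "trop m x \<nu> = (\<lambda>j. t * interior_vec c i j)"
  proof
    fix j
    consider "j = 0" | "j > m" | "j \<in> {1..m}" by fastforce
    then show "trop m x \<nu> j = t * interior_vec c i j"
    proof cases
      case 3
      then have j: "0 < j" "j \<le> m" by auto
      have dj: "deg j > 0" by (rule deg_data(1)[OF 3])
      have "enn2real (\<nu> (x j)) = t * (real (deg j) * meet c i j)"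
      proof (cases "i = j")
        case False
        let ?d = "real (deg i)" and ?e = "real (deg j)"
        have dpos: "?d > 0" "?e > 0" using di dj by auto
        have "min_twice (enn2real (\<nu> (x i)) * ?e) (enn2real (\<nu> (x j)) * ?d) (t * real (int_num i j))"
          unfolding t_def using fin i j by (intro pair_data(4)[OF i 3 False \<nu>]) auto
        then have "enn2real (\<nu> (x j)) * ?d = min (enn2real (\<nu> (x i)) * ?e) (t * real (int_num i j))"
          using max[OF 3] by (auto simp: min_twice_def min_def)
        also have "\<dots> = min (t * ?d * ?e * c) (t * ?d * ?e * kap i j)"
          using dpos by (simp add: vc kap_def mult_ac)
        also have "\<dots> = t * ?d * ?e * min c (kap i j)"
          using t dpos by (simp add: min_def)
        finally show ?thesis using dpos False by (simp add: meet_def)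
      next
        case True
        then show ?thesis using vc by (simp add: meet_def mult.assoc)
      qed
      then show ?thesis using j by (simp add: trop_def interior_vec_def)
    qed (simp_all add: trop_def interior_vec_def t_def)
  qed
qed

text \<open>The valuation of the point \<open>(c, i)\<close> is largest also along the \<open>j\<close>-th segment if this segment
  passes through the point, so both segments give the same vector.\<close>

lemma interior_vec_same_point:
  assumes i: "i \<in> {1..m}" and j: "j \<in> {1..m}" and c: "c > 0" and le: "i \<noteq> j \<Longrightarrow> c \<le> kap i j"
    and kpos: "\<And>l. l \<in> {1..m} \<Longrightarrow> l \<noteq> i \<Longrightarrow> kap i l > 0"
  shows "interior_vec c j = interior_vec c i"
proof -
  obtain \<nu> where \<nu>: "semivaluation \<nu>" "\<nu> (x 0) = 1"
    "\<And>l. l \<in> {1..m} \<Longrightarrow> \<nu> (x l) = ennreal (real (deg l) * meet c i l)"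
    using trop_branch_valuation[OF i c] by blast
  have mc: "0 < meet c i l" "meet c i l \<le> c" if "l \<in> {1..m}" for l
    using c kpos[OF that] by (auto simp: meet_def)
  have mj: "meet c i j = c" using le by (auto simp: meet_def)
  have val: "enn2real (\<nu> (x l)) = real (deg l) * meet c i l" if "l \<in> {1..m}" for l
    using mc[OF that] \<nu>(3)[OF that] by simp
  have fin: "0 < \<nu> (x l) \<and> \<nu> (x l) < \<infinity>" if "l \<le> m" for l
    using that \<nu>(2) \<nu>(3)[of l] mc(1)[of l] deg_data(1)[of l] by (cases "l = 0") auto
  have max: "enn2real (\<nu> (x l)) * real (deg p) \<le> enn2real (\<nu> (x p)) * real (deg l)"
    if p: "p \<in> {1..m}" "meet c i p = c" and l: "l \<in> {1..m}" for p l
    using mult_left_mono[OF mc(2)[OF l], of "real (deg l) * real (deg p)"]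
    unfolding val[OF l] val[OF p(1)] p(2) by (simp add: mult_ac)
  have eq: "trop m x \<nu> = interior_vec c p" if p: "p \<in> {1..m}" "meet c i p = c" for p
  proof -
    let ?t = "enn2real (\<nu> (x 0))"
    have "trop m x \<nu> = (\<lambda>l. ?t * interior_vec (enn2real (\<nu> (x p)) / (?t * real (deg p))) p l)"
      by (rule trop_centered(3)[OF \<nu>(1) _ p(1)]) (use fin max[OF p] in auto)
    then show ?thesis
      unfolding val[OF p(1)] p(2) \<nu>(2) using deg_data(1)[OF p(1)] by simp
  qed
  show ?thesis using eq[OF j mj] eq[OF i] by (simp add: meet_def)
qed

text \<open>The contact of two branches is positive, as both pass through the origin.\<close>

lemma kap_pos:
  assumes i: "i \<in> {1..m}" and j: "j \<in> {1..m}" and ij: "i \<noteq> j"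
  shows "kap i j > 0"
proof -
  have "int_num i j \<noteq> 0"
  proof
    assume "int_num i j = 0"
    then have "intersection (x i) (x j) = 0" using pair_data(3)[OF i j ij] by (simp add: zero_enat_def)
    then have ex: "\<exists>B. quotient_basis (ideal2 (x i) (x j)) B"
      and "card (SOME B. quotient_basis (ideal2 (x i) (x j)) B) = 0"
      unfolding intersection_def quotient_dim_def by (auto simp: zero_enat_def split: if_splits)
    moreover have "quotient_basis (ideal2 (x i) (x j)) (SOME B. quotient_basis (ideal2 (x i) (x j)) B)"
      using ex by (rule someI_ex)
    ultimately have "quotient_basis (ideal2 (x i) (x j)) {}"
      using quotient_basisD(1)[OF _ k_subspace_ideal2] by (metis card_0_eq)
    from quotient_basisD(2)[OF this k_subspace_ideal2, of 1]
    obtain a b where ab: "1 = a * x i + b * x j" by (auto elim: ideal2E)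
    have "cf (x l) 0 0 = 0" if "l \<le> m" for l
      using irr[OF that] by (auto simp: Factorial_Ring.irreducible_def pseries_unit_iff)
    then have "cf (a * x i + b * x j) 0 0 = 0" using i j by simp
    then show False unfolding ab[symmetric] by (simp add: cf_1)
  qed
  then show ?thesis using deg_data(1)[OF i] deg_data(1)[OF j] by (simp add: kap_def)
qed

text \<open>Only a common interior point of two segments needs an argument, as the root always has the
  same vector and the leaves belong to a single segment.\<close>

lemma w_vec_class:
  assumes i: "i \<in> {1..m}"
  shows "w_vec m x (EW_rel m x `` {(c, i)}) = w_rep m x (c, i)"
proof -
  have "w_rep m x (c, j) = w_rep m x (c, i)"
    if j: "j \<in> {1..m}" and le: "c \<le> contact (x 0) (x i) (x j)" for j
  proof -
    consider "c = 0" | "c = \<infinity>" | r where "c = ennreal r" "r > 0"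
      by (cases c) (auto simp: zero_less_iff_neq_zero less_le)
    then show ?thesis
    proof cases
      case 2
      then have "i = j" using le contact_eq[OF i j] by (cases "i = j") (auto simp: top_unique)
      then show ?thesis by simp
    next
      case 3
      have "r \<le> kap i j" if "i \<noteq> j"
        using le that kap_nonneg[of i j] 3 by (simp add: contact_eq[OF i j])
      then have "interior_vec r j = interior_vec r i"
        using kap_pos[OF i] by (intro interior_vec_same_point[OF i j 3(2)]) auto
      then show ?thesis using w_rep_interior[OF _ 3(2)] i j 3(1) by metis
    qed simp
  qed
  then have "w_rep m x ` (EW_rel m x `` {(c, i)}) \<subseteq> {w_rep m x (c, i)}"
    by (auto simp: EW_rel_def)
  moreover have "(c, i) \<in> EW_rel m x `` {(c, i)}"
    using i contact_eq[OF i i] by (simp add: EW_rel_def)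
  ultimately have "w_rep m x ` (EW_rel m x `` {(c, i)}) = {w_rep m x (c, i)}" by blast
  then show ?thesis by (simp add: w_vec_def)
qed

lemma w_vec_image:
  "w_vec m x ` EW_tree m x =
     {unit_vec j | j. j \<le> m} \<union> {interior_vec c i | c i. c > 0 \<and> i \<in> {1..m}}"
proof -
  have "w_vec m x ` EW_tree m x = w_rep m x ` (UNIV \<times> {1..m})"
    unfolding EW_tree_eq image_image by (intro image_cong) (auto simp: w_vec_class)
  also have "\<dots> = {unit_vec j | j. j \<le> m} \<union> {interior_vec c i | c i. c > 0 \<and> i \<in> {1..m}}"
  proof (intro equalityI subsetI)
    fix v assume "v \<in> w_rep m x ` (UNIV \<times> {1..m})"
    then obtain c i where v: "v = w_rep m x (c, i)" and i: "i \<in> {1..m}" by auto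
    consider "c = 0" | "c = \<infinity>" | r where "c = ennreal r" "r > 0"
      by (cases c) (auto simp: less_le)
    then show "v \<in> {unit_vec j | j. j \<le> m} \<union> {interior_vec c i | c i. c > 0 \<and> i \<in> {1..m}}"
    proof cases
      case 3
      then show ?thesis using w_rep_interior[OF i] i v by blast
    qed (use i v in auto)
  next
    fix v assume "v \<in> {unit_vec j | j. j \<le> m} \<union> {interior_vec c i | c i. c > 0 \<and> i \<in> {1..m}}"
    then consider j where "v = unit_vec j" "j \<le> m" | c i where "v = interior_vec c i" "c > 0" "i \<in> {1..m}"
      by blast
    then show "v \<in> w_rep m x ` (UNIV \<times> {1..m})"
    proof cases
      case (1 j)
      show ?thesis
      proof (cases "j = 0")
        case True
        then show ?thesis using 1 m by (intro image_eqI[of _ _ "(0, 1)"]) auto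
      next
        case False
        then show ?thesis using 1 by (intro image_eqI[of _ _ "(\<infinity>, j)"]) auto
      qed
    next
      case (2 c i)
      then show ?thesis using w_rep_interior[OF 2(3,2)] by (intro image_eqI[of _ _ "(ennreal c, i)"]) auto
    qed
  qed
  finally show ?thesis .
qed

lemma x_in_maxideal: "j \<le> m \<Longrightarrow> x j \<in> maxideal"
  using irr[of j] by (simp add: maxideal_iff_nonunit Factorial_Ring.irreducible_def)

text \<open>A semivaluation that is finite on all branches vanishes on all of them, is positive on exactly
  one of them, or is positive on at least two of them and hence centered at the origin. These cases
  yield the origin, the rays of the ends, and the rays of the interior points.\<close>

theorem trop_eq_cone:
  "trop m x ` {\<nu>. semivaluation \<nu> \<and> (\<forall>j\<le>m. \<nu> (x j) < \<infinity>)} =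
     cone_over (w_vec m x ` EW_tree m x)" (is "trop m x ` ?U = ?C")
proof (intro equalityI subsetI)
  have coneI: "(\<lambda>j. a * v j) \<in> ?C" if "a > 0" "v \<in> w_vec m x ` EW_tree m x" for a v
    using that unfolding cone_over_def by blast
  fix y assume "y \<in> trop m x ` ?U"
  then obtain \<nu> where \<nu>: "semivaluation \<nu>" and fin: "\<And>j. j \<le> m \<Longrightarrow> \<nu> (x j) < \<infinity>"
    and y: "y = trop m x \<nu>" by auto
  consider (none) "\<And>j. j \<le> m \<Longrightarrow> \<nu> (x j) = 0"
    | (one) i where "i \<le> m" "\<nu> (x i) > 0" "\<And>j. j \<le> m \<Longrightarrow> j \<noteq> i \<Longrightarrow> \<nu> (x j) = 0"
    | (two) i j where "i \<le> m" "j \<le> m" "i \<noteq> j" "\<nu> (x i) > 0" "\<nu> (x j) > 0"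
    by (metis zero_less_iff_neq_zero)
  then show "y \<in> ?C"
  proof cases
    case none
    then have "y = (\<lambda>_. 0)" by (auto simp: y trop_def)
    then show ?thesis by (simp add: cone_over_def)
  next
    case (one i)
    let ?a = "enn2real (\<nu> (x i))"
    have "?a > 0" using one(1,2) fin by (simp add: enn2real_positive_iff)
    moreover have "y = (\<lambda>j. ?a * unit_vec i j)" using one by (auto simp: y trop_def unit_vec_def)
    ultimately show ?thesis using coneI[of ?a "unit_vec i"] one(1) w_vec_image by auto
  next
    case (two i j)
    have pos: "\<nu> (x l) > 0" if "l \<le> m" for l
      using semivaluation_centered[OF \<nu> irr[OF two(1)] irr[OF two(2)]
          distinct_branches[OF two(1,2,3)] two(4,5) x_in_maxideal[OF that]] .
    let ?h = "\<lambda>l. enn2real (\<nu> (x l)) / real (deg l)"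
    have "Max (?h ` {1..m}) \<in> ?h ` {1..m}" using m by (intro Max_in) auto
    then obtain p where p: "p \<in> {1..m}" "Max (?h ` {1..m}) = ?h p" by auto
    have "?h l \<le> ?h p" if "l \<in> {1..m}" for l
      unfolding p(2)[symmetric] using that by (intro Max_ge) auto
    then have max: "enn2real (\<nu> (x l)) * real (deg p) \<le> enn2real (\<nu> (x p)) * real (deg l)"
      if "l \<in> {1..m}" for l
      using that deg_data(1)[OF that] deg_data(1)[OF p(1)] by (fastforce simp: field_simps)
    have fin': "0 < \<nu> (x l) \<and> \<nu> (x l) < \<infinity>" if "l \<le> m" for l using pos fin that by blast
    note tc = trop_centered[OF \<nu> fin' p(1) max]
    show ?thesis
      unfolding y using coneI[OF tc(1)] tc(2,3) p(1) w_vec_image by auto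
  qed
next
  fix y assume "y \<in> ?C"
  then consider (zero) "y = (\<lambda>_. 0)" | (ray) a v where "a > 0" "v \<in> w_vec m x ` EW_tree m x" "y = (\<lambda>j. a * v j)"
    unfolding cone_over_def by blast
  then show "y \<in> trop m x ` ?U"
  proof cases
    case zero
    obtain \<nu> :: "'a pseries \<Rightarrow> ennreal" where \<nu>: "semivaluation \<nu>" "\<And>g. g \<noteq> 0 \<Longrightarrow> \<nu> g = 0"
      using trivial_valuation by blast
    have "\<nu> (x j) = 0" if "j \<le> m" for j
      using irr[OF that] \<nu>(2) by (simp add: Factorial_Ring.irreducible_def)
    then have "y = trop m x \<nu>" "\<nu> \<in> ?U" using zero \<nu>(1) by (auto simp: trop_def)
    then show ?thesis by blast
  next
    case (ray a v)
    consider i where "v = unit_vec i" "i \<le> m" | c i where "v = interior_vec c i" "c > 0" "i \<in> {1..m}"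
      using ray(2) unfolding w_vec_image by blast
    then show ?thesis
    proof cases
      case (1 i)
      obtain \<nu> where \<nu>: "semivaluation \<nu>" "\<nu> (x i) = ennreal a" "\<And>g. \<not> x i dvd g \<Longrightarrow> \<nu> g = 0"
        using order_valuation[OF irr[OF 1(2)] ray(1)] by blast
      have "\<nu> (x j) = (if j = i then ennreal a else 0)" if "j \<le> m" for j
        using \<nu>(2,3) distinct_branches[OF 1(2) that] by auto
      then have "y = trop m x \<nu>" "\<nu> \<in> ?U"
        using ray(1,3) 1 \<nu>(1) by (auto simp: trop_def unit_vec_def fun_eq_iff)
      then show ?thesis by blast
    next
      case (2 c i)
      obtain \<nu> where \<nu>: "semivaluation \<nu>" "\<nu> (x 0) = 1"
        "\<And>l. l \<in> {1..m} \<Longrightarrow> \<nu> (x l) = ennreal (real (deg l) * meet c i l)"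
        using trop_branch_valuation[OF 2(3,2)] by blast
      let ?\<mu> = "\<lambda>g. ennreal a * \<nu> g"
      have val: "?\<mu> (x l) = ennreal (a * interior_vec c i l)" if "l \<le> m" for l
      proof (cases "l = 0")
        case False
        have "meet c i l \<ge> 0" using 2(2) kap_nonneg by (simp add: meet_def)
        then show ?thesis using that False \<nu>(3)[of l] ray(1)
          by (simp add: interior_vec_def ennreal_mult)
      qed (simp add: \<nu>(2) interior_vec_def)
      have nn: "interior_vec c i l \<ge> 0" for l
        using 2(2) kap_nonneg by (simp add: interior_vec_def meet_def)
      have "y = trop m x ?\<mu>"
      proof
        fix j show "y j = trop m x ?\<mu> j"
          using val[of j] nn[of j] ray(1,3) 2(1) by (cases "j \<le> m") (auto simp: trop_def interior_vec_def)
      qed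
      moreover have "?\<mu> \<in> ?U" using semivaluation_scale[OF \<nu>(1) ray(1)] val by simp
      ultimately show ?thesis by blast
    qed
  qed
qed

end

section \<open>Strict transforms and exceptional divisors\<close>

lemma order_ge_chart: "order_ge 1 (varX * f :: 'a::field pseries)"
  using order_ge_mult[OF order_ge_varX, of 0 f] by simp

lemma pullback_Slope: "pullback (Slope t) varX = varX" "pullback (Slope t) varY = varX * (varY + cnst t)"
  using subst2_varX[OF order_ge_varX order_ge_chart] subst2_varY[OF order_ge_varX order_ge_chart]
  by simp_all

lemma pullback_Vertical: "pullback Vertical varX = varX * varY" "pullback Vertical varY = varY"
  using subst2_varX[OF order_ge_chart order_ge_varY] subst2_varY[OF order_ge_chart order_ge_varY]
  by simp_all

lemma endo_pullback: "endo (pullback d)"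
proof (cases d)
  case (Slope t)
  have "pullback d = (\<lambda>f. subst2 f varX (varX * (varY + cnst t)))" by (simp add: fun_eq_iff Slope)
  then show ?thesis using endo_subst2[OF order_ge_varX order_ge_chart] by simp
next
  case Vertical
  have "pullback d = (\<lambda>f. subst2 f (varX * varY) varY)" by (simp add: fun_eq_iff Vertical)
  then show ?thesis using endo_subst2[OF order_ge_chart order_ge_varY] by simp
qed

lemma exceptional_dvd_pullback: "exceptional d dvd pullback d varX" "exceptional d dvd pullback d varY"
  by (cases d; simp add: pullback_Slope pullback_Vertical del: pullback.simps)+

lemma varX_nonzero [simp]: "(varX :: 'a::field pseries) \<noteq> 0" and varY_nonzero [simp]: "(varY :: 'a pseries) \<noteq> 0"
  using cf_varX[of 1 0, where ?'a = 'a] cf_varY[of 0 1, where ?'a = 'a] by (metis cf_0 zero_neq_one)+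

lemma exceptional_nonzero [simp]: "exceptional d \<noteq> 0"
  by (cases d) auto

lemma strict1_eqI: "pullback d f = exceptional d ^ mult f * g \<Longrightarrow> strict1 d f = g"
  unfolding strict1_def by (rule the_equality) auto

lemma strict1_exists:
  assumes "f \<noteq> 0" shows "pullback d f = exceptional d ^ mult f * strict1 d f"
proof -
  have "exceptional d ^ mult f dvd pullback d f"
    by (rule endo_dvd_power[OF endo_pullback exceptional_dvd_pullback order_ge_mult_f[OF assms]])
  then obtain g where "pullback d f = exceptional d ^ mult f * g" by (rule dvdE)
  then show ?thesis using strict1_eqI by metis
qed

lemma strict1_unit_mult:
  assumes "u dvd 1" "f \<noteq> 0" shows "strict1 d (u * f) = pullback d u * strict1 d f"
proof (rule strict1_eqI)
  have "pullback d (u * f) = pullback d u * (exceptional d ^ mult f * strict1 d f)"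
    by (simp only: endo_simps(2)[OF endo_pullback] strict1_exists[OF assms(2), symmetric])
  then show "pullback d (u * f) = exceptional d ^ mult (u * f) * (pullback d u * strict1 d f)"
    unfolding mult_unit[OF assms(1)] by (simp only: mult.left_commute)
qed

lemma strict_unit_mult: "u dvd 1 \<Longrightarrow> \<exists>v. v dvd 1 \<and> strict p (u * f) = v * strict p f"
proof (induction p)
  case (Cons d p)
  then obtain v where v: "v dvd 1" "strict p (u * f) = v * strict p f" by blast
  show ?case
  proof (cases "strict p f = 0")
    case True
    then show ?thesis using v Cons.prems by (intro exI[of _ 1]) simp
  next
    case False
    then show ?thesis
      using v(2) strict1_unit_mult[OF v(1) False] endo_unit[OF endo_pullback v(1)] by auto
  qed
qed auto

lemma strict_same_curve:
  assumes "same_curve f g" shows "strict p f \<in> maxideal \<longleftrightarrow> strict p g \<in> maxideal"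
proof -
  obtain u where u: "g = f * u" using assms unfolding same_curve_def by (metis dvdE)
  obtain v where v: "f = g * v" using assms unfolding same_curve_def by (metis dvdE)
  obtain w where w: "w dvd 1" "g = w * f"
  proof (cases "f = 0")
    case True
    then have "g = 0" using u by (simp only: mult_zero_left)
    then show ?thesis using True that[of 1] by simp
  next
    case False
    have "f * (u * v) = (f * u) * v" by (simp only: mult.assoc)
    also have "\<dots> = f" by (simp only: u[symmetric] v[symmetric])
    finally have "f * (u * v) = f * 1" by simp
    then have "1 = u * v" unfolding mult_left_cancel[OF False] by simp
    then have "u dvd 1" by (rule dvdI)
    then show ?thesis by (rule that) (simp only: u mult.commute)
  qed
  obtain v where v: "v dvd 1" "strict p g = v * strict p f"
    using strict_unit_mult[OF w(1)] w(2) by blast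
  have "cf v 0 0 \<noteq> 0" using v(1) by (simp add: pseries_unit_iff)
  then show ?thesis by (simp add: maxideal_def v(2))
qed

lemma mult_varX: "mult (varX :: 'a::field pseries) = 1"
  by (subst mult_eq_1_nonzero_linear) (simp_all add: cf_varX)

lemma mult_varY: "mult (varY :: 'a::field pseries) = 1"
  by (subst mult_eq_1_nonzero_linear) (simp_all add: cf_varY)

lemma mult_of_unit: "u dvd 1 \<Longrightarrow> mult u = 0" for u :: "'a::field pseries"
  by (subst mult_eq_iff) (auto simp: pseries_unit_iff order_ge_def)

lemma strict1_unit: "u dvd 1 \<Longrightarrow> strict1 d u dvd 1"
proof -
  assume u: "u dvd 1"
  have "strict1 d u = pullback d u" by (rule strict1_eqI) (simp add: mult_of_unit[OF u])
  then show ?thesis using endo_unit[OF endo_pullback u] by simp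
qed

lemma strict1_axes:
  shows "strict1 (Slope t) varX = 1" "strict1 (Slope t) varY = varY + cnst t"
    "strict1 Vertical varX = varX" "strict1 Vertical varY = 1"
  by (rule strict1_eqI; simp add: mult_varX mult_varY pullback_Slope pullback_Vertical mult.commute
        del: pullback.simps)+

text \<open>The divisors whose strict transforms at \<open>p\<close> are the axes \<open>X = 0\<close> and \<open>Y = 0\<close>. No other
  exceptional divisor passes through \<open>p\<close>.\<close>

fun x_divisor y_divisor :: "'a::field inpoint \<Rightarrow> 'a inpoint option" where
  "x_divisor [] = None"
| "x_divisor (Slope t # p) = Some p"
| "x_divisor (Vertical # p) = x_divisor p"
| "y_divisor [] = None"
| "y_divisor (Slope t # p) = (if t = 0 then y_divisor p else None)"
| "y_divisor (Vertical # p) = Some p"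

lemma divisor_length:
  "x_divisor p = Some q \<Longrightarrow> length q < length p" "y_divisor p = Some q \<Longrightarrow> length q < length p"
proof (induction p)
  case (Cons d p)
  { case 1 then show ?case using Cons.IH(1) by (cases d) auto }
  { case 2 then show ?case using Cons.IH(2) by (cases d) (auto split: if_splits) }
qed auto

lemma divisors_distinct: "x_divisor p = Some q \<Longrightarrow> y_divisor p \<noteq> Some q"
proof (cases p)
  case (Cons d r)
  assume x: "x_divisor p = Some q"
  show ?thesis
  proof (cases d)
    case (Slope t)
    then show ?thesis using x divisor_length(2)[of r q] Cons by auto
  next
    case Vertical
    then show ?thesis using x divisor_length(1)[of r q] Cons by auto
  qed
qed auto

lemma divisor_eq_cases:
  "if x_divisor p = Some q then divisor_eq q p = varX
   else if y_divisor p = Some q then divisor_eq q p = varY else divisor_eq q p dvd 1"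
proof (induction p)
  case (Cons d p)
  show ?case
  proof (cases "p = q")
    case True
    then show ?thesis using divisor_length(1)[of p p] by (cases d) auto
  next
    case False
    have t: "(varY + cnst t :: 'a pseries) dvd 1 \<longleftrightarrow> t \<noteq> 0" for t
      by (simp add: pseries_unit_iff cf_varY cf_cnst)
    consider "x_divisor p = Some q" "divisor_eq q p = varX" "y_divisor p \<noteq> Some q"
      | "y_divisor p = Some q" "divisor_eq q p = varY" "x_divisor p \<noteq> Some q"
      | "x_divisor p \<noteq> Some q" "y_divisor p \<noteq> Some q" "divisor_eq q p dvd 1"
      using Cons.IH divisors_distinct[of p q] by (auto split: if_splits)
    then show ?thesis
    proof cases
      case 3
      then show ?thesis using False strict1_unit[OF 3(3), of d] by (cases d) auto
    qed (use False in \<open>cases d; auto simp: strict1_axes t\<close>)+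
  qed
qed simp

definition divisors_through :: "'a::field inpoint \<Rightarrow> 'a inpoint set" where
  "divisors_through p = {q. x_divisor p = Some q \<or> y_divisor p = Some q}"

lemma divisor_eq_maxideal_iff: "divisor_eq q p \<in> maxideal \<longleftrightarrow> q \<in> divisors_through p"
  using divisor_eq_cases[of p q]
  by (auto simp: divisors_through_def maxideal_iff_nonunit pseries_unit_iff cf_varX cf_varY split: if_splits)

lemma divisor_eq_nonzero: "divisor_eq q p \<noteq> 0"
  using divisor_eq_cases[of p q] by (auto split: if_splits)

section \<open>Maximal contact curves are distinct branches\<close>

text \<open>If both were the same curve, their divisors would meet at the point where it passes through
  the exceptional divisor, but that point is smooth on the exceptional divisor.\<close>

lemma curvettas_distinct:
  assumes f: "curvetta ps q f" and g: "curvetta ps q' g" and ne: "q \<noteq> q'"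
  shows "\<not> same_curve f g"
proof
  assume same: "same_curve f g"
  obtain p where p: "{p' \<in> points_over_O ps. strict p' f \<in> maxideal} = {p}" "divisor_eq q p \<in> maxideal"
    "mult (total_divisor_eq ps p) = 1" "q \<in> set ps"
    using f by (auto simp: curvetta_def)
  obtain p' where p': "{p' \<in> points_over_O ps. strict p' g \<in> maxideal} = {p'}" "divisor_eq q' p' \<in> maxideal"
    "q' \<in> set ps"
    using g by (auto simp: curvetta_def)
  have "p = p'" using p(1) p'(1) strict_same_curve[OF same] by auto
  let ?D = "\<lambda>r. divisor_eq r p"
  have "total_divisor_eq ps p = ?D q * (?D q' * (\<Prod>r\<in>set ps - {q} - {q'}. ?D r))"
    unfolding total_divisor_eq_def using p(4) p'(3) ne
    by (subst prod.remove[of _ q], simp, simp, subst prod.remove[of _ q'], auto)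
  moreover have "order_ge (1 + (1 + 0)) (?D q * (?D q' * (\<Prod>r\<in>set ps - {q} - {q'}. ?D r)))"
    using p(2) p'(2) \<open>p = p'\<close> by (intro order_ge_mult) (auto simp only: maxideal_iff order_ge_0)
  ultimately have "order_ge (Suc 1) (total_divisor_eq ps p)" by simp
  moreover have "total_divisor_eq ps p \<noteq> 0"
    by (simp add: total_divisor_eq_def divisor_eq_nonzero)
  ultimately show False using mult_eq_iff[of "total_divisor_eq ps p" 1] p(3) by blast
qed

section \<open>The dual graph of a model has two ends\<close>

lemma model_snoc:
  assumes "model (ps @ [p])"
  shows "model ps" "p \<notin> set ps" "p = [] \<or> tl p \<in> set ps"
proof -
  have d: "distinct (ps @ [p])" and t: "\<And>n. n < length (ps @ [p]) \<Longrightarrow>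
      (ps @ [p]) ! n = [] \<or> tl ((ps @ [p]) ! n) \<in> set (take n (ps @ [p]))"
    using assms by (auto simp: model_def)
  show "p \<notin> set ps" using d by simp
  show "p = [] \<or> tl p \<in> set ps" using t[of "length ps"] by simp
  show "model ps"
    unfolding model_def
  proof (intro conjI allI impI)
    show "distinct ps" using d by simp
    fix n assume "n < length ps"
    then show "ps ! n = [] \<or> tl (ps ! n) \<in> set (take n ps)" using t[of n] by (simp add: nth_append)
  qed
qed

lemma model_closed: "model ps \<Longrightarrow> q \<in> set ps \<Longrightarrow> q = [] \<or> tl q \<in> set ps"
proof (induction ps rule: rev_induct)
  case (snoc p ps)
  then show ?case using model_snoc[OF snoc.prems(1)] by auto
qed simp

lemma divisors_through_Cons:
  "divisors_through (Slope t # p) = insert p (if t = 0 then set_option (y_divisor p) else {})"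
  "divisors_through (Vertical # p) = insert p (set_option (x_divisor p))"
  by (auto simp: divisors_through_def)

lemma divisors_through_subset: "divisors_through (d # p) \<subseteq> insert p (divisors_through p)"
  by (cases d) (auto simp: divisors_through_def split: if_splits)

lemma divisors_through_model:
  assumes "model ps" shows "p \<in> set ps \<Longrightarrow> divisors_through p \<subseteq> set ps"
proof (induction p)
  case (Cons d p)
  then have "p \<in> set ps" using model_closed[OF assms] by fastforce
  then show ?case using Cons.IH divisors_through_subset[of d p] by auto
qed (simp add: divisors_through_def)

lemma divisors_through_point:
  assumes "model ps" "p \<in> points_over_O ps" shows "divisors_through p \<subseteq> set ps"
proof (cases p)
  case (Cons d r)
  then have "r \<in> set ps" using assms(2) by (simp add: points_over_O_def)
  then show ?thesis
    using divisors_through_model[OF assms(1)] divisors_through_subset[of d r] Cons by blast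
qed (simp add: divisors_through_def)

text \<open>The divisor created last among two that meet comes from blowing up a point \<open>r\<close> of the other
  one, and the direction of the other one at \<open>r\<close> determines the point where they meet.\<close>

lemma crossing_unique:
  assumes "a \<noteq> b" "a \<in> divisors_through p" "b \<in> divisors_through p"
    "a \<in> divisors_through p'" "b \<in> divisors_through p'"
  shows "p = p'"
proof -
  have newest: "\<exists>d r s. p = d # r \<and> {a, b} = {r, s} \<and> length s < length r \<and>
     (d = Vertical \<and> x_divisor r = Some s \<or> d = Slope 0 \<and> y_divisor r = Some s)"
    if "a \<in> divisors_through p" "b \<in> divisors_through p" for p
  proof (cases p)
    case (Cons d r)
    show ?thesis
    proof (cases d)
      case (Slope t)
      then have "t = 0" using that assms(1) Cons by (auto simp: divisors_through_Cons split: if_splits)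
      then have "a \<in> insert r (set_option (y_divisor r))" "b \<in> insert r (set_option (y_divisor r))"
        using that Cons Slope by (auto simp: divisors_through_Cons)
      then obtain s where s: "y_divisor r = Some s" "{a, b} = {r, s}"
        using assms(1) by (cases "y_divisor r") auto
      then show ?thesis using Cons Slope \<open>t = 0\<close> divisor_length(2)[OF s(1)] by blast
    next
      case Vertical
      then have "a \<in> insert r (set_option (x_divisor r))" "b \<in> insert r (set_option (x_divisor r))"
        using that Cons by (auto simp: divisors_through_Cons)
      then obtain s where s: "x_divisor r = Some s" "{a, b} = {r, s}"
        using assms(1) by (cases "x_divisor r") auto
      then show ?thesis using Cons Vertical divisor_length(1)[OF s(1)] by blast
    qed
  qed (use that in \<open>simp add: divisors_through_def\<close>)
  obtain d r s where p: "p = d # r" "{a, b} = {r, s}" "length s < length r"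
    "d = Vertical \<and> x_divisor r = Some s \<or> d = Slope 0 \<and> y_divisor r = Some s"
    using newest[OF assms(2,3)] by blast
  obtain d' r' s' where p': "p' = d' # r'" "{a, b} = {r', s'}" "length s' < length r'"
    "d' = Vertical \<and> x_divisor r' = Some s' \<or> d' = Slope 0 \<and> y_divisor r' = Some s'"
    using newest[OF assms(4,5)] by blast
  have "r = r' \<and> s = s'" using p(2,3) p'(2,3) by (auto simp: doubleton_eq_iff)
  then show ?thesis using p(1,4) p'(1,4) divisors_distinct[of r s] by auto
qed

lemma adjacent_iff:
  "adjacent ps q r \<longleftrightarrow> q \<in> set ps \<and> r \<in> set ps \<and> q \<noteq> r \<and>
     (\<exists>p\<in>points_over_O ps. q \<in> divisors_through p \<and> r \<in> divisors_through p)"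
  by (simp add: adjacent_def divisor_eq_maxideal_iff)

lemma adjacent_sym: "adjacent qs q r \<longleftrightarrow> adjacent qs r q"
  by (auto simp: adjacent_iff)

context
  fixes ps :: "'a::field inpoint list" and p :: "'a inpoint"
  assumes mod: "model (ps @ [p])" and ne: "ps \<noteq> []"
begin

lemma root_in_model: "[] \<in> set ps"
proof -
  have "model ps" by (rule model_snoc(1)[OF mod])
  then have "ps ! 0 = []" using ne by (auto simp: model_def dest: spec[of _ 0])
  then show ?thesis using ne by (metis length_greater_0_conv nth_mem)
qed

lemma new_point: "p \<notin> set ps" "p \<noteq> []" "tl p \<in> set ps" "p \<in> points_over_O ps"
  using model_snoc[OF mod] root_in_model by (auto simp: points_over_O_def)

lemma points_over_O_snoc:
  "points_over_O (ps @ [p]) = (points_over_O ps - {p}) \<union> range (\<lambda>d. d # p)"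
proof -
  have closed: "d # p \<notin> set ps" for d
    using model_closed[OF model_snoc(1)[OF mod], of "d # p"] new_point(1) by auto
  have "z \<in> range (\<lambda>d. d # p) \<longleftrightarrow> z \<noteq> [] \<and> tl z = p" for z
    by (cases z) auto
  then show ?thesis using closed new_point(2,3) root_in_model
    by (auto simp: points_over_O_def)
qed

lemma adjacent_new: "adjacent (ps @ [p]) p r \<longleftrightarrow> r \<in> divisors_through p"
proof
  assume "adjacent (ps @ [p]) p r"
  then obtain z where z: "z \<in> points_over_O (ps @ [p])" "p \<in> divisors_through z" "r \<in> divisors_through z" "r \<noteq> p"
    by (auto simp: adjacent_iff)
  have "z \<notin> points_over_O ps"
    using divisors_through_point[OF model_snoc(1)[OF mod]] z(2) new_point(1) by blast
  then obtain d where "z = d # p" using z(1) points_over_O_snoc by auto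
  then show "r \<in> divisors_through p" using z(3,4) divisors_through_subset[of d p] by auto
next
  assume r: "r \<in> divisors_through p"
  then have "r \<in> set ps" using divisors_through_point[OF model_snoc(1)[OF mod] new_point(4)] by blast
  moreover obtain d where "r \<in> divisors_through (d # p)" "p \<in> divisors_through (d # p)"
  proof (cases "x_divisor p = Some r")
    case True
    then show ?thesis using that[of Vertical] by (simp add: divisors_through_Cons)
  next
    case False
    then show ?thesis using that[of "Slope 0"] r by (simp add: divisors_through_Cons divisors_through_def)
  qed
  ultimately show "adjacent (ps @ [p]) p r"
    using new_point(1) points_over_O_snoc by (auto simp: adjacent_iff)
qed

lemma adjacent_old:
  assumes "q \<in> set ps" "r \<in> set ps"
  shows "adjacent (ps @ [p]) q r \<longleftrightarrow>
    adjacent ps q r \<and> \<not> (q \<in> divisors_through p \<and> r \<in> divisors_through p)"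
proof
  assume "adjacent (ps @ [p]) q r"
  then obtain z where z: "z \<in> points_over_O (ps @ [p])" "q \<in> divisors_through z" "r \<in> divisors_through z" "q \<noteq> r"
    by (auto simp: adjacent_iff)
  have "q \<noteq> p" "r \<noteq> p" using assms new_point(1) by auto
  have "z \<notin> range (\<lambda>d. d # p)"
  proof
    assume "z \<in> range (\<lambda>d. d # p)"
    then obtain d where "z = d # p" by blast
    then show False using z(2-4) \<open>q \<noteq> p\<close> \<open>r \<noteq> p\<close>
      by (cases d) (auto simp: divisors_through_Cons split: if_splits)
  qed
  then have zp: "z \<in> points_over_O ps" "z \<noteq> p" using z(1) points_over_O_snoc by auto
  then have "adjacent ps q r" unfolding adjacent_iff using z(2-4) assms by blast
  moreover have "\<not> (q \<in> divisors_through p \<and> r \<in> divisors_through p)"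
    using crossing_unique[OF z(4,2,3), of p] zp(2) by blast
  ultimately show "adjacent ps q r \<and> \<not> (q \<in> divisors_through p \<and> r \<in> divisors_through p)"
    by blast
next
  assume *: "adjacent ps q r \<and> \<not> (q \<in> divisors_through p \<and> r \<in> divisors_through p)"
  then obtain z where "z \<in> points_over_O ps" "q \<in> divisors_through z" "r \<in> divisors_through z" "q \<noteq> r"
    by (auto simp: adjacent_iff)
  moreover from this have "z \<noteq> p" using * by blast
  ultimately show "adjacent (ps @ [p]) q r"
    unfolding adjacent_iff points_over_O_snoc using assms by auto
qed

lemma neighbours_old:
  assumes q: "q \<in> set ps"
  shows "q \<notin> divisors_through p \<Longrightarrow> {r. adjacent (ps @ [p]) q r} = {r. adjacent ps q r}"
    and "q \<in> divisors_through p \<Longrightarrow>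
      {r. adjacent (ps @ [p]) q r} = insert p ({r. adjacent ps q r} - divisors_through p)"
proof -
  have sub: "adjacent qs q r \<Longrightarrow> r \<in> set qs" for qs r by (simp add: adjacent_iff)
  have new: "adjacent (ps @ [p]) q p \<longleftrightarrow> q \<in> divisors_through p"
    using adjacent_new adjacent_sym by blast
  have old: "adjacent (ps @ [p]) q r \<longleftrightarrow>
      adjacent ps q r \<and> \<not> (q \<in> divisors_through p \<and> r \<in> divisors_through p)" if "r \<noteq> p" for r
    using adjacent_old[OF q, of r] sub[of "ps @ [p]" r] sub[of ps r] that by auto
  have np: "\<not> adjacent ps q p" using sub new_point(1) by blast
  show "{r. adjacent (ps @ [p]) q r} = {r. adjacent ps q r}" if "q \<notin> divisors_through p"
  proof (rule Collect_cong)
    fix r show "adjacent (ps @ [p]) q r \<longleftrightarrow> adjacent ps q r"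
      using new old[of r] np that by (cases "r = p") simp_all
  qed
  show "{r. adjacent (ps @ [p]) q r} = insert p ({r. adjacent ps q r} - divisors_through p)"
    if "q \<in> divisors_through p"
  proof (rule Set.set_eqI)
    fix r
    show "r \<in> {r. adjacent (ps @ [p]) q r} \<longleftrightarrow> r \<in> insert p ({r. adjacent ps q r} - divisors_through p)"
      using new old[of r] that by (cases "r = p") simp_all
  qed
qed

end

text \<open>Blowing up a crossing of two divisors subdivides an edge, which preserves the ends. Blowing up
  any other point adds a new end next to one old vertex, and only that vertex can stop being an
  end.\<close>

lemma two_ends:
  "model ps \<Longrightarrow> length ps \<ge> 2 \<Longrightarrow> card {q \<in> set ps. is_end ps q} \<ge> 2"
proof (induction ps rule: rev_induct)
  case (snoc p ps)
  then have ne: "ps \<noteq> []" by auto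
  note mod = snoc.prems(1)
  note model_ps = model_snoc(1)[OF mod]
  note np = new_point[OF mod ne]
  let ?E = "{q \<in> set ps. is_end ps q}" and ?E' = "{q \<in> set (ps @ [p]). is_end (ps @ [p]) q}"
  have through: "divisors_through p \<subseteq> set ps" by (rule divisors_through_point[OF model_ps np(4)])
  obtain d r where pr: "p = d # r" using np(2) by (cases p) auto
  have r1: "r \<in> set ps" using np(3) by (simp add: pr)
  have r2: "r \<in> divisors_through p" by (cases d) (auto simp: pr divisors_through_Cons)
  note r = r1 r2
  have fin: "finite {s. adjacent ps q s}" for q
    by (rule finite_subset[of _ "set ps"]) (auto simp: adjacent_iff)
  have keep: "q \<in> ?E'" if "q \<in> ?E" "q \<notin> divisors_through p" for q
    using that neighbours_old(1)[OF mod ne, of q] by (auto simp: is_end_def)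
  show ?case
  proof (cases "divisors_through p = {r}")
    case True
    have "{s. adjacent (ps @ [p]) p s} = {r}" using adjacent_new[OF mod ne] True by simp
    then have p_end: "p \<in> ?E'" by (simp add: is_end_def)
    show ?thesis
    proof (cases "length ps \<ge> 2")
      case True
      then have "card ?E \<ge> 2" using snoc.IH model_ps by blast
      moreover have "card (?E - {r}) \<ge> card ?E - 1"
      proof (cases "r \<in> ?E")
        case True
        then show ?thesis by (simp only: card_Diff_singleton order_refl)
      next
        case False
        then have "?E - {r} = ?E" by blast
        then show ?thesis by simp
      qed
      ultimately have "card (?E - {r}) \<ge> 1" by linarith
      moreover have "p \<notin> ?E - {r}" using np(1) by simp
      ultimately have "card (insert p (?E - {r})) \<ge> 2" by simp
      moreover have "insert p (?E - {r}) \<subseteq> ?E'"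
        using keep p_end \<open>divisors_through p = {r}\<close> by auto
      then have "card (insert p (?E - {r})) \<le> card ?E'" by (intro card_mono) auto
      ultimately show ?thesis by linarith
    next
      case False
      moreover have "length ps \<noteq> 0" using ne by simp
      ultimately have "length ps = 1" by linarith
      then obtain a where "ps = [a]" by (auto simp: length_Suc_conv)
      then have ps: "ps = [r]" using r(1) by simp
      then have "{s. adjacent ps r s} = {}" by (auto simp: adjacent_iff)
      then have "{s. adjacent (ps @ [p]) r s} = {p}" using neighbours_old(2)[OF mod ne r] by simp
      then have "r \<in> ?E'" using r(1) by (simp add: is_end_def)
      moreover have "r \<noteq> p" using r(1) np(1) by auto
      ultimately have "card {r, p} \<le> card ?E'" using p_end by (intro card_mono) auto
      then show ?thesis using \<open>r \<noteq> p\<close> by simp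
    qed
  next
    case False
    then obtain s where s: "s \<in> divisors_through p" "s \<noteq> r" using r(2) by auto
    have two: "divisors_through p = {r, s}"
      using r(2) s by (auto simp: divisors_through_def)
    have "s \<in> set ps" using s(1) through by blast
    then have "card {r, s} \<le> card (set ps)" using r(1) by (intro card_mono) auto
    then have "length ps \<ge> 2" using s(2) card_length[of ps] by simp
    then have IH: "card ?E \<ge> 2" using snoc.IH model_ps by blast
    have rs: "adjacent ps r s" using r s(2) s(1) \<open>s \<in> set ps\<close> np(4) by (auto simp: adjacent_iff)
    have "q \<in> ?E'" if q: "q \<in> ?E" for q
    proof (cases "q \<in> divisors_through p")
      case True
      let ?N = "{t. adjacent ps q t}"
      let ?q = "if q = r then s else r"
      have q': "?N \<inter> divisors_through p = {?q}"
        using True rs s(2) adjacent_sym[of ps r s] unfolding two by (auto simp: adjacent_iff)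
      then have "?N - divisors_through p = ?N - {?q}" "?q \<in> ?N" by blast+
      then have N: "card (?N - divisors_through p) = card ?N - 1" by (simp add: card_Diff_singleton)
      have "card (insert p (?N - divisors_through p)) = Suc (card (?N - divisors_through p))"
        using fin np(1) by (intro card_insert_disjoint) (auto simp: adjacent_iff)
      also note N
      finally have "card {t. adjacent (ps @ [p]) q t} = 1"
        using q neighbours_old(2)[OF mod ne _ True] by (simp add: is_end_def)
      then show ?thesis using q by (simp add: is_end_def)
    qed (use keep q in blast)
    then have "card ?E \<le> card ?E'" by (intro card_mono) auto
    then show ?thesis using IH by simp
  qed
qed simp

section \<open>The theorem\<close>

lemma smooth_branch_irreducible:
  fixes f :: "'a::field pseries"
  assumes "smooth_branch f" shows "Factorial_Ring.irreducible f"
proof (rule Factorial_Ring.irreducibleI)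
  have f: "f \<noteq> 0" "\<not> order_ge (Suc 1) f" "cf f 0 0 = 0"
    using assms mult_eq_iff[of f 1] mult_eq_1_nonzero_linear[of f] by (auto simp: smooth_branch_def)
  show "f \<noteq> 0" "\<not> f dvd 1" using f by (simp_all add: pseries_unit_iff)
  fix p q assume pq: "f = p * q"
  show "p dvd 1 \<or> q dvd 1"
  proof (rule ccontr)
    assume "\<not> (p dvd 1 \<or> q dvd 1)"
    then have "order_ge 1 p" "order_ge 1 q" by (simp_all only: pseries_unit_iff order_ge_1_iff de_Morgan_disj not_not)
    from order_ge_mult[OF this] show False using f(2) pq by simp
  qed
qed

text \<open>The equations of a cross have linearly independent linear parts, as the coordinates are
  combinations of them.\<close>

lemma cross_branches:
  fixes f g :: "'a::field pseries"
  assumes "cross f g" shows "smooth_branch f" "smooth_branch g" "\<not> f dvd g"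
proof -
  have I: "ideal2 f g = maxideal" using assms by (simp add: cross_def)
  have f0: "cf f 0 0 = 0" and g0: "cf g 0 0 = 0" using ideal2_gens[of f g] ideal2_gens[of g f] I ideal2_commute[of f g]
    by (auto simp: maxideal_def)
  have "varX \<in> ideal2 f g" "varY \<in> ideal2 f g" unfolding I by (simp_all add: maxideal_def cf_varX cf_varY)
  then obtain a b c d where X: "varX = a * f + b * g" and Y: "varY = c * f + d * g" by (metis ideal2E)
  have lin: "cf (p * h) 1 0 = cf p 0 0 * cf h 1 0" "cf (p * h) 0 1 = cf p 0 0 * cf h 0 1"
    if "cf h 0 0 = 0" for p h :: "'a pseries"
    using that by (simp_all add: cf_mult)
  let ?a = "cf a 0 0" and ?b = "cf b 0 0" and ?c = "cf c 0 0" and ?d = "cf d 0 0"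
  have e: "?a * cf f 1 0 + ?b * cf g 1 0 = 1" "?a * cf f 0 1 + ?b * cf g 0 1 = 0"
    "?c * cf f 1 0 + ?d * cf g 1 0 = 0" "?c * cf f 0 1 + ?d * cf g 0 1 = 1"
    using arg_cong[OF X, of "\<lambda>h. cf h 1 0"] arg_cong[OF X, of "\<lambda>h. cf h 0 1"]
      arg_cong[OF Y, of "\<lambda>h. cf h 1 0"] arg_cong[OF Y, of "\<lambda>h. cf h 0 1"]
    unfolding cf_add lin[OF f0] lin[OF g0] by (simp_all add: cf_varX cf_varY)
  have det: "cf f 1 0 * cf g 0 1 - cf f 0 1 * cf g 1 0 \<noteq> 0"
  proof
    assume 0: "cf f 1 0 * cf g 0 1 - cf f 0 1 * cf g 1 0 = 0"
    have "1 = (?a * cf f 1 0 + ?b * cf g 1 0) * (?c * cf f 0 1 + ?d * cf g 0 1)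
        - (?a * cf f 0 1 + ?b * cf g 0 1) * (?c * cf f 1 0 + ?d * cf g 1 0)" by (simp only: e) simp
    also have "\<dots> = (?a * ?d - ?b * ?c) * (cf f 1 0 * cf g 0 1 - cf f 0 1 * cf g 1 0)"
      by (simp add: algebra_simps)
    finally show False using 0 by simp
  qed
  then have nz: "f \<noteq> 0" "g \<noteq> 0" by auto
  show "smooth_branch f" "smooth_branch g"
    unfolding smooth_branch_def mult_eq_1_nonzero_linear[OF nz(1)] mult_eq_1_nonzero_linear[OF nz(2)]
    using nz f0 g0 det by auto
  show "\<not> f dvd g"
  proof
    assume "f dvd g"
    then obtain h where "g = h * f" by (metis dvdE mult.commute)
    then show False using det lin[OF f0, of h] by (simp add: algebra_simps)
  qed
qed


theorem theorem3p18:
  fixes f :: "'k::alg_closed_field pseries"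
    and ps :: "'k inpoint list"
    and m :: nat
    and x :: "nat \<Rightarrow> 'k pseries"
  assumes "reduced_curve f" and "singular_curve f"
    and "minimal_embedded_resolution ps f"
    and "maximal_contact_curves ps m x"
    and "smooth_curve (x 0)"
    and "generic_for ps m x f"
  shows "trop m x ` {\<nu>. semivaluation \<nu> \<and> (\<forall>j\<le>m. \<nu> (x j) < \<infinity>)} =
           cone_over (w_vec m x ` EW_tree m x)"
proof -
  have model: "model ps"
    using assms(3) by (simp add: minimal_embedded_resolution_def embedded_resolution_def)
  have "branch_family m x"
  proof (cases "length ps \<le> 1")
    case True
    then have m: "m = 1" and cross: "cross (x 0) (x 1)"
      using assms(4) by (auto simp: maximal_contact_curves_def)
    then have cross': "cross (x 1) (x 0)" by (simp add: cross_def ideal2_commute)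
    have le: "i = 0 \<or> i = 1" if "i \<le> m" for i using that m by auto
    show ?thesis
    proof
      show "m \<ge> 1" "smooth_branch (x 0)" using m cross_branches(1)[OF cross] by simp_all
      show "Factorial_Ring.irreducible (x i)" if "i \<le> m" for i
        using le[OF that] cross_branches(1,2)[OF cross] smooth_branch_irreducible by auto
      show "\<not> x i dvd x j" if "i \<le> m" "j \<le> m" "i \<noteq> j" for i j
        using le[OF that(1)] le[OF that(2)] that(3) cross_branches(3)[OF cross] cross_branches(3)[OF cross']
        by auto
    qed
  next
    case False
    let ?es = "filter (is_end ps) ps"
    have es: "length ?es = m + 1" and curv: "\<And>i. i \<le> m \<Longrightarrow> curvetta ps (?es ! i) (x i)"
      using assms(4) False by (auto simp: maximal_contact_curves_def)
    have dist: "distinct ?es" using model by (simp add: model_def)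
    have "card (set ?es) \<ge> 2" using two_ends[OF model] False by (simp add: Collect_conj_eq)
    then have m: "m \<ge> 1" using distinct_card[OF dist] es by simp
    have irr: "Factorial_Ring.irreducible (x i)" if "i \<le> m" for i
      using curv[OF that] by (simp add: curvetta_def)
    show ?thesis
    proof
      show "m \<ge> 1" by (rule m)
      show "smooth_branch (x 0)"
        using irr[of 0] assms(5)
        by (simp add: smooth_branch_def smooth_curve_def Factorial_Ring.irreducible_def)
      show "Factorial_Ring.irreducible (x i)" if "i \<le> m" for i by (rule irr[OF that])
      show "\<not> x i dvd x j" if ij: "i \<le> m" "j \<le> m" "i \<noteq> j" for i j
      proof
        assume dvd: "x i dvd x j"
        then obtain u where u: "x j = x i * u" by (rule dvdE)
        have "\<not> x i dvd 1" using irr[OF ij(1)] by (simp add: Factorial_Ring.irreducible_def)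
        then have "u dvd 1" using irreducible_unit_factor[of "x i" u] irr[OF ij(2)] u by simp
        then have "x j dvd x i" using unit_mult_dvd[of u "x i" "x i"] by (simp add: u mult.commute)
        then have "same_curve (x i) (x j)" using dvd by (simp add: same_curve_def)
        moreover have "?es ! i \<noteq> ?es ! j" using ij es dist by (simp add: nth_eq_iff_index_eq)
        ultimately show False using curvettas_distinct curv ij by blast
      qed
    qed
  qed
  then show ?thesis by (rule branch_family.trop_eq_cone)
qed

end
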